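(* Let $u$ be a (positive) harmonic function on a three-dimensional oriented real-analytic Riemannian manifold $(N,h)$. Let $B$ be a (local) solution of the monopole equation $du=*dB$ and let $w$ be a function on $N$ satisfying $$(\mathrm{grad}\,w)(u)=bu^3+aB^{\sharp}(u),$$ $$\nabla_{\mathrm{grad}\,w}du=-u^{-1}|du|^2(dw-aB)+\tfrac52\,bu^2du-a[\mathrm{grad}\,u,B^{\sharp}]^{\flat}+\tfrac12\,a(\mathcal{L}_{B^{\sharp}}h)(\mathrm{grad}\,u,\cdot),$$ $$\nabla dw=\tfrac12\,a\,\mathcal{L}_{B^{\sharp}}h-\tfrac12\,bu^2h+2u^{-1}du\odot(dw-aB),$$ where $a,b\in\mathbb{R}$, $b\neq0$. Then, locally on $N$, there exist functions $v$ and $f_0$, unique up to constants, such that if $(M,g)$ is given by $(N,h)$, $u$ and $A=B+dv$, through the Gibbons--Hawking construction, and $$E=\bigl(f_0-at+\tfrac14\,b\,t^2\bigr)\frac{\partial}{\partial t}+tF,$$ where $F$ is the horizontal lift of $u^{-2}(\mathrm{grad}\,w-aB^{\sharp})$, then the following assertions are equivalent: (i) $E$ is a soliton flow on $(M,g)$, with the corresponding constant $a$; (ii) $\mathrm{Ric}_N+a\,u\,h-u^{-1}A\odot(dw-aB)=0$. Moreover, any soliton flow on a real-analytic Riemannian manifold, given by the Gibbons--Hawking construction (with $u$ nonconstant), is obtained this way, if its horizontal part is $t$ times a nonzero basic vector field.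
   Context: A vector field $E$ on a Riemannian manifold $(M,g)$ is a soliton flow with corresponding constant $a\in\mathbb{R}$ if $\mathrm{Ric}_M+a\,g+\tfrac12\mathcal{L}_E g=0$. Gibbons--Hawking construction: $(N,h)$ is an oriented $3$-dimensional Riemannian manifold, $u$ a positive function and $A$ a one-form on $N$ satisfying the monopole equation $du=*dA$ (so $u$ is harmonic), $M=N\times\mathbb{R}$ with coordinate $t$ on $\mathbb{R}$, and $g=u\,h+u^{-1}(dt+A)^2$. Standing assumption: $dA$ (equivalently $du$) is nowhere zero. The horizontal distribution is $\ker(dt+A)$; the horizontal lift of a vector field $S$ on $N$ is $S-A(S)\frac{\partial}{\partial t}$; a basic vector field is the horizontal lift of a vector field on $N$. Notation: $\nabla$ is the Levi-Civita connection of $(N,h)$, $\mathrm{Ric}_N$ its Ricci tensor, $*$ its Hodge star operator; $\mathcal{L}$ is the Lie derivative; $\sharp,\flat$ are the musical isomorphisms of $h$; for a vector field $S$, $S(u)=du(S)$; $\alpha\odot\beta=\tfrac12(\alpha\otimes\beta+\beta\otimes\alpha)$ is the symmetric product of one-forms.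
   Formalization: "Unique up to constants" fails if read as uniqueness among all v, f_0 with (i)⇔(ii), since both may be false; it is stated for pairs where the soliton equation holds whenever one argument is ∂/∂t (so for all pairs satisfying (i)), and the pair found has this property. *)

theory Defs
  imports "HOL-Analysis.Analysis"
begin

section \<open>Smooth and real-analytic maps on open subsets of a Euclidean space\<close>

fun Ck_on :: "nat \<Rightarrow> 'e::euclidean_space set \<Rightarrow> ('e \<Rightarrow> 'b::real_normed_vector) \<Rightarrow> bool" where
  "Ck_on 0 D f \<longleftrightarrow> continuous_on D f"
| "Ck_on (Suc k) D f \<longleftrightarrow>
     (\<forall>x\<in>D. f differentiable (at x)) \<and> (\<forall>v. Ck_on k D (\<lambda>x. frechet_derivative f (at x) v))"

definition smooth_on :: "'e::euclidean_space set \<Rightarrow> ('e \<Rightarrow> 'b::real_normed_vector) \<Rightarrow> bool" where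
  "smooth_on D f \<longleftrightarrow> (\<forall>k. Ck_on k D f)"

text \<open>A real-analytic map is smooth and locally the sum of a power series; smoothness follows from
  the second property and is included for convenience. A multi-index is an extensional function
  from the standard basis to the natural numbers.\<close>

definition real_analytic_on :: "'e::euclidean_space set \<Rightarrow> ('e \<Rightarrow> 'b::real_normed_vector) \<Rightarrow> bool" where
  "real_analytic_on D f \<longleftrightarrow> smooth_on D f \<and>
     (\<forall>x\<in>D. \<exists>r>0. \<exists>c :: ('e \<Rightarrow> nat) \<Rightarrow> 'b. \<forall>y\<in>ball x r.
        ((\<lambda>m. (\<Prod>e\<in>Basis. ((y - x) \<bullet> e) ^ m e) *\<^sub>R c m) has_sum f y) (Basis \<rightarrow>\<^sub>E UNIV))"


section \<open>Tensor calculus on an open subset of a Euclidean space\<close>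

text \<open>Here a vector field is a map 'e => 'e, a one-form is \<open>\<alpha> x v\<close> (linear in \<open>v\<close>), and a
  two-tensor is \<open>G x v w\<close> (bilinear in \<open>v\<close>, \<open>w\<close>). These are the components of the corresponding
  objects of a manifold in a chart, and all formulas are the usual component formulas.\<close>

definition diff :: "('e::real_normed_vector \<Rightarrow> 'b::real_normed_vector) \<Rightarrow> 'e \<Rightarrow> 'e \<Rightarrow> 'b" where
  "diff f x v = frechet_derivative f (at x) v"

definition sharp :: "('e \<Rightarrow> 'e \<Rightarrow> real) \<Rightarrow> ('e \<Rightarrow> real) \<Rightarrow> 'e" where
  "sharp g \<alpha> = (THE s. \<forall>v. g s v = \<alpha> v)"

definition sym_prod :: "('e \<Rightarrow> real) \<Rightarrow> ('e \<Rightarrow> real) \<Rightarrow> 'e \<Rightarrow> 'e \<Rightarrow> real" where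
  "sym_prod \<alpha> \<beta> v w = (\<alpha> v * \<beta> w + \<beta> v * \<alpha> w) / 2"

definition grad :: "('e::real_normed_vector \<Rightarrow> 'e \<Rightarrow> 'e \<Rightarrow> real) \<Rightarrow> ('e \<Rightarrow> real) \<Rightarrow> 'e \<Rightarrow> 'e" where
  "grad G f x = sharp (G x) (diff f x)"

definition sharp_field :: "('e \<Rightarrow> 'e \<Rightarrow> 'e \<Rightarrow> real) \<Rightarrow> ('e \<Rightarrow> 'e \<Rightarrow> real) \<Rightarrow> 'e \<Rightarrow> 'e" where
  "sharp_field G \<alpha> x = sharp (G x) (\<alpha> x)"

text \<open>The convention is \<open>d\<alpha>(X,Y) = X(\<alpha>(Y)) - Y(\<alpha>(X)) - \<alpha>([X,Y])\<close>, without a factor 1/2.\<close>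

definition ext_deriv :: "('e::real_normed_vector \<Rightarrow> 'e \<Rightarrow> real) \<Rightarrow> 'e \<Rightarrow> 'e \<Rightarrow> 'e \<Rightarrow> real" where
  "ext_deriv \<alpha> x v w = diff (\<lambda>y. \<alpha> y w) x v - diff (\<lambda>y. \<alpha> y v) x w"

definition lie_bracket :: "('e::real_normed_vector \<Rightarrow> 'e) \<Rightarrow> ('e \<Rightarrow> 'e) \<Rightarrow> 'e \<Rightarrow> 'e" where
  "lie_bracket X Y x = diff Y x (X x) - diff X x (Y x)"

definition lie_deriv :: "('e::real_normed_vector \<Rightarrow> 'e) \<Rightarrow> ('e \<Rightarrow> 'e \<Rightarrow> 'e \<Rightarrow> real)
    \<Rightarrow> 'e \<Rightarrow> 'e \<Rightarrow> 'e \<Rightarrow> real" where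
  "lie_deriv X G x v w =
     diff (\<lambda>y. G y v w) x (X x) + G x (diff X x v) w + G x v (diff X x w)"

text \<open>The vector \<open>christoffel G x v w\<close> is \<open>\<Sum> \<Gamma>\<^bsup>k\<^esup>\<^bsub>ij\<^esub> v\<^bsup>i\<^esup> w\<^bsup>j\<^esup> e\<^bsub>k\<^esub>\<close>
  for the Levi-Civita connection of \<open>G\<close>.\<close>

definition christoffel :: "('e::real_normed_vector \<Rightarrow> 'e \<Rightarrow> 'e \<Rightarrow> real) \<Rightarrow> 'e \<Rightarrow> 'e \<Rightarrow> 'e \<Rightarrow> 'e" where
  "christoffel G x v w = sharp (G x) (\<lambda>z.
     (diff (\<lambda>y. G y w z) x v + diff (\<lambda>y. G y v z) x w - diff (\<lambda>y. G y v w) x z) / 2)"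

text \<open>\<open>cov_deriv G \<alpha> x v w\<close> is \<open>(\<nabla>\<^bsub>v\<^esub> \<alpha>)(w)\<close> at \<open>x\<close>.\<close>

definition cov_deriv :: "('e::real_normed_vector \<Rightarrow> 'e \<Rightarrow> 'e \<Rightarrow> real) \<Rightarrow> ('e \<Rightarrow> 'e \<Rightarrow> real)
    \<Rightarrow> 'e \<Rightarrow> 'e \<Rightarrow> 'e \<Rightarrow> real" where
  "cov_deriv G \<alpha> x v w = diff (\<lambda>y. \<alpha> y w) x v - \<alpha> x (christoffel G x v w)"

text \<open>\<open>R(v,w)z\<close> with the sign convention \<open>R(X,Y) = [\<nabla>\<^bsub>X\<^esub>, \<nabla>\<^bsub>Y\<^esub>] - \<nabla>\<^bsub>[X,Y]\<^esub>\<close>.\<close>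

definition riemann :: "('e::real_normed_vector \<Rightarrow> 'e \<Rightarrow> 'e \<Rightarrow> real)
    \<Rightarrow> 'e \<Rightarrow> 'e \<Rightarrow> 'e \<Rightarrow> 'e \<Rightarrow> 'e" where
  "riemann G x v w z =
     diff (\<lambda>y. christoffel G y w z) x v - diff (\<lambda>y. christoffel G y v z) x w
     + christoffel G x v (christoffel G x w z) - christoffel G x w (christoffel G x v z)"

definition ricci :: "('e::euclidean_space \<Rightarrow> 'e \<Rightarrow> 'e \<Rightarrow> real) \<Rightarrow> 'e \<Rightarrow> 'e \<Rightarrow> 'e \<Rightarrow> real" where
  "ricci G x w z = (\<Sum>e\<in>Basis. riemann G x e w z \<bullet> e)"

text \<open>Since \<open>sharp (G x) (\<lambda>v. v \<bullet> e)\<close> is the vector \<open>G\<^bsup>ij\<^esup> e\<^bsub>i\<^esub>\<close> when \<open>e = e\<^bsub>j\<^esub>\<close>, this is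
  the metric trace of \<open>\<nabla>df\<close>.\<close>

definition laplacian :: "('e::euclidean_space \<Rightarrow> 'e \<Rightarrow> 'e \<Rightarrow> real) \<Rightarrow> ('e \<Rightarrow> real) \<Rightarrow> 'e \<Rightarrow> real" where
  "laplacian G f x = (\<Sum>e\<in>Basis. cov_deriv G (diff f) x e (sharp (G x) (\<lambda>v. v \<bullet> e)))"

text \<open>The Hodge star operator on two-forms of an inner product \<open>g\<close> on \<open>R\<^sup>3\<close> with its standard
  orientation, that is,
  \<open>(*\<omega>)\<^bsub>k\<^esub> = 1/2 g\<^bsup>ia\<^esup> g\<^bsup>jb\<^esup> \<omega>\<^bsub>ij\<^esub> vol\<^bsub>abk\<^esub>\<close>.\<close>

definition vol_form :: "(real^3 \<Rightarrow> real^3 \<Rightarrow> real) \<Rightarrow> real^3 \<Rightarrow> real^3 \<Rightarrow> real^3 \<Rightarrow> real" where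
  "vol_form g x y z =
     sqrt (det (\<chi> i j. g (axis i 1) (axis j 1))) * det (vector [x, y, z] :: real^3^3)"

definition hodge :: "(real^3 \<Rightarrow> real^3 \<Rightarrow> real) \<Rightarrow> (real^3 \<Rightarrow> real^3 \<Rightarrow> real) \<Rightarrow> real^3 \<Rightarrow> real" where
  "hodge g \<omega> z = (\<Sum>e\<in>Basis. \<Sum>e'\<in>Basis.
     \<omega> e e' * vol_form g (sharp g (\<lambda>v. v \<bullet> e)) (sharp g (\<lambda>v. v \<bullet> e')) z) / 2"

definition soliton_tensor :: "('e::euclidean_space \<Rightarrow> 'e \<Rightarrow> 'e \<Rightarrow> real) \<Rightarrow> ('e \<Rightarrow> 'e) \<Rightarrow> real
    \<Rightarrow> 'e \<Rightarrow> 'e \<Rightarrow> 'e \<Rightarrow> real" where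
  "soliton_tensor G E a x v w = ricci G x v w + a * G x v w + lie_deriv E G x v w / 2"


section \<open>Manifolds and tensor fields\<close>

text \<open>The manifold is the whole type \<open>'a\<close> (Hausdorff and second countable), with an atlas
  \<open>cmap i\<close> on \<open>cdom i\<close>, \<open>i \<in> index\<close>. A tensor field is the family, indexed by the charts, of its
  components, each as a function of the coordinates, subject to the usual transformation law.\<close>

record ('i, 'a, 'e) atlas =
  index :: "'i set"
  cdom :: "'i \<Rightarrow> 'a set"
  cmap :: "'i \<Rightarrow> 'a \<Rightarrow> 'e"

definition cinv :: "('i, 'a, 'e) atlas \<Rightarrow> 'i \<Rightarrow> 'e \<Rightarrow> 'a" where
  "cinv N i = inv_into (cdom N i) (cmap N i)"

definition cimage :: "('i, 'a, 'e) atlas \<Rightarrow> 'i \<Rightarrow> 'a set \<Rightarrow> 'e set" where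
  "cimage N i W = cmap N i ` (cdom N i \<inter> W)"

definition transition :: "('i, 'a, 'e) atlas \<Rightarrow> 'i \<Rightarrow> 'i \<Rightarrow> 'e \<Rightarrow> 'e" where
  "transition N i j = cmap N j \<circ> cinv N i"

definition analytic_manifold ::
    "('i, 'a::{t2_space,second_countable_topology}, 'e::euclidean_space) atlas \<Rightarrow> bool" where
  "analytic_manifold N \<longleftrightarrow>
     (\<Union>i\<in>index N. cdom N i) = UNIV \<and>
     (\<forall>i\<in>index N. open (cdom N i) \<and> open (cimage N i UNIV) \<and>
        homeomorphism (cdom N i) (cimage N i UNIV) (cmap N i) (cinv N i)) \<and>
     (\<forall>i\<in>index N. \<forall>j\<in>index N. real_analytic_on (cimage N i (cdom N j)) (transition N i j))"

definition oriented_atlas :: "('i, 'a, real^3) atlas \<Rightarrow> bool" where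
  "oriented_atlas N \<longleftrightarrow> (\<forall>i\<in>index N. \<forall>j\<in>index N. \<forall>x\<in>cimage N i (cdom N j).
     det (matrix (diff (transition N i j) x)) > 0)"

definition rep :: "('i, 'a, 'e) atlas \<Rightarrow> 'i \<Rightarrow> ('a \<Rightarrow> real) \<Rightarrow> 'e \<Rightarrow> real" where
  "rep N i f = f \<circ> cinv N i"

definition smooth_function ::
    "('i, 'a, 'e::euclidean_space) atlas \<Rightarrow> 'a set \<Rightarrow> ('a \<Rightarrow> real) \<Rightarrow> bool" where
  "smooth_function N W f \<longleftrightarrow> (\<forall>i\<in>index N. smooth_on (cimage N i W) (rep N i f))"

definition vector_field ::
    "('i, 'a, 'e::euclidean_space) atlas \<Rightarrow> 'a set \<Rightarrow> ('i \<Rightarrow> 'e \<Rightarrow> 'e) \<Rightarrow> bool" where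
  "vector_field N W X \<longleftrightarrow>
     (\<forall>i\<in>index N. smooth_on (cimage N i W) (X i)) \<and>
     (\<forall>i\<in>index N. \<forall>j\<in>index N. \<forall>x\<in>cimage N i (cdom N j \<inter> W).
        X j (transition N i j x) = diff (transition N i j) x (X i x))"

definition one_form ::
    "('i, 'a, 'e::euclidean_space) atlas \<Rightarrow> 'a set \<Rightarrow> ('i \<Rightarrow> 'e \<Rightarrow> 'e \<Rightarrow> real) \<Rightarrow> bool" where
  "one_form N W \<alpha> \<longleftrightarrow>
     (\<forall>i\<in>index N. \<forall>x\<in>cimage N i W. linear (\<alpha> i x)) \<and>
     (\<forall>i\<in>index N. \<forall>v. smooth_on (cimage N i W) (\<lambda>x. \<alpha> i x v)) \<and>
     (\<forall>i\<in>index N. \<forall>j\<in>index N. \<forall>x\<in>cimage N i (cdom N j \<inter> W). \<forall>v.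
        \<alpha> j (transition N i j x) (diff (transition N i j) x v) = \<alpha> i x v)"

definition riemannian_metric ::
    "('i, 'a, 'e::euclidean_space) atlas \<Rightarrow> ('i \<Rightarrow> 'e \<Rightarrow> 'e \<Rightarrow> 'e \<Rightarrow> real) \<Rightarrow> bool" where
  "riemannian_metric N g \<longleftrightarrow>
     (\<forall>i\<in>index N. \<forall>x\<in>cimage N i UNIV.
        bilinear (g i x) \<and> (\<forall>v w. g i x v w = g i x w v) \<and> (\<forall>v. v \<noteq> 0 \<longrightarrow> g i x v v > 0)) \<and>
     (\<forall>i\<in>index N. \<forall>v w. smooth_on (cimage N i UNIV) (\<lambda>x. g i x v w)) \<and>
     (\<forall>i\<in>index N. \<forall>j\<in>index N. \<forall>x\<in>cimage N i (cdom N j). \<forall>v w.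
        g j (transition N i j x) (diff (transition N i j) x v) (diff (transition N i j) x w)
          = g i x v w)"

definition analytic_metric ::
    "('i, 'a, 'e::euclidean_space) atlas \<Rightarrow> ('i \<Rightarrow> 'e \<Rightarrow> 'e \<Rightarrow> 'e \<Rightarrow> real) \<Rightarrow> bool" where
  "analytic_metric N g \<longleftrightarrow> riemannian_metric N g \<and>
     (\<forall>i\<in>index N. \<forall>v w. real_analytic_on (cimage N i UNIV) (\<lambda>x. g i x v w))"

definition harmonic_function :: "('i, 'a, 'e::euclidean_space) atlas
    \<Rightarrow> ('i \<Rightarrow> 'e \<Rightarrow> 'e \<Rightarrow> 'e \<Rightarrow> real) \<Rightarrow> ('a \<Rightarrow> real) \<Rightarrow> bool" where
  "harmonic_function N h f \<longleftrightarrow> smooth_function N UNIV f \<and>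
     (\<forall>i\<in>index N. \<forall>x\<in>cimage N i UNIV. laplacian (h i) (rep N i f) x = 0)"

definition soliton_flow :: "('i, 'a, 'e::euclidean_space) atlas
    \<Rightarrow> ('i \<Rightarrow> 'e \<Rightarrow> 'e \<Rightarrow> 'e \<Rightarrow> real) \<Rightarrow> 'a set \<Rightarrow> ('i \<Rightarrow> 'e \<Rightarrow> 'e) \<Rightarrow> real \<Rightarrow> bool" where
  "soliton_flow M g W E a \<longleftrightarrow>
     (\<forall>i\<in>index M. \<forall>x\<in>cimage M i W. \<forall>v w. soliton_tensor (g i) (E i) a x v w = 0)"


section \<open>The Gibbons--Hawking construction\<close>

definition times_line :: "('i, 'a, 'e) atlas \<Rightarrow> ('i, 'a \<times> real, 'e \<times> real) atlas" where
  "times_line N = \<lparr> index = index N,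
                    cdom = (\<lambda>i. cdom N i \<times> UNIV),
                    cmap = (\<lambda>i (p, t). (cmap N i p, t)) \<rparr>"

definition monopole :: "('i, 'a, real^3) atlas \<Rightarrow> ('i \<Rightarrow> real^3 \<Rightarrow> real^3 \<Rightarrow> real^3 \<Rightarrow> real)
    \<Rightarrow> 'a set \<Rightarrow> ('a \<Rightarrow> real) \<Rightarrow> ('i \<Rightarrow> real^3 \<Rightarrow> real^3 \<Rightarrow> real) \<Rightarrow> bool" where
  "monopole N h W u A \<longleftrightarrow> (\<forall>i\<in>index N. \<forall>x\<in>cimage N i W. \<forall>z.
     diff (rep N i u) x z = hodge (h i x) (ext_deriv (A i) x) z)"

text \<open>\<open>g = u h + u\<^bsup>-1\<^esup> (dt + A)\<^sup>2\<close>\<close>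

definition gh_metric :: "('i, 'a, 'e) atlas \<Rightarrow> ('i \<Rightarrow> 'e \<Rightarrow> 'e \<Rightarrow> 'e \<Rightarrow> real) \<Rightarrow> ('a \<Rightarrow> real)
    \<Rightarrow> ('i \<Rightarrow> 'e \<Rightarrow> 'e \<Rightarrow> real) \<Rightarrow> 'i \<Rightarrow> 'e \<times> real \<Rightarrow> 'e \<times> real \<Rightarrow> 'e \<times> real \<Rightarrow> real" where
  "gh_metric N h u A i = (\<lambda>(x, t) (v, r) (w, s).
     rep N i u x * h i x v w + inverse (rep N i u x) * ((r + A i x v) * (s + A i x w)))"

definition horizontal_lift :: "('i \<Rightarrow> 'e \<Rightarrow> 'e \<Rightarrow> real) \<Rightarrow> ('i \<Rightarrow> 'e \<Rightarrow> 'e)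
    \<Rightarrow> 'i \<Rightarrow> 'e \<times> real \<Rightarrow> 'e \<times> real" where
  "horizontal_lift A S i = (\<lambda>(x, t). (S i x, - A i x (S i x)))"

text \<open>The component of a vector field in \<open>ker (dt + A)\<close>, along the span of \<open>\<partial>/\<partial>t\<close>.\<close>

definition horizontal_part :: "('i \<Rightarrow> 'e \<Rightarrow> 'e \<Rightarrow> real) \<Rightarrow> ('i \<Rightarrow> 'e \<times> real \<Rightarrow> 'e::real_vector \<times> real)
    \<Rightarrow> 'i \<Rightarrow> 'e \<times> real \<Rightarrow> 'e \<times> real" where
  "horizontal_part A E i = (\<lambda>(x, t).
     E i (x, t) - (snd (E i (x, t)) + A i x (fst (E i (x, t)))) *\<^sub>R (0, 1))"

definition add_exact :: "('i, 'a, 'e::real_normed_vector) atlas \<Rightarrow> ('i \<Rightarrow> 'e \<Rightarrow> 'e \<Rightarrow> real)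
    \<Rightarrow> ('a \<Rightarrow> real) \<Rightarrow> 'i \<Rightarrow> 'e \<Rightarrow> 'e \<Rightarrow> real" where
  "add_exact N B v i x z = B i x z + diff (rep N i v) x z"

text \<open>The one-form \<open>dw - aB\<close>.\<close>

definition dw_aB :: "('i, 'a, 'e::real_normed_vector) atlas \<Rightarrow> ('a \<Rightarrow> real)
    \<Rightarrow> ('i \<Rightarrow> 'e \<Rightarrow> 'e \<Rightarrow> real) \<Rightarrow> real \<Rightarrow> 'i \<Rightarrow> 'e \<Rightarrow> 'e \<Rightarrow> real" where
  "dw_aB N w B a i x z = diff (rep N i w) x z - a * B i x z"

text \<open>The data of the theorem: the monopole equation for \<open>B\<close> and the three equations for \<open>w\<close>,
  on an open set \<open>W\<close> (as \<open>B\<close> is only a local solution).\<close>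

definition soliton_data :: "('i, 'a, real^3) atlas \<Rightarrow> ('i \<Rightarrow> real^3 \<Rightarrow> real^3 \<Rightarrow> real^3 \<Rightarrow> real)
    \<Rightarrow> 'a set \<Rightarrow> ('a \<Rightarrow> real) \<Rightarrow> ('i \<Rightarrow> real^3 \<Rightarrow> real^3 \<Rightarrow> real) \<Rightarrow> ('a \<Rightarrow> real)
    \<Rightarrow> real \<Rightarrow> real \<Rightarrow> bool" where
  "soliton_data N h W u B w a b \<longleftrightarrow>
     one_form N W B \<and> monopole N h W u B \<and> smooth_function N W w \<and>
     (\<forall>i\<in>index N. \<forall>x\<in>cimage N i W.
        let H = h i; U = rep N i u; \<omega> = rep N i w;
            du = diff U; gu = grad H U; gw = grad H \<omega>; Bs = sharp_field H (B i)
        in du x (gw x) = b * U x ^ 3 + a * du x (Bs x) \<and>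
           (\<forall>z. cov_deriv H du x (gw x) z =
                - inverse (U x) * H x (gu x) (gu x) * dw_aB N w B a i x z
                + 5/2 * b * U x ^ 2 * du x z
                - a * H x (lie_bracket gu Bs x) z
                + 1/2 * a * lie_deriv Bs H x (gu x) z) \<and>
           (\<forall>y z. cov_deriv H (diff \<omega>) x y z =
                1/2 * a * lie_deriv Bs H x y z
                - 1/2 * b * U x ^ 2 * H x y z
                + 2 * inverse (U x) * sym_prod (du x) (dw_aB N w B a i x) y z))"

text \<open>\<open>E = (f\<^sub>0 - a t + b t\<^sup>2 / 4) \<partial>/\<partial>t + t F\<close>, with \<open>F\<close> the horizontal lift of
  \<open>u\<^bsup>-2\<^esup> (grad w - a B\<^sup>#)\<close>.\<close>

definition base_field :: "('i, 'a, 'e::real_normed_vector) atlas \<Rightarrow> ('i \<Rightarrow> 'e \<Rightarrow> 'e \<Rightarrow> 'e \<Rightarrow> real)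
    \<Rightarrow> ('a \<Rightarrow> real) \<Rightarrow> ('i \<Rightarrow> 'e \<Rightarrow> 'e \<Rightarrow> real) \<Rightarrow> ('a \<Rightarrow> real) \<Rightarrow> real \<Rightarrow> 'i \<Rightarrow> 'e \<Rightarrow> 'e" where
  "base_field N h u B w a i x =
     inverse (rep N i u x ^ 2) *\<^sub>R (grad (h i) (rep N i w) x - a *\<^sub>R sharp_field (h i) (B i) x)"

definition gh_field :: "('i, 'a, 'e::real_normed_vector) atlas \<Rightarrow> ('i \<Rightarrow> 'e \<Rightarrow> 'e \<Rightarrow> 'e \<Rightarrow> real)
    \<Rightarrow> ('a \<Rightarrow> real) \<Rightarrow> ('i \<Rightarrow> 'e \<Rightarrow> 'e \<Rightarrow> real) \<Rightarrow> ('i \<Rightarrow> 'e \<Rightarrow> 'e \<Rightarrow> real) \<Rightarrow> ('a \<Rightarrow> real)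
    \<Rightarrow> ('a \<Rightarrow> real) \<Rightarrow> real \<Rightarrow> real \<Rightarrow> 'i \<Rightarrow> 'e \<times> real \<Rightarrow> 'e \<times> real" where
  "gh_field N h u A B w f0 a b i = (\<lambda>(x, t).
     (rep N i f0 x - a * t + 1/4 * b * t ^ 2) *\<^sub>R (0, 1)
     + t *\<^sub>R horizontal_lift A (base_field N h u B w a) i (x, t))"

definition base_equation :: "('i, 'a, 'e::euclidean_space) atlas
    \<Rightarrow> ('i \<Rightarrow> 'e \<Rightarrow> 'e \<Rightarrow> 'e \<Rightarrow> real) \<Rightarrow> 'a set \<Rightarrow> ('a \<Rightarrow> real) \<Rightarrow> ('i \<Rightarrow> 'e \<Rightarrow> 'e \<Rightarrow> real)
    \<Rightarrow> ('i \<Rightarrow> 'e \<Rightarrow> 'e \<Rightarrow> real) \<Rightarrow> ('a \<Rightarrow> real) \<Rightarrow> real \<Rightarrow> bool" where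
  "base_equation N h U u A B w a \<longleftrightarrow> (\<forall>i\<in>index N. \<forall>x\<in>cimage N i U. \<forall>y z.
     ricci (h i) x y z + a * rep N i u x * h i x y z
     - inverse (rep N i u x) * sym_prod (A i x) (dw_aB N w B a i x) y z = 0)"

text \<open>The part of the soliton flow equation with one argument along the fibres. It is implied by
  \<open>soliton_flow\<close>, and it is the part of that equation which involves \<open>f\<^sub>0\<close>. The functions \<open>v\<close>
  and \<open>f\<^sub>0\<close> of the theorem are unique with respect to it. (An equivalence between two assertions
  that may both fail does not determine them: where the base equation fails for a given \<open>v\<close>, the
  equivalence holds for almost any \<open>f\<^sub>0\<close>.)\<close>

definition soliton_along_fibres :: "('i, 'a \<times> real, 'e::euclidean_space \<times> real) atlas
    \<Rightarrow> ('i \<Rightarrow> 'e \<times> real \<Rightarrow> 'e \<times> real \<Rightarrow> 'e \<times> real \<Rightarrow> real) \<Rightarrow> ('a \<times> real) set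
    \<Rightarrow> ('i \<Rightarrow> 'e \<times> real \<Rightarrow> 'e \<times> real) \<Rightarrow> real \<Rightarrow> bool" where
  "soliton_along_fibres M g W E a \<longleftrightarrow>
     (\<forall>i\<in>index M. \<forall>x\<in>cimage M i W. \<forall>v. soliton_tensor (g i) (E i) a x (0, 1) v = 0)"

end

theory Submission
  imports Defs
begin

text \<open>The monopole equation makes the Ricci tensor of \<open>u h + u\<inverse> (dt + A)\<^sup>2\<close> the pullback of the Ricci tensor
  of \<open>h\<close>. Hence for \<open>E = f \<partial>\<^sub>t + t F\<close>, with \<open>F\<close> the lift of \<open>S\<close>, the soliton equation is polynomial in \<open>t\<close> once
  its fibre component has been solved for \<open>f\<close>. Its coefficients say that \<open>b = S(u) / u\<close> is constant, that
  \<open>L\<^sub>S h = - b h\<close>, that \<open>dA(S, \<cdot>) = (b / 2) A\<close>, that \<open>df\<^sub>0 = - a A - u\<^sup>2 h(S, \<cdot>)\<close>, and that the base equation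
  holds; with \<open>w = - f\<^sub>0\<close> this is the system for \<open>w\<close>. In the other direction \<open>S = u\<^sup>-\<^sup>2 (grad w - a B\<^sup>\<sharp>)\<close> satisfies
  \<open>S(u) = b u\<close> and \<open>L\<^sub>S h = - b h\<close>, so \<open>L\<^sub>S dB = (b / 2) dB\<close> and the form \<open>(2 / b) dB(S, \<cdot>) - B\<close> is closed: its
  primitive is \<open>v\<close>. Finally \<open>b = 0\<close> would make \<open>S\<close> a Killing field vanishing wherever \<open>du\<close> does not, hence
  everywhere by unique continuation.\<close>

section \<open>Smooth maps\<close>

text \<open>The four-dimensional curvature is computed from component formulas in a chart. What
  keeps this manageable is the split of a vector into its base part and the value of
  \<open>dt + A\<close> on it: in these terms the Christoffel symbols involve only those of h, u,
  its gradient, derivatives of A and the skew operator J got from dA by raising an index. Since J is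
  the cross product with grad u, J and its covariant derivatives are trace free, J is divergence
  free and J J is explicit; together with the harmonicity of u this leaves only the Ricci tensor of
  h in the trace.

  The functions v and f0 are decided by the fibre part of the soliton equation. For E of the given
  shape it amounts to two first-order equations, one for dv and one for df0, so existence is a
  matter of closedness, and uniqueness up to constants needs only connectedness.

  To exclude b = 0, the zeros of S must spread from one open set to the whole manifold. The second
  derivatives of a Killing field are linear in its first jet, so along a segment this jet solves a
  linear differential equation.\<close>

declare Ck_on.simps(2) [simp del]

lemma diff_eq: "(f has_derivative f') (at x) \<Longrightarrow> diff f x = f'"
  by (simp add: diff_def[abs_def] frechet_derivative_at[symmetric])

lemma diff_works: "f differentiable (at x) \<Longrightarrow> (f has_derivative diff f x) (at x)"
  by (simp add: diff_def[abs_def] frechet_derivative_works[symmetric])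

lemma linear_diff_at: "f differentiable (at x) \<Longrightarrow> linear (diff f x)"
  using diff_works has_derivative_linear by blast

lemma has_derivative_cong_on:
  assumes "open D" "x \<in> D" "\<And>y. y \<in> D \<Longrightarrow> f y = g y" "(f has_derivative f') (at x)"
  shows "(g has_derivative f') (at x)"
  using has_derivative_transform_within_open[OF assms(4,1,2)] assms(3) by auto

text \<open>Maps that agree near \<open>x\<close> have the same candidates for a derivative, so the
  choice behind \<open>frechet_derivative\<close> gives the same value, even where there is no
  candidate.\<close>

lemma diff_cong_on:
  assumes "open D" "x \<in> D" "\<And>y. y \<in> D \<Longrightarrow> f y = g y"
  shows "diff f x = diff g x"
proof -
  have "(f has_derivative f') (at x) \<longleftrightarrow> (g has_derivative f') (at x)" for f'
    using has_derivative_cong_on[OF assms(1,2)] assms(3) by metis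
  then show ?thesis by (simp add: diff_def[abs_def] frechet_derivative_def)
qed

lemma differentiable_cong_on:
  assumes "open D" "x \<in> D" "\<And>y. y \<in> D \<Longrightarrow> f y = g y" "f differentiable (at x)"
  shows "g differentiable (at x)"
proof -
  obtain f' where "(f has_derivative f') (at x)" using assms(4) unfolding differentiable_def by blast
  then have "(g has_derivative f') (at x)" using has_derivative_cong_on[OF assms(1,2), of f g f'] assms(3) by simp
  then show ?thesis unfolding differentiable_def by blast
qed

lemma Ck_on_Suc_diff:
  "Ck_on (Suc k) D f \<longleftrightarrow> (\<forall>x\<in>D. f differentiable (at x)) \<and> (\<forall>v. Ck_on k D (\<lambda>x. diff f x v))"
  by (simp add: diff_def Ck_on.simps(2))

lemma Ck_on_cong:
  assumes "open D"
  shows "(\<And>x. x \<in> D \<Longrightarrow> f x = g x) \<Longrightarrow> Ck_on k D f \<Longrightarrow> Ck_on k D g"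
proof (induction k arbitrary: f g)
  case 0
  then show ?case using continuous_on_cong by (metis Ck_on.simps(1))
next
  case (Suc k)
  have "diff f x v = diff g x v" if "x \<in> D" for x v
    using diff_cong_on[OF assms that, of f g] Suc.prems(1) by simp
  moreover have "g differentiable (at x)" if "x \<in> D" for x
    using differentiable_cong_on[OF assms that, of f g] Suc.prems that
    unfolding Ck_on_Suc_diff by blast
  ultimately show ?case
    using Suc.prems(2) Suc.IH[of "\<lambda>x. diff f x v" "\<lambda>x. diff g x v" for v]
    unfolding Ck_on_Suc_diff by blast
qed

text \<open>Shared induction step of the closure lemmas below: it takes an explicit derivative
  formula, so that the induction hypothesis can be applied to each term of that formula.\<close>

lemma Ck_on_SucI:
  assumes "open D" "\<And>x. x \<in> D \<Longrightarrow> (f has_derivative f' x) (at x)"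
    and "\<And>v. Ck_on k D (\<lambda>x. f' x v)"
  shows "Ck_on (Suc k) D f"
  unfolding Ck_on_Suc_diff
proof (intro conjI ballI allI)
  show "f differentiable (at x)" if "x \<in> D" for x
    using assms(2)[OF that] differentiable_def by blast
  show "Ck_on k D (\<lambda>x. diff f x v)" for v
    using Ck_on_cong[OF assms(1) _ assms(3)[of v], of "\<lambda>x. diff f x v"] diff_eq[OF assms(2)] by simp
qed

lemma Ck_on_SucD:
  assumes "Ck_on (Suc k) D f"
  shows "x \<in> D \<Longrightarrow> (f has_derivative diff f x) (at x)" "Ck_on k D (\<lambda>x. diff f x v)"
  using assms diff_works unfolding Ck_on_Suc_diff by blast+

lemma Ck_on_subset: "Ck_on k D f \<Longrightarrow> D' \<subseteq> D \<Longrightarrow> Ck_on k D' f"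
proof (induction k arbitrary: f)
  case 0 then show ?case using continuous_on_subset by auto
next
  case (Suc k) then show ?case unfolding Ck_on_Suc_diff by blast
qed

lemma Ck_on_Suc_imp: "Ck_on (Suc k) D f \<Longrightarrow> Ck_on k D f"
proof (induction k arbitrary: f)
  case 0
  then show ?case
    by (auto simp: Ck_on_Suc_diff intro!: continuous_at_imp_continuous_on differentiable_imp_continuous_within)
next
  case (Suc k) then show ?case by (metis Ck_on_Suc_diff)
qed

lemma Ck_on_const: "open D \<Longrightarrow> Ck_on k D (\<lambda>x. c)"
proof (induction k arbitrary: c)
  case (Suc k)
  then show ?case by (auto intro!: Ck_on_SucI[of D _ "\<lambda>_ _. 0"] derivative_eq_intros)
qed auto

lemma Ck_on_bounded_linear:
  assumes "open D" "bounded_linear T"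
  shows "Ck_on k D f \<Longrightarrow> Ck_on k D (\<lambda>x. T (f x))"
proof (induction k arbitrary: f)
  case 0 then show ?case using assms by (auto intro: bounded_linear.continuous_on)
next
  case (Suc k)
  show ?case
    by (rule Ck_on_SucI[OF assms(1) bounded_linear.has_derivative[OF assms(2) Ck_on_SucD(1)[OF Suc.prems]]])
      (use Suc Ck_on_SucD(2) in blast)+
qed

lemma Ck_on_add:
  assumes "open D"
  shows "Ck_on k D f \<Longrightarrow> Ck_on k D g \<Longrightarrow> Ck_on k D (\<lambda>x. f x + g x)"
proof (induction k arbitrary: f g)
  case 0 then show ?case by (auto intro: continuous_intros)
next
  case (Suc k)
  show ?case
    by (rule Ck_on_SucI[OF assms has_derivative_add[OF Ck_on_SucD(1)[OF Suc.prems(1)] Ck_on_SucD(1)[OF Suc.prems(2)]]])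
      (use Suc Ck_on_SucD(2) in blast)+
qed

lemma Ck_on_bilinear:
  assumes "open D" "bounded_bilinear B"
  shows "Ck_on k D f \<Longrightarrow> Ck_on k D g \<Longrightarrow> Ck_on k D (\<lambda>x. B (f x) (g x))"
proof (induction k arbitrary: f g)
  case 0 then show ?case using bounded_bilinear.continuous_on[OF assms(2)] by auto
next
  case (Suc k)
  have fg: "Ck_on k D f" "Ck_on k D g" using Suc.prems Ck_on_Suc_imp by blast+
  show ?case
    by (rule Ck_on_SucI[OF assms(1) bounded_bilinear.FDERIV[OF assms(2)
          Ck_on_SucD(1)[OF Suc.prems(1)] Ck_on_SucD(1)[OF Suc.prems(2)]]])
      (auto intro!: Ck_on_add[OF assms(1)] Suc.IH fg Ck_on_SucD(2)[OF Suc.prems(1)] Ck_on_SucD(2)[OF Suc.prems(2)])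
qed

lemma Ck_on_sum:
  assumes "open D" "\<And>i. i \<in> I \<Longrightarrow> Ck_on k D (f i)"
  shows "Ck_on k D (\<lambda>x. \<Sum>i\<in>I. f i x)"
  using assms(2)
  by (induction I rule: infinite_finite_induct) (auto intro!: Ck_on_const Ck_on_add assms(1))

lemma Ck_on_inverse:
  fixes f :: "'e::euclidean_space \<Rightarrow> real"
  assumes "open D" "\<And>x. x \<in> D \<Longrightarrow> f x \<noteq> 0"
  shows "Ck_on k D f \<Longrightarrow> Ck_on k D (\<lambda>x. inverse (f x))"
proof (induction k)
  case 0 then show ?case using assms by (auto intro: continuous_intros)
next
  case (Suc k)
  have f: "Ck_on k D f" "\<And>v. Ck_on k D (\<lambda>x. diff f x v)"
    using Suc.prems Ck_on_Suc_imp Ck_on_SucD(2) by blast+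
  then have i: "Ck_on k D (\<lambda>x. inverse (f x))" using Suc.IH by blast
  show ?case
  proof (rule Ck_on_SucI[OF assms(1)])
    show "((\<lambda>x. inverse (f x)) has_derivative (\<lambda>v. - (inverse (f x) * diff f x v * inverse (f x)))) (at x)"
      if "x \<in> D" for x
      using Deriv.has_derivative_inverse[OF assms(2)[OF that] Ck_on_SucD(1)[OF Suc.prems that]] by simp
    show "Ck_on k D (\<lambda>x. - (inverse (f x) * diff f x v * inverse (f x)))" for v
      by (intro Ck_on_bounded_linear[OF assms(1) bounded_linear_minus[OF bounded_linear_ident]]
          Ck_on_bilinear[OF assms(1) bounded_bilinear_mult] i f)
  qed
qed

lemma Ck_on_compose:
  fixes f :: "'f::euclidean_space \<Rightarrow> 'b::real_normed_vector" and g :: "'e::euclidean_space \<Rightarrow> 'f"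
  assumes "open D" "open D'" "\<And>x. x \<in> D \<Longrightarrow> g x \<in> D'"
  shows "Ck_on k D' f \<Longrightarrow> Ck_on k D g \<Longrightarrow> Ck_on k D (\<lambda>x. f (g x))"
proof (induction k arbitrary: f)
  case 0
  then show ?case using assms(3) continuous_on_compose2[of D' f D g] by (simp add: image_subset_iff)
next
  case (Suc k)
  have g: "Ck_on k D g" "\<And>v. Ck_on k D (\<lambda>x. diff g x v)"
    using Suc.prems Ck_on_Suc_imp Ck_on_SucD(2) by blast+
  show ?case
  proof (rule Ck_on_SucI[OF assms(1)])
    fix x assume x: "x \<in> D"
    have f': "(f has_derivative diff f (g x)) (at (g x))" using Ck_on_SucD(1)[OF Suc.prems(1)] assms(3) x by blast
    have d: "((\<lambda>x. f (g x)) has_derivative (\<lambda>v. diff f (g x) (diff g x v))) (at x)"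
      using diff_chain_at[OF Ck_on_SucD(1)[OF Suc.prems(2) x] f'] by (simp add: o_def)
    \<comment> \<open>\<open>Ck_on\<close> controls derivatives in fixed directions only. Expanding
      the moving direction \<open>diff g x v\<close> in the basis leaves products of maps of class
      k.\<close>
    have eq: "diff f (g x) v = (\<Sum>e\<in>Basis. (v \<bullet> e) *\<^sub>R diff f (g x) e)" for v
      using linear_sum[OF has_derivative_linear[OF f'], of "\<lambda>e. (v \<bullet> e) *\<^sub>R e" Basis]
      by (simp add: euclidean_representation linear_scale[OF has_derivative_linear[OF f']])
    show "((\<lambda>x. f (g x)) has_derivative (\<lambda>v. \<Sum>e\<in>Basis. (diff g x v \<bullet> e) *\<^sub>R diff f (g x) e)) (at x)"
      by (rule has_derivative_eq_rhs[OF d]) (rule ext, rule eq)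
  next
    show "Ck_on k D (\<lambda>x. \<Sum>e\<in>Basis. (diff g x v \<bullet> e) *\<^sub>R diff f (g x) e)" for v
      using Ck_on_SucD(2)[OF Suc.prems(1)]
      by (intro Ck_on_sum Ck_on_bilinear[OF assms(1) bounded_bilinear_scaleR]
          Ck_on_bounded_linear[OF assms(1) bounded_linear_inner_left] assms g Suc.IH)
  qed
qed

section \<open>Closure properties of smooth maps\<close>

named_theorems smooth_intros

lemma smooth_on_diff [smooth_intros]: "smooth_on D f \<Longrightarrow> smooth_on D (\<lambda>x. diff f x v)"
  unfolding smooth_on_def using Ck_on_SucD(2) by blast

lemma smooth_on_differentiable: "smooth_on D f \<Longrightarrow> x \<in> D \<Longrightarrow> f differentiable (at x)"
  unfolding smooth_on_def using Ck_on_Suc_diff by blast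

lemma smooth_on_has_derivative: "smooth_on D f \<Longrightarrow> x \<in> D \<Longrightarrow> (f has_derivative diff f x) (at x)"
  using smooth_on_differentiable diff_works by blast

lemma smooth_on_linear_diff: "smooth_on D f \<Longrightarrow> x \<in> D \<Longrightarrow> linear (diff f x)"
  using smooth_on_differentiable linear_diff_at by blast

lemma smooth_on_continuous: "smooth_on D f \<Longrightarrow> continuous_on D f"
  unfolding smooth_on_def using Ck_on.simps(1) by blast

lemma smooth_onI:
  assumes "open D" "\<And>x. x \<in> D \<Longrightarrow> (f has_derivative f' x) (at x)" "\<And>v. smooth_on D (\<lambda>x. f' x v)"
  shows "smooth_on D f"
  unfolding smooth_on_def
proof
  fix k show "Ck_on k D f"
    using Ck_on_SucI[OF assms(1,2), of k] assms(3) Ck_on_Suc_imp unfolding smooth_on_def by blast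
qed

lemma smooth_on_cong:
  "open D \<Longrightarrow> (\<And>x. x \<in> D \<Longrightarrow> f x = g x) \<Longrightarrow> smooth_on D f \<Longrightarrow> smooth_on D g"
  unfolding smooth_on_def using Ck_on_cong by blast

lemma smooth_on_subset: "smooth_on D f \<Longrightarrow> D' \<subseteq> D \<Longrightarrow> smooth_on D' f"
  unfolding smooth_on_def using Ck_on_subset by blast

lemma smooth_on_const [smooth_intros]: "open D \<Longrightarrow> smooth_on D (\<lambda>x. c)"
  unfolding smooth_on_def using Ck_on_const by blast

lemma smooth_on_bounded_linear:
  "open D \<Longrightarrow> bounded_linear T \<Longrightarrow> smooth_on D f \<Longrightarrow> smooth_on D (\<lambda>x. T (f x))"
  unfolding smooth_on_def using Ck_on_bounded_linear by blast

lemma smooth_on_ident [smooth_intros]: "open D \<Longrightarrow> smooth_on D (\<lambda>x. x)"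
  by (rule smooth_onI[of D _ "\<lambda>_ v. v", OF _ has_derivative_ident smooth_on_const])

lemma smooth_on_add [smooth_intros]:
  "open D \<Longrightarrow> smooth_on D f \<Longrightarrow> smooth_on D g \<Longrightarrow> smooth_on D (\<lambda>x. f x + g x)"
  unfolding smooth_on_def using Ck_on_add by blast

lemma smooth_on_bilinear:
  "open D \<Longrightarrow> bounded_bilinear B \<Longrightarrow> smooth_on D f \<Longrightarrow> smooth_on D g \<Longrightarrow> smooth_on D (\<lambda>x. B (f x) (g x))"
  unfolding smooth_on_def using Ck_on_bilinear by blast

lemmas smooth_on_scaleR [smooth_intros] = smooth_on_bilinear[OF _ bounded_bilinear_scaleR]
lemmas smooth_on_inner [smooth_intros] = smooth_on_bilinear[OF _ bounded_bilinear_inner]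
lemmas smooth_on_mult [smooth_intros] = smooth_on_bilinear[OF _ bounded_bilinear_mult]

lemma smooth_on_minus [smooth_intros]: "open D \<Longrightarrow> smooth_on D f \<Longrightarrow> smooth_on D (\<lambda>x. - f x)"
  using smooth_on_bounded_linear[OF _ bounded_linear_minus[OF bounded_linear_ident]] .

lemma smooth_on_diff_op [smooth_intros]:
  "open D \<Longrightarrow> smooth_on D f \<Longrightarrow> smooth_on D g \<Longrightarrow> smooth_on D (\<lambda>x. f x - g x)"
  using smooth_on_add[of D f "\<lambda>x. - g x"] smooth_on_minus[of D g] by simp

lemma smooth_on_sum [smooth_intros]:
  "open D \<Longrightarrow> (\<And>i. i \<in> I \<Longrightarrow> smooth_on D (f i)) \<Longrightarrow> smooth_on D (\<lambda>x. \<Sum>i\<in>I. f i x)"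
  unfolding smooth_on_def by (auto intro: Ck_on_sum)

lemma smooth_on_inverse [smooth_intros]:
  fixes f :: "'e::euclidean_space \<Rightarrow> real"
  shows "open D \<Longrightarrow> (\<And>x. x \<in> D \<Longrightarrow> f x \<noteq> 0) \<Longrightarrow> smooth_on D f \<Longrightarrow> smooth_on D (\<lambda>x. inverse (f x))"
  unfolding smooth_on_def by (auto intro: Ck_on_inverse)

lemma smooth_on_divide [smooth_intros]:
  fixes f g :: "'e::euclidean_space \<Rightarrow> real"
  shows "open D \<Longrightarrow> (\<And>x. x \<in> D \<Longrightarrow> g x \<noteq> 0) \<Longrightarrow> smooth_on D f \<Longrightarrow> smooth_on D g \<Longrightarrow> smooth_on D (\<lambda>x. f x / g x)"
  by (simp add: divide_inverse smooth_on_mult smooth_on_inverse)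

lemma smooth_on_compose:
  fixes f :: "'f::euclidean_space \<Rightarrow> 'b::real_normed_vector" and g :: "'e::euclidean_space \<Rightarrow> 'f"
  shows "\<lbrakk>open D; open D'; \<And>x. x \<in> D \<Longrightarrow> g x \<in> D'; smooth_on D' f; smooth_on D g\<rbrakk>
    \<Longrightarrow> smooth_on D (\<lambda>x. f (g x))"
  unfolding smooth_on_def using Ck_on_compose[of D D' g _ f] by simp

text \<open>Symmetry of second derivatives: the second difference of \<open>f\<close> over a small parallelogram
  equals each mixed derivative at some nearby point, by the mean value theorem.\<close>

lemma second_difference:
  fixes f :: "'e::euclidean_space \<Rightarrow> real"
  assumes f: "smooth_on (ball x r) f" and s: "s > 0" "s * (norm v + norm w) < r"
  shows "\<exists>y. dist x y \<le> s * (norm v + norm w) \<and>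
    f (x + s *\<^sub>R v + s *\<^sub>R w) - f (x + s *\<^sub>R v) - f (x + s *\<^sub>R w) + f x
      = s\<^sup>2 * diff (\<lambda>y. diff f y v) y w"
proof -
  have in_ball: "x + c *\<^sub>R v + d *\<^sub>R w \<in> ball x r \<and> dist x (x + c *\<^sub>R v + d *\<^sub>R w) \<le> s * (norm v + norm w)"
    if "0 \<le> c" "c \<le> s" "0 \<le> d" "d \<le> s" for c d
  proof -
    have "norm (c *\<^sub>R v + d *\<^sub>R w) \<le> c * norm v + d * norm w"
      using norm_triangle_ineq[of "c *\<^sub>R v" "d *\<^sub>R w"] that by simp
    also have "\<dots> \<le> s * (norm v + norm w)"
      using that by (auto simp: distrib_left intro!: add_mono mult_right_mono)
    finally have *: "norm (c *\<^sub>R v + d *\<^sub>R w) \<le> s * (norm v + norm w)" .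
    have "dist x (x + c *\<^sub>R v + d *\<^sub>R w) = norm (c *\<^sub>R v + d *\<^sub>R w)"
      using norm_minus_cancel[of "c *\<^sub>R v + d *\<^sub>R w"] by (simp add: dist_norm algebra_simps)
    with * s show ?thesis by auto
  qed
  define g where "g = (\<lambda>c. f (x + c *\<^sub>R v + s *\<^sub>R w) - f (x + c *\<^sub>R v + 0 *\<^sub>R w))"
  have dg: "(g has_real_derivative diff f (x + c *\<^sub>R v + s *\<^sub>R w) v - diff f (x + c *\<^sub>R v + 0 *\<^sub>R w) v) (at c)"
    if "0 \<le> c" "c \<le> s" for c
  proof -
    have D: "((\<lambda>c. f (x + c *\<^sub>R v + d *\<^sub>R w)) has_real_derivative diff f (x + c *\<^sub>R v + d *\<^sub>R w) v) (at c)"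
      if "0 \<le> d" "d \<le> s" for d
    proof -
      let ?y = "x + c *\<^sub>R v + d *\<^sub>R w"
      have f': "(f has_derivative diff f ?y) (at ?y)"
        using smooth_on_has_derivative[OF f] in_ball[OF \<open>0 \<le> c\<close> \<open>c \<le> s\<close> that] by blast
      have "((\<lambda>c. x + c *\<^sub>R v + d *\<^sub>R w) has_derivative (\<lambda>h. h *\<^sub>R v)) (at c)"
        by (auto intro!: derivative_eq_intros)
      from diff_chain_at[OF this f'] show ?thesis
        by (simp add: has_field_derivative_def o_def linear_scale[OF has_derivative_linear[OF f']] mult.commute[of _ "diff f ?y v"])
    qed
    show ?thesis unfolding g_def using D[of s] D[of 0] s by (intro DERIV_diff) auto
  qed
  obtain c where c: "0 < c" "c < s" "g s - g 0 = s * (diff f (x + c *\<^sub>R v + s *\<^sub>R w) v - diff f (x + c *\<^sub>R v + 0 *\<^sub>R w) v)"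
    using MVT2[OF s(1), of g "\<lambda>c. diff f (x + c *\<^sub>R v + s *\<^sub>R w) v - diff f (x + c *\<^sub>R v + 0 *\<^sub>R w) v"] dg by auto
  define p where "p = (\<lambda>d. diff f (x + c *\<^sub>R v + d *\<^sub>R w) v)"
  have dp: "(p has_real_derivative diff (\<lambda>y. diff f y v) (x + c *\<^sub>R v + d *\<^sub>R w) w) (at d)"
    if "0 \<le> d" "d \<le> s" for d
  proof -
    let ?y = "x + c *\<^sub>R v + d *\<^sub>R w"
    have f': "((\<lambda>y. diff f y v) has_derivative diff (\<lambda>y. diff f y v) ?y) (at ?y)"
      using smooth_on_has_derivative[OF smooth_on_diff[OF f, of v]] in_ball[of c d] c that by auto
    have "((\<lambda>d. x + c *\<^sub>R v + d *\<^sub>R w) has_derivative (\<lambda>h. h *\<^sub>R w)) (at d)"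
      by (auto intro!: derivative_eq_intros)
    from diff_chain_at[OF this f'] show ?thesis unfolding p_def
      by (simp add: has_field_derivative_def o_def linear_scale[OF has_derivative_linear[OF f']] mult.commute[of _ "diff (\<lambda>y. diff f y v) ?y w"])
  qed
  obtain d where d: "0 < d" "d < s" "p s - p 0 = s * diff (\<lambda>y. diff f y v) (x + c *\<^sub>R v + d *\<^sub>R w) w"
    using MVT2[OF s(1), of p "\<lambda>d. diff (\<lambda>y. diff f y v) (x + c *\<^sub>R v + d *\<^sub>R w) w"] dp by auto
  show ?thesis
  proof (intro exI conjI)
    show "dist x (x + c *\<^sub>R v + d *\<^sub>R w) \<le> s * (norm v + norm w)" using in_ball[of c d] c d by auto
    have "f (x + s *\<^sub>R v + s *\<^sub>R w) - f (x + s *\<^sub>R v) - f (x + s *\<^sub>R w) + f x = g s - g 0"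
      by (simp add: g_def)
    also have "\<dots> = s * (p s - p 0)" using c(3) by (simp add: p_def)
    finally show "f (x + s *\<^sub>R v + s *\<^sub>R w) - f (x + s *\<^sub>R v) - f (x + s *\<^sub>R w) + f x
        = s\<^sup>2 * diff (\<lambda>y. diff f y v) (x + c *\<^sub>R v + d *\<^sub>R w) w"
      using d(3) by (simp add: power2_eq_square)
  qed
qed

lemma diff_diff_commute_real:
  fixes f :: "'e::euclidean_space \<Rightarrow> real"
  assumes "open D" "smooth_on D f" "x \<in> D"
  shows "diff (\<lambda>y. diff f y v) x w = diff (\<lambda>y. diff f y w) x v"
proof (rule ccontr)
  let ?p = "\<lambda>y. diff (\<lambda>y. diff f y v) y w" and ?q = "\<lambda>y. diff (\<lambda>y. diff f y w) y v"
  assume ne: "?p x \<noteq> ?q x"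
  \<comment> \<open>Half the gap: a value within \<open>e\<close> of one limit cannot equal a value
    within \<open>e\<close> of the other.\<close>
  define e where "e = dist (?p x) (?q x) / 2"
  have e: "e > 0" using ne by (simp add: e_def)
  obtain r where r: "r > 0" "ball x r \<subseteq> D" using assms openE by blast
  have cont: "continuous_on D ?p" "continuous_on D ?q"
    by (intro smooth_on_continuous smooth_on_diff assms)+
  then have lim: "?p \<midarrow>x\<rightarrow> ?p x" "?q \<midarrow>x\<rightarrow> ?q x"
    using continuous_on_eq_continuous_at[OF assms(1)] assms(3) isContD by blast+
  have "\<forall>\<^sub>F y in at x. dist (?p y) (?p x) < e" "\<forall>\<^sub>F y in at x. dist (?q y) (?q x) < e"
    using tendstoD[OF lim(1) e] tendstoD[OF lim(2) e] by blast+
  then have "\<forall>\<^sub>F y in at x. dist (?p y) (?p x) < e \<and> dist (?q y) (?q x) < e" by eventually_elim auto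
  then obtain d where d0: "d > 0"
    "\<And>y. y \<noteq> x \<Longrightarrow> dist y x < d \<Longrightarrow> dist (?p y) (?p x) < e \<and> dist (?q y) (?q x) < e"
    unfolding eventually_at by blast
  have d: "d > 0" "\<And>y. dist y x < d \<Longrightarrow> dist (?p y) (?p x) < e \<and> dist (?q y) (?q x) < e"
     apply (fact d0(1))
    subgoal for y using d0(2)[of y] e by (cases "y = x") simp_all
    done
  define n where "n = norm v + norm w"
  \<comment> \<open>The summand 1 keeps the denominator positive when both vectors are zero; the
    factor 2 makes the bound by \<open>r\<close> and \<open>d\<close> strict.\<close>
  define s where "s = min r d / (2 * (n + 1))"
  have n: "n \<ge> 0" by (simp add: n_def)
  have s: "s > 0" using r d n by (simp add: s_def)
  have sn: "s * n < min r d"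
  proof -
    have "s * n \<le> s * (n + 1)" using s by simp
    also have "\<dots> = min r d / 2" using n by (simp add: s_def field_simps)
    also have "\<dots> < min r d" using r d(1) by (simp add: min_def)
    finally show ?thesis .
  qed
  have sm: "smooth_on (ball x r) f" using smooth_on_subset assms r by blast
  obtain y where y: "dist x y \<le> s * (norm v + norm w)"
    "f (x + s *\<^sub>R v + s *\<^sub>R w) - f (x + s *\<^sub>R v) - f (x + s *\<^sub>R w) + f x = s\<^sup>2 * ?p y"
    using second_difference[OF sm s, of v w] sn unfolding n_def by auto
  obtain z where z: "dist x z \<le> s * (norm w + norm v)"
    "f (x + s *\<^sub>R w + s *\<^sub>R v) - f (x + s *\<^sub>R w) - f (x + s *\<^sub>R v) + f x = s\<^sup>2 * ?q z"
    using second_difference[OF sm s, of w v] sn unfolding n_def by (auto simp: add.commute)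
  have "s\<^sup>2 * ?p y = s\<^sup>2 * ?q z" using y z by (simp add: algebra_simps)
  then have "?p y = ?q z" using s by simp
  moreover have "dist (?p y) (?p x) < e" "dist (?q z) (?q x) < e"
    using d(2)[of y] d(2)[of z] y z sn by (auto simp: n_def dist_commute add.commute)
  ultimately show False unfolding e_def dist_real_def by (smt (verit) field_sum_of_halves)
qed

lemma diff_inner:
  assumes "f differentiable (at x)"
  shows "diff (\<lambda>y. f y \<bullet> e) x v = diff f x v \<bullet> e"
  by (rule fun_cong[OF diff_eq[OF has_derivative_inner_left[OF diff_works[OF assms]]]])

lemma diff_diff_commute:
  fixes f :: "'e::euclidean_space \<Rightarrow> 'b::euclidean_space"
  assumes "open D" "smooth_on D f" "x \<in> D"
  shows "diff (\<lambda>y. diff f y v) x w = diff (\<lambda>y. diff f y w) x v"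
proof (rule euclidean_eqI)
  fix e :: 'b
  have *: "diff (\<lambda>y. diff f y v) x w \<bullet> e = diff (\<lambda>y. diff (\<lambda>y. f y \<bullet> e) y v) x w" for v w
  proof -
    have "diff (\<lambda>y. diff f y v) x w \<bullet> e = diff (\<lambda>y. diff f y v \<bullet> e) x w"
      by (rule diff_inner[OF smooth_on_differentiable[OF smooth_on_diff[OF assms(2)] assms(3)], symmetric])
    also have "\<dots> = diff (\<lambda>y. diff (\<lambda>y. f y \<bullet> e) y v) x w"
      by (rule fun_cong[OF diff_cong_on[OF assms(1,3)]])
        (simp add: diff_inner[OF smooth_on_differentiable[OF assms(2)]])
    finally show ?thesis .
  qed
  have "smooth_on D (\<lambda>y. f y \<bullet> e)" by (intro smooth_intros assms)
  then show "diff (\<lambda>y. diff f y v) x w \<bullet> e = diff (\<lambda>y. diff f y w) x v \<bullet> e"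
    unfolding * by (rule diff_diff_commute_real[OF assms(1) _ assms(3)])
qed

section \<open>Tensor fields evaluated on moving vectors\<close>

lemma linear_Basis_expand:
  fixes f :: "'e::euclidean_space \<Rightarrow> 'b::real_vector"
  assumes "linear f"
  shows "f v = (\<Sum>e\<in>Basis. (v \<bullet> e) *\<^sub>R f e)"
proof -
  have "f v = f (\<Sum>e\<in>Basis. (v \<bullet> e) *\<^sub>R e)" by (simp add: euclidean_representation)
  then show ?thesis by (simp add: linear_sum[OF assms] linear_scale[OF assms])
qed

text \<open>A form is a curried function, and only its values on fixed vectors are known to be
  differentiable. Expansion of \<open>s\<close> in the basis reduces the product rule to scalar
  coefficients. Derivatives of contracted tensors below go through this lemma or its bilinear
  version.\<close>

lemma has_derivative_form:
  fixes \<alpha> :: "'e::euclidean_space \<Rightarrow> 'f::euclidean_space \<Rightarrow> 'b::real_normed_vector"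
  assumes "open D" "x \<in> D" "\<And>y. y \<in> D \<Longrightarrow> linear (\<alpha> y)"
    and d: "\<And>v. (\<lambda>y. \<alpha> y v) differentiable (at x)" and s: "(s has_derivative s') (at x)"
  shows "((\<lambda>y. \<alpha> y (s y)) has_derivative (\<lambda>v. diff (\<lambda>y. \<alpha> y (s x)) x v + \<alpha> x (s' v))) (at x)"
proof -
  have ex: "\<alpha> y w = (\<Sum>e\<in>Basis. (w \<bullet> e) *\<^sub>R \<alpha> y e)" if "y \<in> D" for y w
    by (rule linear_Basis_expand[OF assms(3)[OF that]])
  have main: "((\<lambda>y. \<alpha> y (r y)) has_derivative
      (\<lambda>v. \<Sum>e\<in>Basis. (r x \<bullet> e) *\<^sub>R diff (\<lambda>y. \<alpha> y e) x v + (r' v \<bullet> e) *\<^sub>R \<alpha> x e)) (at x)"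
    if "(r has_derivative r') (at x)" for r r'
  proof (rule has_derivative_cong_on[OF assms(1,2)])
    show "((\<lambda>y. \<Sum>e\<in>Basis. (r y \<bullet> e) *\<^sub>R \<alpha> y e) has_derivative
      (\<lambda>v. \<Sum>e\<in>Basis. (r x \<bullet> e) *\<^sub>R diff (\<lambda>y. \<alpha> y e) x v + (r' v \<bullet> e) *\<^sub>R \<alpha> x e)) (at x)"
      by (intro has_derivative_sum has_derivative_scaleR has_derivative_inner_left that diff_works d)
  qed (simp add: ex[symmetric])
  have "diff (\<lambda>y. \<alpha> y (s x)) x v = (\<Sum>e\<in>Basis. (s x \<bullet> e) *\<^sub>R diff (\<lambda>y. \<alpha> y e) x v)" for v
    using diff_eq[OF main[OF has_derivative_const[of "s x"]]] by simp
  moreover have "\<alpha> x (s' v) = (\<Sum>e\<in>Basis. (s' v \<bullet> e) *\<^sub>R \<alpha> x e)" for v by (rule ex[OF assms(2)])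
  ultimately show ?thesis using main[OF s] by (simp add: sum.distrib)
qed

lemma has_derivative_bilinear_form:
  fixes G :: "'e::euclidean_space \<Rightarrow> 'f::euclidean_space \<Rightarrow> 'g::euclidean_space \<Rightarrow> 'b::real_normed_vector"
  assumes "open D" "x \<in> D" "\<And>y. y \<in> D \<Longrightarrow> bilinear (G y)"
    and d: "\<And>v w. (\<lambda>y. G y v w) differentiable (at x)"
    and s: "(s has_derivative s') (at x)" and r: "(r has_derivative r') (at x)"
  shows "((\<lambda>y. G y (s y) (r y)) has_derivative
    (\<lambda>v. diff (\<lambda>y. G y (s x) (r x)) x v + G x (s' v) (r x) + G x (s x) (r' v))) (at x)"
proof -
  have l: "linear (\<lambda>v. G y v w)" "linear (\<lambda>w. G y v w)" if "y \<in> D" for y v w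
    using assms(3)[OF that] by (auto simp: bilinear_def)
  have 1: "((\<lambda>y. G y (s y) w) has_derivative (\<lambda>v. diff (\<lambda>y. G y (s x) w) x v + G x (s' v) w)) (at x)" for w
    using has_derivative_form[where \<alpha> = "\<lambda>y v. G y v w", OF assms(1,2) l(1) d s] .
  have 2: "(\<lambda>y. G y (s y) w) differentiable (at x)" for w using 1 unfolding differentiable_def by blast
  have "((\<lambda>y. G y (s y) (r y)) has_derivative
      (\<lambda>v. diff (\<lambda>y. G y (s y) (r x)) x v + G x (s x) (r' v))) (at x)"
    using has_derivative_form[where \<alpha> = "\<lambda>y. G y (s y)", OF assms(1,2) l(2) 2 r] .
  then show ?thesis by (simp add: diff_eq[OF 1])
qed

lemma smooth_on_form:
  fixes \<alpha> :: "'e::euclidean_space \<Rightarrow> 'f::euclidean_space \<Rightarrow> 'b::real_normed_vector"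
  assumes "open D" "\<And>y. y \<in> D \<Longrightarrow> linear (\<alpha> y)" "\<And>v. smooth_on D (\<lambda>y. \<alpha> y v)" "smooth_on D s"
  shows "smooth_on D (\<lambda>y. \<alpha> y (s y))"
proof (rule smooth_on_cong[OF assms(1)])
  show "smooth_on D (\<lambda>y. \<Sum>e\<in>Basis. (s y \<bullet> e) *\<^sub>R \<alpha> y e)"
    by (intro smooth_on_sum smooth_on_scaleR smooth_on_inner smooth_on_const assms)
qed (use linear_Basis_expand[OF assms(2)] in simp)

lemma smooth_on_prod:
  fixes f :: "'i \<Rightarrow> 'e::euclidean_space \<Rightarrow> real"
  assumes "open D" "\<And>i. i \<in> I \<Longrightarrow> smooth_on D (f i)"
  shows "smooth_on D (\<lambda>x. \<Prod>i\<in>I. f i x)"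
  using assms(2)
  by (induction I rule: infinite_finite_induct) (auto intro!: smooth_on_const smooth_on_mult assms(1))

lemma smooth_on_det:
  fixes A :: "'e::euclidean_space \<Rightarrow> real^'n^'n"
  assumes "open D" "\<And>i j. smooth_on D (\<lambda>x. A x $ i $ j)"
  shows "smooth_on D (\<lambda>x. det (A x))"
  unfolding det_def by (intro smooth_on_sum smooth_on_mult smooth_on_const smooth_on_prod assms)

lemma smooth_on_vec:
  fixes f :: "'e::euclidean_space \<Rightarrow> real^'n"
  assumes "open D" "\<And>i. smooth_on D (\<lambda>x. f x $ i)"
  shows "smooth_on D f"
proof (rule smooth_on_cong[OF assms(1)])
  show "smooth_on D (\<lambda>x. \<Sum>i\<in>UNIV. f x $ i *\<^sub>R axis i 1)"
    by (intro smooth_on_sum smooth_on_scaleR smooth_on_const assms)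
qed (simp add: vec_eq_iff axis_def if_distrib cong: if_cong)

section \<open>Primitives of closed forms\<close>

text \<open>The primitive of \<open>\<eta>\<close> is its integral along the rays from the centre.\<close>

lemma poincare_ball:
  fixes \<eta> :: "'e::euclidean_space \<Rightarrow> 'e \<Rightarrow> real"
  assumes lin: "\<And>x. x \<in> ball c r \<Longrightarrow> linear (\<eta> x)"
    and sm: "\<And>v. smooth_on (ball c r) (\<lambda>x. \<eta> x v)"
    and closed: "\<And>x v w. x \<in> ball c r \<Longrightarrow> ext_deriv \<eta> x v w = 0"
  shows "\<exists>f. smooth_on (ball c r) f \<and> (\<forall>x\<in>ball c r. (f has_derivative \<eta> x) (at x))"
proof -
  let ?D = "ball c r"
  define \<gamma> where "\<gamma> = (\<lambda>x s. c + s *\<^sub>R (x - c))"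
  have \<gamma>: "\<gamma> x s \<in> ?D" if "x \<in> ?D" "s \<in> cbox 0 1" for x and s :: real
  proof -
    have "dist c (\<gamma> x s) = s * norm (x - c)" using that by (simp add: \<gamma>_def dist_norm)
    also have "\<dots> \<le> norm (x - c)" using that by (simp add: mult_left_le_one_le)
    finally show ?thesis using that by (simp add: dist_norm norm_minus_commute)
  qed
  define h where "h = (\<lambda>x s. \<eta> (\<gamma> x s) (x - c))"
  define h' where "h' = (\<lambda>x s z. s * diff (\<lambda>y. \<eta> y (x - c)) (\<gamma> x s) z + \<eta> (\<gamma> x s) z)"
  have dh: "((\<lambda>x. h x s) has_derivative h' x s) (at x)" if x: "x \<in> ?D" and s: "s \<in> cbox 0 1" for x s
  proof -
    note p = \<gamma>[OF x s]
    have g: "((\<lambda>x. \<gamma> x s) has_derivative (\<lambda>z. s *\<^sub>R z)) (at x)"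
      unfolding \<gamma>_def by (auto intro!: derivative_eq_intros)
    have lin': "linear (\<eta> (\<gamma> y s))" if "y \<in> ?D" for y using lin \<gamma>[OF that s] by blast
    have d: "((\<lambda>y. \<eta> (\<gamma> y s) v) has_derivative (\<lambda>z. s * diff (\<lambda>y. \<eta> y v) (\<gamma> x s) z)) (at x)" for v
      using diff_chain_at[OF g smooth_on_has_derivative[OF sm[of v] p]]
        linear_scale[OF smooth_on_linear_diff[OF sm[of v] p]] by (simp add: o_def)
    have e: "((\<lambda>x. x - c) has_derivative (\<lambda>z. z)) (at x)" by (auto intro!: derivative_eq_intros)
    have "((\<lambda>y. \<eta> (\<gamma> y s) (y - c)) has_derivative
        (\<lambda>z. diff (\<lambda>y. \<eta> (\<gamma> y s) (x - c)) x z + \<eta> (\<gamma> x s) z)) (at x)"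
      using has_derivative_form[where \<alpha> = "\<lambda>y. \<eta> (\<gamma> y s)", OF open_ball x lin' _ e] d
      unfolding differentiable_def by blast
    then show ?thesis by (simp add: h_def h'_def diff_eq[OF d])
  qed
  have lin_h': "bounded_linear (h' x s)" if "x \<in> ?D" "s \<in> cbox 0 1" for x s
    using has_derivative_bounded_linear[OF dh[OF that]] .
  have cont_\<gamma>: "continuous_on (?D \<times> cbox 0 1) (\<lambda>p. \<gamma> (fst p) (snd p))"
    unfolding \<gamma>_def by (intro continuous_intros)
  have im: "(\<lambda>p. \<gamma> (fst p) (snd p)) ` (?D \<times> cbox 0 1) \<subseteq> ?D" using \<gamma> by auto
  have cont_\<eta>: "continuous_on (?D \<times> cbox 0 1) (\<lambda>p. \<eta> (\<gamma> (fst p) (snd p)) v)" for v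
    using continuous_on_compose2[OF smooth_on_continuous[OF sm] cont_\<gamma> im] .
  have cont_D\<eta>: "continuous_on (?D \<times> cbox 0 1) (\<lambda>p. diff (\<lambda>y. \<eta> y v) (\<gamma> (fst p) (snd p)) z)" for v z
    using continuous_on_compose2[OF smooth_on_continuous[OF smooth_on_diff[OF sm]] cont_\<gamma> im] .
  \<comment> \<open>The vector \<open>x - c\<close> sits inside the form that is differentiated;
    moving its components out of the derivative makes joint continuity in \<open>x\<close> and
    \<open>s\<close> visible.\<close>
  have expand: "diff (\<lambda>y. \<eta> y w) y z = (\<Sum>e\<in>Basis. (w \<bullet> e) * diff (\<lambda>y. \<eta> y e) y z)" if "y \<in> ?D" for w y z
  proof -
    have "((\<lambda>y. \<Sum>e\<in>Basis. (w \<bullet> e) * \<eta> y e) has_derivative (\<lambda>z. \<Sum>e\<in>Basis. (w \<bullet> e) * diff (\<lambda>y. \<eta> y e) y z)) (at y)"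
      by (intro has_derivative_sum has_derivative_mult_right smooth_on_has_derivative[OF sm] that)
    from has_derivative_cong_on[OF open_ball that _ this, of "\<lambda>y. \<eta> y w"]
    show ?thesis using linear_Basis_expand[OF lin] by (simp add: diff_eq)
  qed
  have cont_h': "continuous_on (?D \<times> cbox 0 1) (\<lambda>p. h' (fst p) (snd p) z)" for z
  proof -
    have "continuous_on (?D \<times> cbox 0 1) (\<lambda>p. snd p * (\<Sum>e\<in>Basis. ((fst p - c) \<bullet> e) *
        diff (\<lambda>y. \<eta> y e) (\<gamma> (fst p) (snd p)) z) + \<eta> (\<gamma> (fst p) (snd p)) z)"
      by (intro continuous_intros cont_\<eta> cont_D\<eta>)
    then show ?thesis
    proof (rule continuous_on_cong[THEN iffD1, rotated -1])
      fix p :: "'e \<times> real" assume p: "p \<in> ?D \<times> cbox 0 1"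
      have "\<gamma> (fst p) (snd p) \<in> ?D" by (rule \<gamma>) (use p in auto)
      then show "snd p * (\<Sum>e\<in>Basis. ((fst p - c) \<bullet> e) *
        diff (\<lambda>y. \<eta> y e) (\<gamma> (fst p) (snd p)) z) + \<eta> (\<gamma> (fst p) (snd p)) z = h' (fst p) (snd p) z"
        by (simp only: h'_def expand[where w = "fst p - c"])
    qed simp
  qed
  \<comment> \<open>\<open>leibniz_rule\<close> asks for the derivative of the integrand as a
    continuous family of bounded linear maps, so the curried \<open>h'\<close> is packed into the
    type of such maps.\<close>
  define H' where "H' = (\<lambda>x s. Blinfun (h' x s))"
  have H': "blinfun_apply (H' x s) = h' x s" if "x \<in> ?D" "s \<in> cbox 0 1" for x s
    unfolding H'_def using bounded_linear_Blinfun_apply[OF lin_h'[OF that]] .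
  have cont_H': "continuous_on (?D \<times> cbox 0 1) (\<lambda>(x, s). H' x s)"
    by (rule continuous_on_blinfun_componentwise)
      (rule continuous_on_cong[THEN iffD1, OF refl _ cont_h'], auto simp: H')
  have cont_h: "continuous_on (cbox 0 1) (h x)" if "x \<in> ?D" for x
    unfolding h_def using continuous_on_compose2[OF cont_\<eta>[of "x - c"], of "cbox 0 1" "Pair x"] that
      continuous_on_Pair[OF continuous_on_const continuous_on_id, of "{0..1}" x]
    by (simp add: image_subset_iff)
  define f where "f = (\<lambda>x. integral (cbox 0 1) (h x))"
  have df: "(f has_derivative \<eta> x) (at x)" if x: "x \<in> ?D" for x
  proof -
    have "(f has_derivative blinfun_apply (integral (cbox 0 1) (H' x))) (at x within ?D)"
      unfolding f_def
      by (rule leibniz_rule[OF _ integrable_continuous[OF cont_h] cont_H' x convex_ball])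
        (use H' dh has_derivative_at_withinI in force)
    moreover have "blinfun_apply (integral (cbox 0 1) (H' x)) z = \<eta> x z" for z
    proof -
      have c: "continuous_on (cbox 0 1) (H' x)"
        using continuous_on_compose2[OF cont_H', of "cbox 0 1" "Pair x"] x
          continuous_on_Pair[OF continuous_on_const continuous_on_id, of "{0..1}" x]
        by (simp add: image_subset_iff)
      have "blinfun_apply (integral (cbox 0 1) (H' x)) z = integral (cbox 0 1) (\<lambda>s. h' x s z)"
        by (subst blinfun_apply_integral[OF integrable_continuous[OF c]])
          (auto intro!: integral_cong simp: H'[OF x])
      \<comment> \<open>Closedness lets the direction \<open>z\<close> and the vector
        \<open>x - c\<close> change places, so that \<open>h' x s z\<close> is the derivative of
        \<open>s * \<eta> (\<gamma> x s) z\<close> in \<open>s\<close>. The factor \<open>s\<close>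
        kills the value at 0, and the value at 1 is \<open>\<eta> x z\<close>.\<close>
      moreover have "((\<lambda>s. h' x s z) has_integral (1 * \<eta> (\<gamma> x 1) z - 0 * \<eta> (\<gamma> x 0) z)) {0..1}"
      proof (rule fundamental_theorem_of_calculus)
        fix s :: real assume s: "s \<in> {0..1}"
        then have p: "\<gamma> x s \<in> ?D" using \<gamma>[OF x] by simp
        have "((\<lambda>s. \<gamma> x s) has_derivative (\<lambda>k. k *\<^sub>R (x - c))) (at s)"
          unfolding \<gamma>_def by (auto intro!: derivative_eq_intros)
        from diff_chain_at[OF this smooth_on_has_derivative[OF sm[of z] p]]
        have "((\<lambda>s. \<eta> (\<gamma> x s) z) has_derivative (\<lambda>k. k * diff (\<lambda>y. \<eta> y z) (\<gamma> x s) (x - c))) (at s)"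
          using linear_scale[OF smooth_on_linear_diff[OF sm[of z] p]] by (simp add: o_def)
        then have "((\<lambda>s. \<eta> (\<gamma> x s) z) has_real_derivative diff (\<lambda>y. \<eta> y (x - c)) (\<gamma> x s) z) (at s)"
          using closed[OF p, of "x - c" z] by (simp add: ext_deriv_def has_field_derivative_def mult_commute_abs)
        then have "((\<lambda>s. s * \<eta> (\<gamma> x s) z) has_real_derivative h' x s z) (at s)"
          unfolding h'_def by (auto intro!: derivative_eq_intros)
        then show "((\<lambda>s. s * \<eta> (\<gamma> x s) z) has_vector_derivative h' x s z) (at s within {0..1})"
          using has_real_derivative_iff_has_vector_derivative has_vector_derivative_at_within by blast
      qed simp
      ultimately show ?thesis by (simp add: integral_unique \<gamma>_def)
    qed
    ultimately have "(f has_derivative \<eta> x) (at x within ?D)" by (metis ext)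
    then show ?thesis using at_within_open[OF x open_ball] by simp
  qed
  then have "smooth_on ?D f" using smooth_onI[OF open_ball df sm] by blast
  with df show ?thesis by blast
qed

section \<open>Inner products\<close>

definition inner_form :: "('e::real_vector \<Rightarrow> 'e \<Rightarrow> real) \<Rightarrow> bool" where
  "inner_form g \<longleftrightarrow> bilinear g \<and> (\<forall>v w. g v w = g w v) \<and> (\<forall>v. v \<noteq> 0 \<longrightarrow> g v v > 0)"

lemma inner_form_linear:
  assumes "inner_form g"
  shows "linear (g v)" "linear (\<lambda>v. g v w)"
  using assms by (auto simp: inner_form_def bilinear_def)

lemma inner_form_sym: "inner_form g \<Longrightarrow> g v w = g w v"
  by (simp add: inner_form_def)

lemma inner_form_simps:
  assumes "inner_form g"
  shows "g (x + y) z = g x z + g y z" "g z (x + y) = g z x + g z y"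
    "g (x - y) z = g x z - g y z" "g z (x - y) = g z x - g z y"
    "g (c *\<^sub>R x) z = c * g x z" "g z (c *\<^sub>R x) = c * g z x"
    "g (- x) z = - g x z" "g z (- x) = - g z x" "g 0 z = 0" "g z 0 = 0"
  using assms
  by (simp_all add: inner_form_def bilinear_ladd bilinear_radd bilinear_lsub bilinear_rsub
      bilinear_lmul bilinear_rmul bilinear_lneg bilinear_rneg bilinear_lzero bilinear_rzero)

lemma inner_form_cancel:
  assumes "inner_form g" "\<And>v. g x v = g y v"
  shows "x = y"
proof (rule ccontr)
  assume "x \<noteq> y"
  then have "g (x - y) (x - y) > 0" using assms(1) by (simp add: inner_form_def)
  then show False using assms(2) by (simp add: inner_form_simps[OF assms(1)])
qed

lemma sharp_unique:
  assumes "inner_form g" "\<And>v. g s v = \<alpha> v"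
  shows "sharp g \<alpha> = s"
  unfolding sharp_def using inner_form_cancel[OF assms(1)] assms(2) by (intro the_equality) auto

text \<open>\<open>sharp\<close> is a definite description, so existence has to be shown. The map
  \<open>T\<close> lowers an index; it is injective because the form is definite, hence surjective
  in finite dimension.\<close>

lemma sharp_works:
  fixes g :: "'e::euclidean_space \<Rightarrow> 'e \<Rightarrow> real"
  assumes g: "inner_form g" and \<alpha>: "linear \<alpha>"
  shows "g (sharp g \<alpha>) v = \<alpha> v"
proof -
  define T where "T = (\<lambda>s. \<Sum>e\<in>Basis. g s e *\<^sub>R e)"
  have T: "T s \<bullet> e = g s e" if "e \<in> Basis" for s e
    unfolding T_def using inner_sum_left_Basis[OF that, of "g s"] .
  have "linear T" unfolding T_def
    by (intro linearI) (simp_all add: inner_form_simps[OF g] scaleR_left.add sum.distrib scaleR_sum_right)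
  moreover have "inj T"
  proof (rule injI)
    fix x y assume xy: "T x = T y"
    have "g x v = g y v" for v
    proof -
      have "g x e = g y e" if "e \<in> Basis" for e using T[OF that] xy by metis
      then show ?thesis
        using linear_Basis_expand[OF inner_form_linear(1)[OF g], of x v]
          linear_Basis_expand[OF inner_form_linear(1)[OF g], of y v] by simp
    qed
    then show "x = y" using inner_form_cancel[OF g] by blast
  qed
  ultimately have "surj T" by (rule linear_inj_imp_surj)
  then obtain s where s: "T s = (\<Sum>e\<in>Basis. \<alpha> e *\<^sub>R e)" by (metis surjD)
  have "g s e = \<alpha> e" if "e \<in> Basis" for e
    using T[OF that, of s] inner_sum_left_Basis[OF that, of \<alpha>] by (simp add: s)
  then have "g s v = \<alpha> v" for v
    using linear_Basis_expand[OF inner_form_linear(1)[OF g], of s v] linear_Basis_expand[OF \<alpha>, of v] by simp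
  then show ?thesis using sharp_unique[OF g] by metis
qed

lemma sharp_linear_family:
  fixes g :: "'e::euclidean_space \<Rightarrow> 'e \<Rightarrow> real"
  assumes g: "inner_form g" and \<alpha>: "\<And>z. linear (\<lambda>v. \<alpha> v z)" and l: "\<And>v. linear (\<alpha> v)"
  shows "linear (\<lambda>v. sharp g (\<alpha> v))"
proof (rule linearI)
  show "sharp g (\<alpha> (x + y)) = sharp g (\<alpha> x) + sharp g (\<alpha> y)" for x y
    by (rule sharp_unique[OF g]) (simp add: inner_form_simps[OF g] sharp_works[OF g l] linear_add[OF \<alpha>])
  show "sharp g (\<alpha> (c *\<^sub>R x)) = c *\<^sub>R sharp g (\<alpha> x)" for c x
    by (rule sharp_unique[OF g]) (simp add: inner_form_simps[OF g] sharp_works[OF g l] linear_scale[OF \<alpha>])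
qed

section \<open>Gram matrices and the smoothness of raising an index\<close>

definition gram :: "(real^'n \<Rightarrow> real^'n \<Rightarrow> real) \<Rightarrow> real^'n^'n" where
  "gram g = (\<chi> i j. g (axis i 1) (axis j 1))"

lemma vec_axis_expand: "(\<Sum>j\<in>UNIV. v $ j *\<^sub>R axis j 1) = (v :: real^'n)"
  by (simp add: vec_eq_iff axis_def if_distrib cong: if_cong)

lemma gram_mult:
  assumes g: "inner_form g"
  shows "g v w = v \<bullet> (gram g *v w)" "gram g *v w = (\<chi> i. g (axis i 1) w)"
proof -
  have l: "f w = (\<Sum>j\<in>UNIV. f (axis j 1) * w $ j)" if "linear f" for f :: "real^'n \<Rightarrow> real" and w
    by (subst vec_axis_expand[symmetric, of w]) (simp add: linear_sum[OF that] linear_scale[OF that] mult.commute)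
  show 2: "gram g *v w = (\<chi> i. g (axis i 1) w)"
    by (simp add: gram_def matrix_vector_mult_def l[OF inner_form_linear(1)[OF g], symmetric])
  show "g v w = v \<bullet> (gram g *v w)"
    unfolding 2 by (simp add: inner_vec_def l[OF inner_form_linear(2)[OF g, of w], of v] mult.commute)
qed

lemma gram_sym: "inner_form g \<Longrightarrow> transpose (gram g) = gram g"
  by (simp add: gram_def transpose_def vec_eq_iff inner_form_sym[of g])

lemma det_gram_nonzero:
  assumes g: "inner_form g"
  shows "det (gram g) \<noteq> 0"
proof -
  have "inj ((*v) (gram g))"
  proof (rule injI)
    fix x y assume "gram g *v x = gram g *v y"
    then have "g v x = g v y" for v by (simp only: gram_mult(1)[OF g])
    then show "x = y" using inner_form_cancel[OF g] inner_form_sym[OF g] by metis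
  qed
  then show ?thesis using det_nz_iff_inj[of "(*v) (gram g)"] by simp
qed

text \<open>The source of smoothness for \<open>sharp\<close>: as a quotient of determinants, the
  raised form depends smoothly on the components of the form and of the metric.\<close>

lemma sharp_cramer:
  fixes g :: "real^'n \<Rightarrow> real^'n \<Rightarrow> real"
  assumes g: "inner_form g" and \<alpha>: "linear \<alpha>"
  shows "sharp g \<alpha> = (\<chi> k. det (\<chi> i j. if j = k then \<alpha> (axis i 1) else g (axis i 1) (axis j 1)) / det (gram g))"
proof -
  have "gram g *v sharp g \<alpha> = (\<chi> i. \<alpha> (axis i 1))"
    unfolding gram_mult(2)[OF g] inner_form_sym[OF g, of "axis _ 1" "sharp g \<alpha>"] sharp_works[OF g \<alpha>] ..
  then show ?thesis
    unfolding cramer[OF det_gram_nonzero[OF g]] by (simp add: gram_def cong: if_cong)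
qed

lemma smooth_on_sharp:
  fixes H :: "'e::euclidean_space \<Rightarrow> real^'n \<Rightarrow> real^'n \<Rightarrow> real"
  assumes D: "open D" and H: "\<And>x. x \<in> D \<Longrightarrow> inner_form (H x)" "\<And>v w. smooth_on D (\<lambda>x. H x v w)"
    and \<alpha>: "\<And>x. x \<in> D \<Longrightarrow> linear (\<alpha> x)" "\<And>v. smooth_on D (\<lambda>x. \<alpha> x v)"
  shows "smooth_on D (\<lambda>x. sharp (H x) (\<alpha> x))"
proof (rule smooth_on_cong[OF D sharp_cramer[symmetric, OF H(1) \<alpha>(1)]])
  have if_smooth: "smooth_on D (\<lambda>x. if b then f x else g x)" if "smooth_on D f" "smooth_on D g"
    for b and f g :: "'e \<Rightarrow> real" using that by (cases b) simp_all
  show "smooth_on D (\<lambda>x. \<chi> k. det (\<chi> i j. if j = k then \<alpha> x (axis i 1) else H x (axis i 1) (axis j 1))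
      / det (gram (H x)))"
  proof (intro smooth_on_vec D)
    fix k
    show "smooth_on D (\<lambda>x. (\<chi> k. det (\<chi> i j. if j = k then \<alpha> x (axis i 1) else H x (axis i 1) (axis j 1))
      / det (gram (H x))) $ k)"
      unfolding vec_lambda_beta gram_def
      by (intro smooth_on_divide smooth_on_det D)
        (simp_all only: vec_lambda_beta if_smooth H(2) \<alpha>(2) det_gram_nonzero[OF H(1), unfolded gram_def] not_False_eq_True)
  qed
qed

lemma sum_Basis_real3:
  fixes f :: "real^3 \<Rightarrow> 'b::comm_monoid_add"
  shows "(\<Sum>e\<in>Basis. f e) = f (axis 1 1) + f (axis 2 1) + f (axis 3 1)"
proof -
  have B: "Basis = range (\<lambda>i. axis i 1 :: real^3)" by (auto simp: Basis_vec_def)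
  have inj: "inj (\<lambda>i. axis i 1 :: real^3)" by (rule injI) (simp add: axis_eq_axis)
  show ?thesis by (simp only: B sum.reindex[OF inj] o_def sum_3)
qed

section \<open>Traces, cross products and the Hodge star in dimension three\<close>

definition trace_op :: "('e::euclidean_space \<Rightarrow> 'e) \<Rightarrow> real" where
  "trace_op L = (\<Sum>e\<in>Basis. L e \<bullet> e)"

context includes cross3_syntax begin

lemma linear_real3:
  fixes L :: "real^3 \<Rightarrow> real^3"
  assumes "linear L"
  shows "L v $ i = v $ 1 * L (axis 1 1) $ i + v $ 2 * L (axis 2 1) $ i + v $ 3 * L (axis 3 1) $ i"
  using arg_cong[OF linear_Basis_expand[OF assms, of v], of "\<lambda>x. x $ i"]
  by (simp add: sum_Basis_real3 inner_axis)

lemma trace_op_real3: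
  "trace_op L = L (axis 1 1) $ 1 + L (axis 2 1) $ 2 + L (axis 3 1) $ (3::3)"
  by (simp add: trace_op_def sum_Basis_real3 inner_axis)

text \<open>An operator acts on the determinant as a derivation, and this action is multiplication
  by its trace. Thus derivatives of the volume density cancel against Christoffel terms in the
  arguments of a volume form.\<close>

lemma cross3_trace:
  fixes a :: "real^3"
  assumes "linear L"
  shows "L a \<bullet> (b \<times> c) + a \<bullet> (L b \<times> c) + a \<bullet> (b \<times> L c) = trace_op L * (a \<bullet> (b \<times> c))"
  unfolding trace_op_real3 inner_vec_def sum_3 cross_components inner_real_def
    linear_real3[OF assms, of a] linear_real3[OF assms, of b] linear_real3[OF assms, of c]
  by algebra

text \<open>The sum is the trace of a symmetric operator followed by a skew one.\<close>

lemma cross3_selfadjoint: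
  fixes Q :: "real^3 \<Rightarrow> real^3"
  assumes "\<And>v w. Q v \<bullet> w = v \<bullet> Q w"
  shows "(\<Sum>e\<in>Basis. (Q e \<times> m) \<bullet> e) = 0"
  using assms[of "axis 1 1" "axis 2 1"] assms[of "axis 1 1" "axis 3 1"] assms[of "axis 2 1" "axis 3 1"]
  by (simp add: sum_Basis_real3 inner_axis inner_axis' cross_components)

text \<open>The cofactor identity for a symmetric matrix, through which the Euclidean cross product
  is related to the metric.\<close>

lemma gram_cross:
  fixes g :: "real^3 \<Rightarrow> real^3 \<Rightarrow> real"
  assumes g: "inner_form g"
  shows "gram g *v ((gram g *v a) \<times> (gram g *v b)) = det (gram g) *\<^sub>R (a \<times> b)"
  using cross_matrix_mult[of "gram g" a b] by (simp add: gram_sym[OF g])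

text \<open>Sylvester's criterion in dimension three: the form is evaluated at vectors whose images
  under the Gram matrix are multiples of a coordinate vector.\<close>

lemma det_gram_pos:
  fixes g :: "real^3 \<Rightarrow> real^3 \<Rightarrow> real"
  assumes g: "inner_form g"
  shows "det (gram g) > 0"
proof -
  have pos: "v \<noteq> 0 \<Longrightarrow> g v v > 0" for v using g by (simp add: inner_form_def)
  define m where "m i j = g (axis i 1) (axis j 1)" for i j
  have sym: "m 2 1 = m 1 2" "m 3 1 = m 1 3" "m 3 2 = m 2 3" by (simp_all add: m_def inner_form_sym[OF g])
  have m1: "m 1 1 > 0" unfolding m_def by (rule pos) simp
  define v :: "real^3" where "v = m 1 1 *\<^sub>R axis 2 1 - m 1 2 *\<^sub>R axis 1 1"
  have "v $ 2 = m 1 1" by (simp add: v_def axis_def)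
  then have "v \<noteq> 0" using m1 by (metis zero_index less_irrefl)
  from pos[OF this] have "m 1 1 * (m 1 1 * m 2 2 - m 1 2 * m 1 2) > 0"
    by (simp add: v_def inner_form_simps[OF g] m_def[symmetric] sym algebra_simps)
  then have m2: "m 1 1 * m 2 2 - m 1 2 * m 1 2 > 0" using m1 zero_less_mult_pos by blast
  define c where "c = (gram g *v axis 1 1) \<times> (gram g *v axis 2 1)"
  have c3: "c $ 3 = m 1 1 * m 2 2 - m 1 2 * m 1 2"
    unfolding c_def gram_mult(2)[OF g] cross_components vec_lambda_beta m_def[symmetric] sym by simp
  then have "c \<noteq> 0" using m2 by (metis zero_index less_irrefl)
  have "g c c = c \<bullet> (gram g *v c)" by (rule gram_mult(1)[OF g])
  also have "gram g *v c = det (gram g) *\<^sub>R axis 3 1"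
    unfolding c_def gram_cross[OF g] cross_basis ..
  finally have "g c c = det (gram g) * (c $ 3)" by (simp add: inner_axis)
  then show ?thesis using c3 m2 pos[OF \<open>c \<noteq> 0\<close>] by (simp add: zero_less_mult_iff)
qed

definition vol_density :: "(real^3 \<Rightarrow> real^3 \<Rightarrow> real) \<Rightarrow> real" where
  "vol_density g = sqrt (det (gram g))"

lemma vol_density_pos: "inner_form g \<Longrightarrow> vol_density g > 0"
  by (simp add: vol_density_def det_gram_pos)

lemma vol_density_square: "inner_form g \<Longrightarrow> vol_density g * vol_density g = det (gram g)"
  using det_gram_pos[of g] by (simp add: vol_density_def)

text \<open>The Euclidean dual of an alternating form; for the exterior derivative of a one-form it
  is the curl of the components, and no metric enters.\<close>

definition curl_vector :: "(real^3 \<Rightarrow> real^3 \<Rightarrow> real) \<Rightarrow> real^3" where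
  "curl_vector \<omega> = vector [\<omega> (axis 2 1) (axis 3 1), \<omega> (axis 3 1) (axis 1 1), \<omega> (axis 1 1) (axis 2 1)]"

lemma curl_vector_works:
  assumes b: "bilinear \<omega>" and alt: "\<And>v. \<omega> v v = 0"
  shows "\<omega> v w = curl_vector \<omega> \<bullet> (v \<times> w)"
proof -
  have skew: "\<omega> v w = - \<omega> w v" for v w
    using alt[of "v + w"] alt[of v] alt[of w] by (simp add: bilinear_ladd[OF b] bilinear_radd[OF b])
  have l: "linear (\<omega> v)" "linear (\<lambda>v. \<omega> v w)" for v w using b by (auto simp: bilinear_def)
  have "\<omega> v w = (\<Sum>e\<in>Basis. \<Sum>e'\<in>Basis. (v \<bullet> e) * ((w \<bullet> e') * \<omega> e e'))"
    unfolding linear_Basis_expand[OF l(2), of v w]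
    by (rule sum.cong[OF refl]) (subst linear_Basis_expand[OF l(1), of _ w], simp add: sum_distrib_left)
  then show ?thesis
    using alt skew[of "axis 2 1" "axis 1 1"] skew[of "axis 3 1" "axis 1 1"] skew[of "axis 3 1" "axis 2 1"]
    by (simp add: sum_Basis_real3 inner_axis curl_vector_def cross_components algebra_simps
        inner_vec_def[of "vector _"] sum_3)
qed

text \<open>The raised basis vectors \<open>P e\<close> solve \<open>gram g *v P e = e\<close>, so
  \<open>gram_cross\<close> turns their cross products into the Gram matrix applied to a Euclidean
  one, divided by its determinant. That determinant is the square of the density, and one of its two
  factors cancels against the density in \<open>vol_form\<close>.\<close>

lemma hodge_curl:
  assumes g: "inner_form g" and b: "bilinear \<omega>" and alt: "\<And>v. \<omega> v v = 0"
  shows "hodge g \<omega> z = g (curl_vector \<omega>) z / vol_density g"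
proof -
  let ?M = "gram g" and ?\<rho> = "vol_density g"
  define P where "P = (\<lambda>e. sharp g (\<lambda>v. v \<bullet> e))"
  have MP: "?M *v P e = e" for e
  proof (rule vec_eq_iff[THEN iffD2], rule allI)
    fix i
    have "g (P e) (axis i 1) = axis i 1 \<bullet> e"
      unfolding P_def by (rule sharp_works[OF g]) (simp add: bounded_linear.linear bounded_linear_inner_left)
    then show "(?M *v P e) $ i = e $ i"
      by (simp add: gram_mult(2)[OF g] inner_form_sym[OF g, of "axis i 1"] inner_axis')
  qed
  have \<rho>: "?\<rho> > 0" "?\<rho> * ?\<rho> = det ?M" using vol_density_pos vol_density_square g by auto
  have cross: "(P a \<times> P b) = (1 / det ?M) *\<^sub>R (?M *v (a \<times> b))" for a b
    using gram_cross[OF g, of "P a" "P b"] det_gram_pos[OF g] by (simp add: MP)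
  have vol: "vol_form g (P a) (P b) z = (a \<times> b) \<bullet> (?M *v z) / ?\<rho>" for a b
  proof -
    have "vol_form g (P a) (P b) z = ?\<rho> * ((P a \<times> P b) \<bullet> z)"
      unfolding vol_form_def gram_def[symmetric] vol_density_def[symmetric] dot_cross_det[symmetric]
        cross_triple[of "P a" "P b" z] inner_commute[of "P a"] ..
    also have "(P a \<times> P b) \<bullet> z = ((a \<times> b) \<bullet> (?M *v z)) / det ?M"
    proof -
      have "z \<bullet> (?M *v (a \<times> b)) = (a \<times> b) \<bullet> (?M *v z)"
        using inner_form_sym[OF g, of z "a \<times> b"] by (simp only: gram_mult(1)[OF g])
      then show ?thesis unfolding cross by (simp add: inner_commute[of z, symmetric])
    qed
    finally show ?thesis using \<rho>(1) unfolding \<rho>(2)[symmetric] by simp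
  qed
  let ?W = "curl_vector \<omega>"
  have P: "sharp g (\<lambda>v. v \<bullet> e) = P e" for e by (simp add: P_def)
  have "hodge g \<omega> z = (\<Sum>e\<in>Basis. \<Sum>e'\<in>Basis. (?W \<bullet> (e \<times> e')) * ((e \<times> e') \<bullet> (?M *v z) / ?\<rho>)) / 2"
  proof -
    have "\<omega> e e' * vol_form g (P e) (P e') z = (?W \<bullet> (e \<times> e')) * ((e \<times> e') \<bullet> (?M *v z) / ?\<rho>)" for e e'
      by (simp only: vol curl_vector_works[OF b alt, of e e'])
    then show ?thesis by (simp only: hodge_def P)
  qed
  also have "\<dots> = (?W $ 1 * (?M *v z) $ 1 + ?W $ 2 * (?M *v z) $ 2 + ?W $ 3 * (?M *v z) $ 3) / ?\<rho>"
    unfolding sum_Basis_real3 cross_basis cross_refl inner_minus_left inner_minus_right inner_axis inner_axis'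
      inner_zero_left inner_zero_right
    by (simp add: add_divide_distrib)
  also have "\<dots> = (?W \<bullet> (?M *v z)) / ?\<rho>" by (simp add: inner_vec_def[of ?W] sum_3)
  finally show ?thesis by (simp add: gram_mult(1)[OF g])
qed

end

section \<open>Metrics and monopoles in a chart\<close>

locale chart_metric =
  fixes D :: "(real^3) set" and H :: "real^3 \<Rightarrow> real^3 \<Rightarrow> real^3 \<Rightarrow> real"
  assumes open_D: "open D"
    and metric: "x \<in> D \<Longrightarrow> inner_form (H x)"
    and smooth_metric: "smooth_on D (\<lambda>x. H x v w)"
begin

abbreviation "\<Gamma> \<equiv> christoffel H"
abbreviation "\<rho> x \<equiv> vol_density (H x)"

lemmas metric_simps = inner_form_simps[OF metric]
lemmas metric_sym = inner_form_sym[OF metric]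
lemmas metric_cancel = inner_form_cancel[OF metric]

lemma metric_bilinear: "x \<in> D \<Longrightarrow> bilinear (H x)"
  using metric by (simp add: inner_form_def)

lemma metric_differentiable: "x \<in> D \<Longrightarrow> (\<lambda>y. H y v w) differentiable (at x)"
  by (rule smooth_on_differentiable[OF smooth_metric])

lemma metric_derivative:
  assumes "x \<in> D" "(s has_derivative s') (at x)" "(r has_derivative r') (at x)"
  shows "((\<lambda>y. H y (s y) (r y)) has_derivative
    (\<lambda>v. diff (\<lambda>y. H y (s x) (r x)) x v + H x (s' v) (r x) + H x (s x) (r' v))) (at x)"
  by (rule has_derivative_bilinear_form[OF open_D assms(1) metric_bilinear metric_differentiable[OF assms(1)] assms(2,3)])

lemma diff_metric_linear:
  assumes x: "x \<in> D"
  shows "linear (\<lambda>w. diff (\<lambda>y. H y w z) x v)" "linear (\<lambda>z. diff (\<lambda>y. H y w z) x v)"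
    "linear (diff (\<lambda>y. H y w z) x)"
proof -
  have sym: "diff (\<lambda>y. H y w z) x v = diff (\<lambda>y. H y z w) x v" for w z v
    using diff_cong_on[OF open_D x, of "\<lambda>y. H y w z" "\<lambda>y. H y z w"] metric_sym by simp
  have d: "((\<lambda>y. H y w z) has_derivative diff (\<lambda>y. H y w z) x) (at x)" for w z
    by (rule diff_works[OF metric_differentiable[OF x]])
  have add: "diff (\<lambda>y. H y (a + b) z) x v = diff (\<lambda>y. H y a z) x v + diff (\<lambda>y. H y b z) x v" for a b z v
    by (rule fun_cong[OF diff_eq[OF has_derivative_cong_on[OF open_D x _ has_derivative_add[OF d d]]]])
      (simp add: metric_simps)
  have scale: "diff (\<lambda>y. H y (c *\<^sub>R a) z) x v = c * diff (\<lambda>y. H y a z) x v" for c a z v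
    by (rule fun_cong[OF diff_eq[OF has_derivative_cong_on[OF open_D x _ has_derivative_mult_right[OF d]]]])
      (simp add: metric_simps)
  show *: "linear (\<lambda>w. diff (\<lambda>y. H y w z) x v)" for z by (rule linearI) (simp_all add: add scale)
  show "linear (\<lambda>z. diff (\<lambda>y. H y w z) x v)" using *[of w] by (simp add: sym[of w])
  show "linear (diff (\<lambda>y. H y w z) x)" by (rule linear_diff_at[OF metric_differentiable[OF x]])
qed

lemma diff_metric_sym:
  assumes x: "x \<in> D"
  shows "diff (\<lambda>y. H y w z) x v = diff (\<lambda>y. H y z w) x v"
  using diff_cong_on[OF open_D x, of "\<lambda>y. H y w z" "\<lambda>y. H y z w"] metric_sym by simp

lemma christoffel_rhs_linear:
  assumes x: "x \<in> D"
  defines "\<beta> \<equiv> \<lambda>v w z. (diff (\<lambda>y. H y w z) x v + diff (\<lambda>y. H y v z) x w - diff (\<lambda>y. H y v w) x z) / 2"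
  shows "linear (\<beta> v w)" "linear (\<lambda>v. \<beta> v w z)" "linear (\<lambda>w. \<beta> v w z)"
proof -
  have half: "linear (\<lambda>v. f v / 2)" if "linear f" for f :: "real^3 \<Rightarrow> real"
    by (rule linearI) (simp_all add: linear_add[OF that] linear_scale[OF that] add_divide_distrib)
  show "linear (\<beta> v w)" "linear (\<lambda>v. \<beta> v w z)" "linear (\<lambda>w. \<beta> v w z)"
    unfolding \<beta>_def by (intro half linear_compose_add linear_compose_sub diff_metric_linear[OF x])+
qed

lemma koszul:
  assumes x: "x \<in> D"
  shows "H x (\<Gamma> x v w) z = (diff (\<lambda>y. H y w z) x v + diff (\<lambda>y. H y v z) x w - diff (\<lambda>y. H y v w) x z) / 2"
  unfolding christoffel_def by (rule sharp_works[OF metric[OF x] christoffel_rhs_linear(1)[OF x]])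

lemma christoffel_sym:
  assumes x: "x \<in> D"
  shows "\<Gamma> x v w = \<Gamma> x w v"
  by (rule metric_cancel[OF x]) (simp add: koszul[OF x] diff_metric_sym[OF x, of v w])

lemma metric_compatible:
  assumes "x \<in> D"
  shows "diff (\<lambda>y. H y w z) x v = H x (\<Gamma> x v w) z + H x w (\<Gamma> x v z)"
  using koszul[OF assms, of v w z] koszul[OF assms, of v z w]
  by (simp add: metric_sym[OF assms, of w] diff_metric_sym[OF assms, of z w])

lemma christoffel_linear:
  assumes x: "x \<in> D"
  shows "linear (\<Gamma> x v)" "linear (\<lambda>v. \<Gamma> x v w)"
proof -
  show "linear (\<lambda>v. \<Gamma> x v w)" for w unfolding christoffel_def
    by (rule sharp_linear_family[OF metric[OF x] christoffel_rhs_linear(2,1)[OF x]])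
  moreover have "\<Gamma> x v = (\<lambda>w. \<Gamma> x w v)" using christoffel_sym[OF x, of v] by blast
  ultimately show "linear (\<Gamma> x v)" by metis
qed

lemma smooth_christoffel: "smooth_on D (\<lambda>x. \<Gamma> x v w)"
  unfolding christoffel_def
proof (rule smooth_on_sharp[OF open_D metric smooth_metric christoffel_rhs_linear(1)])
  show "smooth_on D (\<lambda>x. (diff (\<lambda>y. H y w z) x v + diff (\<lambda>y. H y v z) x w - diff (\<lambda>y. H y v w) x z) / 2)" for z
    by (rule smooth_on_divide[OF open_D _ smooth_on_diff_op[OF open_D smooth_on_add[OF open_D]] smooth_on_const[OF open_D]])
      (simp_all add: smooth_on_diff smooth_metric)
qed

lemma sharp_field_works: "x \<in> D \<Longrightarrow> linear (\<alpha> x) \<Longrightarrow> H x (sharp_field H \<alpha> x) v = \<alpha> x v"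
  unfolding sharp_field_def by (rule sharp_works[OF metric])

lemma smooth_sharp_field:
  assumes "\<And>x. x \<in> D \<Longrightarrow> linear (\<alpha> x)" "\<And>v. smooth_on D (\<lambda>x. \<alpha> x v)"
  shows "smooth_on D (sharp_field H \<alpha>)"
  unfolding sharp_field_def[abs_def] by (rule smooth_on_sharp[OF open_D metric smooth_metric assms])

lemma grad_works: "x \<in> D \<Longrightarrow> f differentiable (at x) \<Longrightarrow> H x (grad H f x) v = diff f x v"
  unfolding grad_def by (rule sharp_works[OF metric linear_diff_at])

lemma smooth_grad: "smooth_on D f \<Longrightarrow> smooth_on D (grad H f)"
  unfolding grad_def[abs_def]
  by (rule smooth_on_sharp[OF open_D metric smooth_metric smooth_on_linear_diff smooth_on_diff])

text \<open>The raised basis vectors are dual to the basis for the metric, so the metric trace in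
  \<open>laplacian\<close> is an ordinary trace of operators.\<close>

lemma trace_sharp:
  assumes x: "x \<in> D" and L: "linear L"
  shows "(\<Sum>e\<in>Basis. H x (L e) (sharp (H x) (\<lambda>v. v \<bullet> e))) = trace_op L"
proof -
  have "H x (L e) (sharp (H x) (\<lambda>v. v \<bullet> e)) = L e \<bullet> e" for e
    using sharp_works[OF metric[OF x], of "\<lambda>v. v \<bullet> e"]
    by (simp add: metric_sym[OF x, of "L e"] bounded_linear.linear bounded_linear_inner_left)
  then show ?thesis by (simp add: trace_op_def)
qed

text \<open>Jacobi's formula for the square root of the Gram determinant. Two operators are fed into
  it: the Christoffel operator, where it says that the volume form is parallel, and in
  \<open>contraction_ext_deriv\<close> an operator built from the derivative of a field that scales
  the metric.\<close>

lemma vol_density_derivative: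
  assumes x: "x \<in> D" and L: "linear L"
    and d: "\<And>v w. diff (\<lambda>y. H y v w) x X = H x (L v) w + H x v (L w)"
  shows "diff \<rho> x X = trace_op L * \<rho> x" "\<rho> differentiable (at x)"
proof -
  let ?m = "\<lambda>i j y. H y (axis i 1) (axis j 1)" and ?d = "\<lambda>i j. diff (\<lambda>y. H y (axis i 1) (axis j 1)) x"
  have dm: "((\<lambda>y. ?m i j y) has_derivative ?d i j) (at x)" for i j
    by (rule diff_works[OF metric_differentiable[OF x]])
  have dm': "?d i j X = (L (axis i 1) $ 1 * ?m 1 j x + L (axis i 1) $ 2 * ?m 2 j x + L (axis i 1) $ 3 * ?m 3 j x)
      + (L (axis j 1) $ 1 * ?m i 1 x + L (axis j 1) $ 2 * ?m i 2 x + L (axis j 1) $ 3 * ?m i 3 x)" for i j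
  proof -
    have e: "f v = v $ 1 * f (axis 1 1) + v $ 2 * f (axis 2 1) + v $ 3 * f (axis 3 1)"
      if "linear f" for f :: "real^3 \<Rightarrow> real" and v
      using linear_Basis_expand[OF that, of v] by (simp add: sum_Basis_real3 inner_axis)
    show ?thesis unfolding d
      using e[OF inner_form_linear(1)[OF metric[OF x], of "axis i 1"], of "L (axis j 1)"]
        e[OF inner_form_linear(2)[OF metric[OF x], of "axis j 1"], of "L (axis i 1)"] by simp
  qed
  define det' where "det' = (\<lambda>v. 
     ?d 1 1 v * (?m 2 2 x * ?m 3 3 x) + ?m 1 1 x * (?d 2 2 v * ?m 3 3 x + ?m 2 2 x * ?d 3 3 v)
   + ?d 1 2 v * (?m 2 3 x * ?m 3 1 x) + ?m 1 2 x * (?d 2 3 v * ?m 3 1 x + ?m 2 3 x * ?d 3 1 v)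
   + ?d 1 3 v * (?m 2 1 x * ?m 3 2 x) + ?m 1 3 x * (?d 2 1 v * ?m 3 2 x + ?m 2 1 x * ?d 3 2 v)
   - (?d 1 1 v * (?m 2 3 x * ?m 3 2 x) + ?m 1 1 x * (?d 2 3 v * ?m 3 2 x + ?m 2 3 x * ?d 3 2 v))
   - (?d 1 2 v * (?m 2 1 x * ?m 3 3 x) + ?m 1 2 x * (?d 2 1 v * ?m 3 3 x + ?m 2 1 x * ?d 3 3 v))
   - (?d 1 3 v * (?m 2 2 x * ?m 3 1 x) + ?m 1 3 x * (?d 2 2 v * ?m 3 1 x + ?m 2 2 x * ?d 3 1 v)))"
  have det: "det (gram (H y)) = ?m 1 1 y * (?m 2 2 y * ?m 3 3 y) + ?m 1 2 y * (?m 2 3 y * ?m 3 1 y)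
      + ?m 1 3 y * (?m 2 1 y * ?m 3 2 y) - ?m 1 1 y * (?m 2 3 y * ?m 3 2 y)
      - ?m 1 2 y * (?m 2 1 y * ?m 3 3 y) - ?m 1 3 y * (?m 2 2 y * ?m 3 1 y)" for y
    unfolding det_3 gram_def by simp
  have dm3: "((\<lambda>y. ?m i j y * (?m k l y * ?m p q y)) has_derivative
      (\<lambda>v. ?m i j x * (?m k l x * ?d p q v + ?d k l v * ?m p q x) + ?d i j v * (?m k l x * ?m p q x))) (at x)"
    for i j k l p q by (intro has_derivative_mult dm)
  have ddet: "((\<lambda>y. det (gram (H y))) has_derivative det') (at x)"
    unfolding det
    by (rule has_derivative_eq_rhs[OF has_derivative_diff[OF has_derivative_diff[OF has_derivative_diff[OF
          has_derivative_add[OF has_derivative_add[OF dm3 dm3] dm3] dm3] dm3] dm3]])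
      (simp add: det'_def fun_eq_iff algebra_simps)
  have e1: "det' X = 2 * trace_op L * det (gram (H x))"
    unfolding det'_def dm' det trace_op_real3 by algebra
  have p: "det (gram (H x)) > 0" by (rule det_gram_pos[OF metric[OF x]])
  have dr: "(\<rho> has_derivative (\<lambda>v. det' v * (inverse (sqrt (det (gram (H x)))) / 2))) (at x)"
    unfolding vol_density_def using has_derivative_real_sqrt[OF p ddet] .
  have "diff \<rho> x X = det' X * (inverse (sqrt (det (gram (H x)))) / 2)"
    by (simp only: diff_eq[OF dr])
  also have "\<dots> = trace_op L * (det (gram (H x)) / sqrt (det (gram (H x))))"
    unfolding e1 by (simp only: divide_inverse mult_ac) simp
  also have "det (gram (H x)) / sqrt (det (gram (H x))) = \<rho> x"
    using p real_div_sqrt[of "det (gram (H x))"] by (simp only: vol_density_def less_imp_le)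
  finally show "diff \<rho> x X = trace_op L * \<rho> x" .
  show "\<rho> differentiable (at x)" using dr unfolding differentiable_def by blast
qed

lemma vol_density_parallel:
  assumes x: "x \<in> D"
  shows "diff \<rho> x v = trace_op (\<Gamma> x v) * \<rho> x" "\<rho> differentiable (at x)"
  using vol_density_derivative[OF x christoffel_linear(1)[OF x] metric_compatible[OF x]] by auto

text \<open>The metric is parallel, so raising the index of the differential commutes with covariant
  differentiation.\<close>

lemma grad_derivative:
  assumes f: "smooth_on D f" and x: "x \<in> D"
  shows "H x (diff (grad H f) x v + \<Gamma> x v (grad H f x)) w = cov_deriv H (diff f) x v w"
proof -
  note fd = smooth_on_differentiable[OF f]
  have "((\<lambda>y. H y (grad H f y) w) has_derivative (\<lambda>v. diff (\<lambda>y. H y (grad H f x) w) x v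
      + H x (diff (grad H f) x v) w + H x (grad H f x) 0)) (at x)"
    by (rule metric_derivative[OF x smooth_on_has_derivative[OF smooth_grad[OF f] x] has_derivative_const])
  from has_derivative_cong_on[OF open_D x _ this, of "\<lambda>y. diff f y w"]
  have "diff (\<lambda>y. diff f y w) x v = diff (\<lambda>y. H y (grad H f x) w) x v
      + H x (diff (grad H f) x v) w + H x (grad H f x) 0"
    using grad_works fd by (simp add: diff_eq)
  then show ?thesis
    by (simp add: metric_compatible[OF x] cov_deriv_def metric_simps[OF x] grad_works[OF x fd[OF x], symmetric])
qed

lemma hessian_sym:
  assumes f: "smooth_on D f" and x: "x \<in> D"
  shows "cov_deriv H (diff f) x v w = cov_deriv H (diff f) x w v"
  unfolding cov_deriv_def
  using diff_diff_commute[OF open_D f x, of w v] christoffel_sym[OF x, of v w] by simp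

lemma laplacian_trace:
  assumes f: "smooth_on D f" and x: "x \<in> D"
  shows "laplacian H f x = trace_op (\<lambda>v. diff (grad H f) x v + \<Gamma> x v (grad H f x))"
proof -
  have "linear (\<lambda>v. diff (grad H f) x v + \<Gamma> x v (grad H f x))"
    by (intro linear_compose_add christoffel_linear[OF x] smooth_on_linear_diff[OF smooth_grad[OF f] x])
  from trace_sharp[OF x this] show ?thesis
    by (simp add: laplacian_def grad_derivative[OF f x])
qed

end

section \<open>The monopole equation and the operator J\<close>

lemma ext_deriv_alt: "ext_deriv \<alpha> x v v = 0"
  by (simp add: ext_deriv_def)

locale chart_monopole = chart_metric +
  fixes u :: "real^3 \<Rightarrow> real" and A :: "real^3 \<Rightarrow> real^3 \<Rightarrow> real"
  assumes smooth_u: "smooth_on D u" and u_pos: "x \<in> D \<Longrightarrow> u x > 0"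
    and linear_A: "x \<in> D \<Longrightarrow> linear (A x)" and smooth_A: "smooth_on D (\<lambda>x. A x v)"
    and monopole_eq: "x \<in> D \<Longrightarrow> diff u x z = hodge (H x) (ext_deriv A x) z"
begin

abbreviation "F \<equiv> ext_deriv A"
abbreviation "G \<equiv> grad H u"

lemma smooth_G: "smooth_on D G" by (rule smooth_grad[OF smooth_u])

lemma du_G: "x \<in> D \<Longrightarrow> diff u x v = H x (G x) v"
  using grad_works smooth_on_differentiable[OF smooth_u] by simp

lemma A_derivative_linear:
  assumes x: "x \<in> D"
  shows "linear (\<lambda>v. diff (\<lambda>y. A y v) x w)" "linear (diff (\<lambda>y. A y v) x)"
proof -
  have d: "((\<lambda>y. A y v) has_derivative diff (\<lambda>y. A y v) x) (at x)" for v
    by (rule smooth_on_has_derivative[OF smooth_A x])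
  have "diff (\<lambda>y. A y (a + b)) x w = diff (\<lambda>y. A y a) x w + diff (\<lambda>y. A y b) x w" for a b
    by (rule fun_cong[OF diff_eq[OF has_derivative_cong_on[OF open_D x _ has_derivative_add[OF d d]]]])
      (simp add: linear_add[OF linear_A])
  moreover have "diff (\<lambda>y. A y (c *\<^sub>R a)) x w = c * diff (\<lambda>y. A y a) x w" for a c
    by (rule fun_cong[OF diff_eq[OF has_derivative_cong_on[OF open_D x _ has_derivative_mult_right[OF d]]]])
      (simp add: linear_scale[OF linear_A])
  ultimately show "linear (\<lambda>v. diff (\<lambda>y. A y v) x w)" by (intro linearI) simp_all
  show "linear (diff (\<lambda>y. A y v) x)" by (rule smooth_on_linear_diff[OF smooth_A x])
qed

lemma F_bilinear:
  assumes x: "x \<in> D"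
  shows "bilinear (F x)"
  unfolding bilinear_def ext_deriv_def using A_derivative_linear[OF x]
  by (auto intro!: linear_compose_sub)

lemma F_skew: "F x v w = - F x w v"
  by (simp add: ext_deriv_def)

lemma smooth_F: "smooth_on D (\<lambda>x. F x v w)"
  unfolding ext_deriv_def by (intro smooth_on_diff_op smooth_on_diff smooth_A open_D)

context includes cross3_syntax begin

lemma triple_skew: "a \<bullet> (b \<times> c) = - (b \<bullet> (a \<times> c))"
  using cross_triple[of a c b] cross_skew[of c b] by (simp add: cross3_simps)

text \<open>The monopole equation solved for dA: by \<open>hodge_curl\<close> the Euclidean curl of
  \<open>A\<close> is the density times grad u, so dA is the volume form with grad u
  inserted.\<close>

lemma F_eq:
  assumes x: "x \<in> D"
  shows "F x v w = \<rho> x * (G x \<bullet> (v \<times> w))"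
proof -
  note p = vol_density_pos[OF metric[OF x]]
  have "G x = (1 / \<rho> x) *\<^sub>R curl_vector (F x)"
    by (rule metric_cancel[OF x])
      (simp add: du_G[OF x, symmetric] monopole_eq[OF x] hodge_curl[OF metric[OF x] F_bilinear[OF x] ext_deriv_alt]
        metric_simps[OF x])
  then have "curl_vector (F x) = \<rho> x *\<^sub>R G x" using p by simp
  then show ?thesis using curl_vector_works[OF F_bilinear[OF x] ext_deriv_alt, of v w] by simp
qed

text \<open>By the monopole equation, \<open>J\<close> is the cross product with \<open>grad u\<close>.\<close>

definition J :: "real^3 \<Rightarrow> real^3 \<Rightarrow> real^3" where "J x v = sharp (H x) (F x v)"

definition hess :: "real^3 \<Rightarrow> real^3 \<Rightarrow> real^3" where "hess x v = diff G x v + \<Gamma> x v (G x)"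

text \<open>The covariant derivative along \<open>v\<close> of the operator field \<open>J\<close>,
  applied to \<open>w\<close>.\<close>

definition nabla_J :: "real^3 \<Rightarrow> real^3 \<Rightarrow> real^3 \<Rightarrow> real^3" where
  "nabla_J x v w = diff (\<lambda>y. J y w) x v - J x (\<Gamma> x v w) + \<Gamma> x v (J x w)"

lemma F_linear:
  assumes x: "x \<in> D" shows "linear (F x v)" "linear (\<lambda>v. F x v w)"
  using F_bilinear[OF x] by (auto simp: bilinear_def)

lemma J_works: "x \<in> D \<Longrightarrow> H x (J x v) w = F x v w"
  unfolding J_def by (rule sharp_works[OF metric F_linear(1)])

lemma J_linear: "x \<in> D \<Longrightarrow> linear (J x)"
  unfolding J_def using sharp_linear_family[OF metric F_linear(2,1)] by blast

lemma smooth_J: "smooth_on D (\<lambda>x. J x v)"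
  unfolding J_def by (rule smooth_on_sharp[OF open_D metric smooth_metric F_linear(1) smooth_F])

lemma F_G: "x \<in> D \<Longrightarrow> F x (G x) w = 0" "x \<in> D \<Longrightarrow> F x w (G x) = 0"
  by (simp_all add: F_eq dot_cross_self)

lemma J_G: "x \<in> D \<Longrightarrow> J x (G x) = 0"
  by (rule metric_cancel[of x]) (simp_all add: J_works F_G metric_simps)

lemma G_J: "x \<in> D \<Longrightarrow> H x (G x) (J x w) = 0"
  using metric_sym[of x "G x"] by (simp add: J_works F_G)

text \<open>\<open>X\<close> is the cross product of \<open>a\<close> and \<open>b\<close> with
  respect to the metric; the conclusion expresses it by the Euclidean cross product of the lowered
  vectors.\<close>

lemma sharp_cross:
  assumes x: "x \<in> D" and X: "\<And>w. H x X w = \<rho> x * (a \<bullet> (b \<times> w))"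
  shows "X = (1 / \<rho> x) *\<^sub>R ((gram (H x) *v a) \<times> (gram (H x) *v b))"
proof (rule metric_cancel[OF x])
  fix w
  let ?M = "gram (H x)"
  note p = vol_density_pos[OF metric[OF x]]
  have "H x ((1 / \<rho> x) *\<^sub>R ((?M *v a) \<times> (?M *v b))) w = (w \<bullet> (det ?M *\<^sub>R (a \<times> b))) / \<rho> x"
    unfolding gram_cross[OF metric[OF x], symmetric] gram_mult(1)[OF metric[OF x], symmetric]
    by (simp add: metric_simps[OF x] metric_sym[OF x, of w])
  also have "\<dots> = \<rho> x * (w \<bullet> (a \<times> b))"
    using p by (simp add: vol_density_square[OF metric[OF x], symmetric])
  also have "w \<bullet> (a \<times> b) = a \<bullet> (b \<times> w)"
    unfolding dot_cross_det[symmetric] using cross_triple[of a b w] by (simp add: inner_commute)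
  finally show "H x X w = H x ((1 / \<rho> x) *\<^sub>R ((?M *v a) \<times> (?M *v b))) w" by (simp add: X)
qed

text \<open>\<open>X\<close> is a metric-symmetric operator followed by the metric cross product
  with \<open>z\<close>, which is skew. Composing \<open>S\<close> with the Gram matrix makes it
  symmetric in the Euclidean sense, as \<open>cross3_selfadjoint\<close> requires.\<close>

lemma trace_cross_selfadjoint:
  assumes x: "x \<in> D" and S: "\<And>v w. H x (S v) w = H x v (S w)"
    and X: "\<And>v w. H x (X v) w = \<rho> x * (S v \<bullet> (z \<times> w))"
  shows "trace_op X = 0"
proof -
  let ?M = "gram (H x)"
  have "(?M *v S v) \<bullet> w = v \<bullet> (?M *v S w)" for v w
    unfolding inner_commute[of _ w] gram_mult(1)[OF metric[OF x], symmetric]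
    using S[of v w] metric_sym[OF x, of w] by simp
  from cross3_selfadjoint[of "\<lambda>v. ?M *v S v", OF this, of "?M *v z"]
  show ?thesis
    by (simp add: trace_op_def sharp_cross[OF x X] sum_distrib_left[symmetric] sum_divide_distrib[symmetric])
qed

lemma trace_J: 
  assumes x: "x \<in> D"
  shows "trace_op (J x) = 0"
proof -
  have "trace_op (\<lambda>v. - J x v) = 0"
  proof (rule trace_cross_selfadjoint[OF x, of "\<lambda>v. v"])
    show "H x (- J x v) w = \<rho> x * (v \<bullet> (G x \<times> w))" for v w
      by (simp add: metric_simps[OF x] J_works[OF x] F_eq[OF x] triple_skew[of v])
  qed (simp add: metric_sym[OF x])
  then show ?thesis by (simp add: trace_op_def sum_negf)
qed

text \<open>The identity for the double cross product with the same vector grad u.\<close>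

lemma J_J:
  assumes x: "x \<in> D"
  shows "H x (J x (J x v)) w = H x (G x) v * H x (G x) w - H x (G x) (G x) * H x v w"
proof -
  let ?M = "gram (H x)"
  note p = vol_density_pos[OF metric[OF x]]
  have J: "J x v = (1 / \<rho> x) *\<^sub>R ((?M *v G x) \<times> (?M *v v))"
    by (rule sharp_cross[OF x]) (simp add: J_works[OF x] F_eq[OF x])
  have "H x (J x (J x v)) w = - (\<rho> x * (J x v \<bullet> (G x \<times> w)))"
    by (simp add: J_works[OF x] F_eq[OF x] triple_skew[of "G x"])
  also have "\<dots> = - (((?M *v G x) \<times> (?M *v v)) \<bullet> (G x \<times> w))" using p by (simp add: J)
  also have "\<dots> = - ((?M *v G x) \<bullet> G x * ((?M *v v) \<bullet> w) - (?M *v G x) \<bullet> w * ((?M *v v) \<bullet> G x))"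
    unfolding dot_cross ..
  also have "\<dots> = H x (G x) v * H x (G x) w - H x (G x) (G x) * H x v w"
    unfolding inner_commute[of "?M *v _"] gram_mult(1)[OF metric[OF x], symmetric]
    by (simp add: metric_sym[OF x, of w])
  finally show ?thesis .
qed

lemma hess_linear: "x \<in> D \<Longrightarrow> linear (hess x)"
  unfolding hess_def
  by (intro linear_compose_add christoffel_linear smooth_on_linear_diff[OF smooth_G])

lemma hess_works: "x \<in> D \<Longrightarrow> H x (hess x v) w = cov_deriv H (diff u) x v w"
  unfolding hess_def by (rule grad_derivative[OF smooth_u])

lemma hess_sym: "x \<in> D \<Longrightarrow> H x (hess x v) w = H x v (hess x w)"
  using metric_sym[of x v] hessian_sym[OF smooth_u] by (simp add: hess_works)

text \<open>Covariant differentiation commutes with the Hodge star because the volume form is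
  parallel: by \<open>cross3_trace\<close> the trace coming from the density is absorbed by the
  Christoffel terms, and the Hessian of \<open>u\<close> takes the place of grad u.\<close>

lemma F_derivative:
  assumes x: "x \<in> D"
  shows "diff (\<lambda>y. F y v w) x X = \<rho> x * (hess x X \<bullet> (v \<times> w)) + F x (\<Gamma> x X v) w + F x v (\<Gamma> x X w)"
proof -
  have "((\<lambda>y. \<rho> y * (G y \<bullet> (v \<times> w))) has_derivative
      (\<lambda>X. \<rho> x * (diff G x X \<bullet> (v \<times> w)) + diff \<rho> x X * (G x \<bullet> (v \<times> w)))) (at x)"
    by (intro has_derivative_mult has_derivative_inner_left diff_works vol_density_parallel(2)[OF x]
        smooth_on_differentiable[OF smooth_G x])
  from has_derivative_cong_on[OF open_D x _ this, of "\<lambda>y. F y v w"]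
  have "diff (\<lambda>y. F y v w) x X = \<rho> x * (diff G x X \<bullet> (v \<times> w)) + diff \<rho> x X * (G x \<bullet> (v \<times> w))"
    using F_eq by (simp add: diff_eq)
  then show ?thesis
    using arg_cong[OF cross3_trace[OF christoffel_linear(1)[OF x], of X "G x" v w], of "(*) (\<rho> x)"]
    by (simp add: vol_density_parallel(1)[OF x] hess_def F_eq[OF x] inner_add_left algebra_simps)
qed

lemma nabla_J_works:
  assumes x: "x \<in> D"
  shows "H x (nabla_J x X z) w = \<rho> x * (hess x X \<bullet> (z \<times> w))"
proof -
  have "((\<lambda>y. H y (J y z) w) has_derivative (\<lambda>v. diff (\<lambda>y. H y (J x z) w) x v
      + H x (diff (\<lambda>y. J y z) x v) w + H x (J x z) 0)) (at x)"
    by (rule metric_derivative[OF x smooth_on_has_derivative[OF smooth_J x] has_derivative_const])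
  from has_derivative_cong_on[OF open_D x _ this, of "\<lambda>y. F y z w"]
  have "diff (\<lambda>y. F y z w) x X = diff (\<lambda>y. H y (J x z) w) x X
      + H x (diff (\<lambda>y. J y z) x X) w + H x (J x z) 0"
    using J_works by (simp add: diff_eq)
  then show ?thesis
    by (simp add: F_derivative[OF x] metric_compatible[OF x] nabla_J_def metric_simps[OF x] J_works[OF x])
qed

text \<open>The divergence of \<open>J\<close> pairs the symmetric Hessian with a skew operator. In
  terms of forms: *dA = du is closed, so dA is coclosed.\<close>

lemma div_J:
  assumes x: "x \<in> D"
  shows "trace_op (\<lambda>e. nabla_J x e z) = 0"
  by (rule trace_cross_selfadjoint[OF x, OF hess_sym[OF x] nabla_J_works[OF x]])

text \<open>Differentiating the cross product with grad u gives the cross product with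
  \<open>hess x X\<close>, again a skew operator.\<close>

lemma trace_nabla_J:
  assumes x: "x \<in> D"
  shows "trace_op (nabla_J x X) = 0"
proof -
  have "trace_op (\<lambda>v. - nabla_J x X v) = 0"
  proof (rule trace_cross_selfadjoint[OF x, of "\<lambda>v. v"])
    show "H x (- nabla_J x X v) w = \<rho> x * (v \<bullet> (hess x X \<times> w))" for v w
      by (simp add: metric_simps[OF x] nabla_J_works[OF x] triple_skew[of v])
  qed (simp add: metric_sym[OF x])
  then show ?thesis by (simp add: trace_op_def sum_negf)
qed

end

end

section \<open>Traces of operators and derivatives on a product\<close>

lemma trace_op_add: "trace_op (\<lambda>e. f e + g e) = trace_op f + trace_op g"
  by (simp add: trace_op_def inner_add_left sum.distrib)

lemma trace_op_sub: "trace_op (\<lambda>e. f e - g e) = trace_op f - trace_op g"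
  by (simp add: trace_op_def inner_diff_left sum_subtractf)

lemma trace_op_scale: "trace_op (\<lambda>e. c *\<^sub>R f e) = c * trace_op f"
  by (simp add: trace_op_def sum_distrib_left)

lemma trace_op_rank1:
  fixes f :: "'e::euclidean_space \<Rightarrow> real"
  assumes "linear f"
  shows "trace_op (\<lambda>e. f e *\<^sub>R c) = f c"
  using linear_Basis_expand[OF assms, of c] by (simp add: trace_op_def mult.commute)

lemma trace_op_ident: "trace_op (\<lambda>e::real^3. e) = 3"
  by (simp add: trace_op_real3)

lemma trace_op_commute:
  fixes f g :: "'a::euclidean_space \<Rightarrow> 'a"
  assumes "linear f" "linear g"
  shows "trace_op (\<lambda>e. f (g e)) = trace_op (\<lambda>e. g (f e))"
proof -
  have *: "trace_op (\<lambda>e. f (g e)) = (\<Sum>e\<in>Basis. \<Sum>e'\<in>Basis. (g e \<bullet> e') * (f e' \<bullet> e))"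
    if "linear f" for f g :: "'a \<Rightarrow> 'a"
    unfolding trace_op_def
    by (rule sum.cong[OF refl]) (subst linear_Basis_expand[OF that], simp add: inner_sum_left)
  show ?thesis
    unfolding *[OF assms(1)] *[OF assms(2)]
    using sum.swap[of "\<lambda>e e'. (g e \<bullet> e') * (f e' \<bullet> e)" Basis Basis] by (simp add: mult.commute)
qed

lemma linear_real_mult:
  fixes f g :: "'e::real_vector \<Rightarrow> real"
  assumes "linear f"
  shows "linear (\<lambda>e. c * f e)" "linear (\<lambda>e. f e * c)" "linear (\<lambda>e. f e / c)" "linear (\<lambda>e. - f e)"
  by (auto intro!: linearI simp: linear_add[OF assms] linear_scale[OF assms] algebra_simps add_divide_distrib)

lemma sum_Basis_prod:
  fixes f :: "'a::euclidean_space \<times> 'b::euclidean_space \<Rightarrow> 'c::comm_monoid_add"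
  shows "sum f Basis = (\<Sum>e\<in>Basis. f (e, 0)) + (\<Sum>e\<in>Basis. f (0, e))"
proof -
  have "inj_on (\<lambda>e. (e::'a, 0::'b)) Basis" "inj_on (\<lambda>e. (0::'a, e::'b)) Basis" by (auto intro: inj_onI)
  then show ?thesis unfolding Basis_prod_def
    by (subst sum.union_disjoint) (auto simp: sum.reindex)
qed

lemma diff_form_linear:
  fixes \<alpha> :: "'e::euclidean_space \<Rightarrow> 'f::euclidean_space \<Rightarrow> 'b::real_normed_vector"
  assumes D: "open D" "x \<in> D" "\<And>y. y \<in> D \<Longrightarrow> linear (\<alpha> y)"
    and d: "\<And>v. (\<lambda>y. \<alpha> y v) differentiable (at x)"
  shows "linear (\<lambda>v. diff (\<lambda>y. \<alpha> y v) x w)"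
proof (rule linearI)
  note d = diff_works[OF d]
  show "diff (\<lambda>y. \<alpha> y (a + b)) x w = diff (\<lambda>y. \<alpha> y a) x w + diff (\<lambda>y. \<alpha> y b) x w" for a b
    by (rule fun_cong[OF diff_eq[OF has_derivative_cong_on[OF D(1,2) _ has_derivative_add[OF d d]]]])
      (simp add: linear_add[OF D(3)])
  show "diff (\<lambda>y. \<alpha> y (c *\<^sub>R a)) x w = c *\<^sub>R diff (\<lambda>y. \<alpha> y a) x w" for c a
    by (rule fun_cong[OF diff_eq[OF has_derivative_cong_on[OF D(1,2) _ has_derivative_scaleR_right[OF d]]]])
      (simp add: linear_scale[OF D(3)])
qed

lemma has_derivative_compose_fst:
  assumes "(f has_derivative f') (at x)"
  shows "((\<lambda>p. f (fst p)) has_derivative (\<lambda>X. f' (fst X))) (at (x, t))"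
  using diff_chain_at[OF has_derivative_fst[OF has_derivative_ident, of "at (x, t)"], of f f'] assms
  by (simp add: o_def)

section \<open>The Gibbons--Hawking metric\<close>

definition gh_form :: "(real^3 \<Rightarrow> real^3 \<Rightarrow> real^3 \<Rightarrow> real) \<Rightarrow> (real^3 \<Rightarrow> real) \<Rightarrow> (real^3 \<Rightarrow> real^3 \<Rightarrow> real)
    \<Rightarrow> (real^3) \<times> real \<Rightarrow> (real^3) \<times> real \<Rightarrow> (real^3) \<times> real \<Rightarrow> real" where
  "gh_form H u A = (\<lambda>(x, t) (v, r) (w, s).
     u x * H x v w + inverse (u x) * ((r + A x v) * (s + A x w)))"

context chart_monopole begin

abbreviation "gm \<equiv> gh_form H u A"
abbreviation "i x \<equiv> inverse (u x)"
abbreviation "du \<equiv> diff u"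
abbreviation "dA x X v \<equiv> diff (\<lambda>y. A y v) x X"

lemma gm_inner_form:
  assumes x: "x \<in> D"
  shows "inner_form (gm (x, t))"
  unfolding inner_form_def
proof (intro conjI allI impI)
  show "bilinear (gm (x, t))"
    unfolding bilinear_def
    by (intro conjI allI linearI)
      (auto simp: gh_form_def metric_simps[OF x] linear_add[OF linear_A[OF x]] linear_scale[OF linear_A[OF x]] algebra_simps)
  show "gm (x, t) v w = gm (x, t) w v" for v w
    using metric_sym[OF x, of "fst v" "fst w"] by (cases v; cases w) (simp add: gh_form_def mult.commute)
  show "gm (x, t) v v > 0" if "v \<noteq> 0" for v
  proof -
    obtain a r where v: "v = (a, r)" by (cases v)
    have u: "u x > 0" "i x > 0" using u_pos[OF x] by auto
    show ?thesis
    proof (cases "a = 0")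
      case True
      then have "r * r > 0" using that v by (metis not_real_square_gt_zero zero_prod_def)
      then show ?thesis using u True by (simp add: v gh_form_def metric_simps[OF x] linear_0[OF linear_A[OF x]])
    next
      case False
      then have "H x a a > 0" using metric[OF x] by (simp add: inner_form_def)
      then show ?thesis using u by (simp add: v gh_form_def add_pos_nonneg)
    qed
  qed
qed

lemma A_has_derivative: "x \<in> D \<Longrightarrow> ((\<lambda>y. A y v) has_derivative (\<lambda>X. dA x X v)) (at x)"
  by (rule smooth_on_has_derivative[OF smooth_A])

lemma inverse_u_has_derivative: "x \<in> D \<Longrightarrow> (i has_derivative (\<lambda>X. - (i x * du x X * i x))) (at x)"
  using Deriv.has_derivative_inverse[OF _ smooth_on_has_derivative[OF smooth_u]] u_pos by force

lemma H_has_derivative: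
  "x \<in> D \<Longrightarrow> ((\<lambda>y. H y v w) has_derivative (\<lambda>X. H x (\<Gamma> x X v) w + H x v (\<Gamma> x X w))) (at x)"
  using smooth_on_has_derivative[OF smooth_metric] metric_compatible by (metis (no_types, lifting) ext has_derivative_eq_rhs)

lemma du_has_derivative:
  assumes x: "x \<in> D"
  shows "((\<lambda>y. du y v) has_derivative (\<lambda>X. H x (hess x X) v + du x (\<Gamma> x X v))) (at x)"
proof (rule has_derivative_eq_rhs[OF smooth_on_has_derivative[OF smooth_on_diff[OF smooth_u] x]], rule ext)
  show "diff (\<lambda>y. du y v) x X = H x (hess x X) v + du x (\<Gamma> x X v)" for X
    by (simp add: hess_works[OF x] cov_deriv_def)
qed

lemma G_has_derivative: "x \<in> D \<Longrightarrow> (G has_derivative (\<lambda>X. hess x X - \<Gamma> x X (G x))) (at x)"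
  by (rule has_derivative_eq_rhs[OF smooth_on_has_derivative[OF smooth_G]]) (simp_all add: hess_def fun_eq_iff)

lemma J_has_derivative:
  "x \<in> D \<Longrightarrow> ((\<lambda>y. J y v) has_derivative (\<lambda>X. nabla_J x X v + J x (\<Gamma> x X v) - \<Gamma> x X (J x v))) (at x)"
  by (rule has_derivative_eq_rhs[OF smooth_on_has_derivative[OF smooth_J]]) (simp_all add: nabla_J_def fun_eq_iff)

text \<open>Neither \<open>t\<close> nor \<open>k\<close> occurs on the right: translations along
  the fibre are isometries.\<close>

lemma gm_derivative:
  assumes x: "x \<in> D"
  shows "diff (\<lambda>y. gm y (v, r) (w, s)) (x, t) (X, k) =
    du x X * H x v w + u x * (H x (\<Gamma> x X v) w + H x v (\<Gamma> x X w))
    - i x * i x * du x X * ((r + A x v) * (s + A x w))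
    + i x * (dA x X v * (s + A x w) + (r + A x v) * dA x X w)"
proof -
  have "((\<lambda>y. u y * H y v w + i y * ((r + A y v) * (s + A y w))) has_derivative
     (\<lambda>X. (u x * (H x (\<Gamma> x X v) w + H x v (\<Gamma> x X w)) + du x X * H x v w) +
       (i x * ((r + A x v) * (0 + dA x X w) + (0 + dA x X v) * (s + A x w))
        + - (i x * du x X * i x) * ((r + A x v) * (s + A x w))))) (at x)"
    by (intro has_derivative_add has_derivative_mult has_derivative_const smooth_on_has_derivative[OF smooth_u x]
        H_has_derivative[OF x] inverse_u_has_derivative[OF x] A_has_derivative[OF x])
  from has_derivative_compose_fst[OF this, of t]
  have "((\<lambda>y. gm y (v, r) (w, s)) has_derivative (\<lambda>X. (u x * (H x (\<Gamma> x (fst X) v) w + H x v (\<Gamma> x (fst X) w)) + du x (fst X) * H x v w) +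
       (i x * ((r + A x v) * (0 + dA x (fst X) w) + (0 + dA x (fst X) v) * (s + A x w))
        + - (i x * du x (fst X) * i x) * ((r + A x v) * (s + A x w))))) (at (x, t))"
    by (simp only: gh_form_def split_beta fst_conv snd_conv)
  from fun_cong[OF diff_eq[OF this], of "(X, k)"] show ?thesis by (simp add: algebra_simps)
qed

text \<open>The bracket with factor \<open>i x\<close> is the conformal change from h to u h, the
  \<open>J\<close> terms come from the curvature dA of the horizontal distribution, and the last
  term from the squared fibre length 1/u.\<close>

definition gh_base :: "real^3 \<Rightarrow> real \<Rightarrow> real \<Rightarrow> real^3 \<Rightarrow> real^3 \<Rightarrow> real^3" where
  "gh_base x p q v w = \<Gamma> x v w + (1 / 2) *\<^sub>R (i x *\<^sub>R (du x v *\<^sub>R w + du x w *\<^sub>R v - H x v w *\<^sub>R G x)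
     + (i x * i x) *\<^sub>R (q *\<^sub>R J x v + p *\<^sub>R J x w) + (i x * i x * i x * (p * q)) *\<^sub>R G x)"

text \<open>The value of \<open>dt + A\<close> on the Christoffel vector. The symmetrised derivative
  of \<open>A\<close> comes from the coordinate frame and disappears again from the Ricci
  tensor.\<close>

definition gh_fibre :: "real^3 \<Rightarrow> real \<Rightarrow> real \<Rightarrow> real^3 \<Rightarrow> real^3 \<Rightarrow> real" where
  "gh_fibre x p q v w = (dA x v w + dA x w v) / 2 - i x / 2 * (q * du x v + p * du x w)"

text \<open>Here \<open>p\<close> and \<open>q\<close> are the values of \<open>dt + A\<close> on the two arguments.\<close>

lemma christoffel_gm:
  assumes x: "x \<in> D"
  shows "christoffel gm (x, t) (v, r) (w, s) =
    (gh_base x (r + A x v) (s + A x w) v w,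
     gh_fibre x (r + A x v) (s + A x w) v w - A x (gh_base x (r + A x v) (s + A x w) v w))"
  unfolding christoffel_def
proof (rule sharp_unique[OF gm_inner_form[OF x]])
  fix Z :: "(real^3) \<times> real"
  obtain z k where Z: "Z = (z, k)" by (cases Z)
  \<comment> \<open>The value \<open>m\<close> of \<open>dt + A\<close> on the test vector plays the
    same role as \<open>p\<close> and \<open>q\<close>. In these numbers the Koszul formula becomes
    a polynomial identity modulo \<open>u x * i x = 1\<close>.\<close>
  define p q m where "p = r + A x v" and "q = s + A x w" and "m = k + A x z"
  have ui: "u x * i x = 1" using u_pos[OF x] by simp
  have dAF: "F x v z = dA x v z - dA x z v" "F x w z = dA x w z - dA x z w" by (simp_all add: ext_deriv_def)
  have g1: "H x (\<Gamma> x w v) z = H x (\<Gamma> x v w) z" "H x v (\<Gamma> x w z) = H x (\<Gamma> x z w) v"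
    "H x (\<Gamma> x z v) w = H x w (\<Gamma> x v z)" "H x v (\<Gamma> x z w) = H x (\<Gamma> x z w) v"
    using christoffel_sym[OF x] metric_sym[OF x] by metis+
  have lhs: "gm (x, t) (gh_base x p q v w, gh_fibre x p q v w - A x (gh_base x p q v w)) (z, k)
    = u x * (H x (\<Gamma> x v w) z + (i x * (du x v * H x w z + du x w * H x v z - H x v w * du x z)
      + i x * i x * (q * F x v z + p * F x w z) + i x * i x * i x * (p * q) * du x z) / 2)
      + i x * (((dA x v w + dA x w v) / 2 - i x / 2 * (q * du x v + p * du x w)) * m)"
    by (simp add: gh_form_def gh_fibre_def gh_base_def metric_simps[OF x] J_works[OF x] du_G[OF x] m_def)
  show "gm (x, t) (gh_base x (r + A x v) (s + A x w) v w,
       gh_fibre x (r + A x v) (s + A x w) v w - A x (gh_base x (r + A x v) (s + A x w) v w)) Z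
     = (diff (\<lambda>y. gm y (w, s) Z) (x, t) (v, r) + diff (\<lambda>y. gm y (v, r) Z) (x, t) (w, s)
        - diff (\<lambda>y. gm y (v, r) (w, s)) (x, t) Z) / 2"
    unfolding Z gm_derivative[OF x] p_def[symmetric] q_def[symmetric] lhs m_def[symmetric] dAF g1
    using ui by algebra
qed


section \<open>The Ricci tensor of the Gibbons-Hawking metric\<close>

definition gh_base' :: "real^3 \<Rightarrow> real \<Rightarrow> real \<Rightarrow> real^3 \<Rightarrow> real^3 \<Rightarrow> real^3 \<Rightarrow> real^3" where
  "gh_base' x p q v w X = diff (\<lambda>y. \<Gamma> y v w) x X + (1 / 2) *\<^sub>R (
     i x *\<^sub>R ((H x (hess x X) v + du x (\<Gamma> x X v)) *\<^sub>R w + (H x (hess x X) w + du x (\<Gamma> x X w)) *\<^sub>R v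
       - (H x (\<Gamma> x X v) w + H x v (\<Gamma> x X w)) *\<^sub>R G x - H x v w *\<^sub>R (hess x X - \<Gamma> x X (G x)))
     - (i x * i x) *\<^sub>R (du x X *\<^sub>R (du x v *\<^sub>R w + du x w *\<^sub>R v - H x v w *\<^sub>R G x))
     + (i x * i x) *\<^sub>R (dA x X w *\<^sub>R J x v + q *\<^sub>R (nabla_J x X v + J x (\<Gamma> x X v) - \<Gamma> x X (J x v))
       + dA x X v *\<^sub>R J x w + p *\<^sub>R (nabla_J x X w + J x (\<Gamma> x X w) - \<Gamma> x X (J x w)))
     - (2 * (i x * i x * i x)) *\<^sub>R (du x X *\<^sub>R (q *\<^sub>R J x v + p *\<^sub>R J x w))
     + (i x * i x * i x) *\<^sub>R ((dA x X v * q + p * dA x X w) *\<^sub>R G x + (p * q) *\<^sub>R (hess x X - \<Gamma> x X (G x)))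
     - (3 * (i x * i x * i x * i x) * (p * q)) *\<^sub>R (du x X *\<^sub>R G x))"

text \<open>The vectors stay fixed, so the values of \<open>dt + A\<close> on them move with
  \<open>A\<close>; this is the origin of the terms \<open>dA x X v\<close> and
  \<open>dA x X w\<close> in \<open>gh_base'\<close>.\<close>

lemma gh_base_has_derivative:
  assumes x: "x \<in> D"
  shows "((\<lambda>y. gh_base y (r + A y v) (s + A y w) v w) has_derivative
    gh_base' x (r + A x v) (s + A x w) v w) (at x)"
proof -
  note d = has_derivative_add has_derivative_diff has_derivative_scaleR has_derivative_mult has_derivative_const
    smooth_on_has_derivative[OF smooth_christoffel x] inverse_u_has_derivative[OF x] H_has_derivative[OF x]
    du_has_derivative[OF x] G_has_derivative[OF x] J_has_derivative[OF x] A_has_derivative[OF x]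
  show ?thesis unfolding gh_base_def
    by (rule has_derivative_eq_rhs, ((rule d)+)[1]) (simp add: gh_base'_def fun_eq_iff algebra_simps)
qed

lemma gh_linear:
  assumes x: "x \<in> D"
  shows "linear (\<lambda>e. du x e)" "linear (\<lambda>e. dA x e v)" "linear (\<lambda>e. dA x v e)" "linear (\<lambda>e. H x e v)"
    "linear (\<lambda>e. H x (hess x e) v)" "linear (\<lambda>e. H x (hess x v) e)"
    "linear (\<lambda>e. du x (\<Gamma> x e v))" "linear (\<lambda>e. du x (\<Gamma> x v e))"
    "linear (\<lambda>e. H x (\<Gamma> x e v) w)" "linear (\<lambda>e. H x w (\<Gamma> x e v))"
    "linear (\<lambda>e. H x (\<Gamma> x v e) w)" "linear (\<lambda>e. H x e (\<Gamma> x v w))"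
  using A_derivative_linear[OF x] smooth_on_linear_diff[OF smooth_u x] inner_form_linear[OF metric[OF x]]
    linear_compose[OF hess_linear[OF x] inner_form_linear(2)[OF metric[OF x]]]
    linear_compose[OF christoffel_linear(1)[OF x] smooth_on_linear_diff[OF smooth_u x]]
    linear_compose[OF christoffel_linear(2)[OF x] smooth_on_linear_diff[OF smooth_u x]]
    linear_compose[OF christoffel_linear(2)[OF x] inner_form_linear(2)[OF metric[OF x]]]
    linear_compose[OF christoffel_linear(2)[OF x] inner_form_linear(1)[OF metric[OF x]]]
    linear_compose[OF christoffel_linear(1)[OF x] inner_form_linear(2)[OF metric[OF x]]]
  by (simp_all add: o_def)

lemma gh_linear_simps:
  assumes x: "x \<in> D"
  shows "du x (a + b) = du x a + du x b" "du x (a - b) = du x a - du x b" "du x (c *\<^sub>R a) = c * du x a"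
    "\<Gamma> x v (a + b) = \<Gamma> x v a + \<Gamma> x v b" "\<Gamma> x v (a - b) = \<Gamma> x v a - \<Gamma> x v b" "\<Gamma> x v (c *\<^sub>R a) = c *\<^sub>R \<Gamma> x v a"
    "J x (a + b) = J x a + J x b" "J x (a - b) = J x a - J x b" "J x (c *\<^sub>R a) = c *\<^sub>R J x a"
    "dA x v (a + b) = dA x v a + dA x v b" "dA x v (a - b) = dA x v a - dA x v b" "dA x v (c *\<^sub>R a) = c * dA x v a"
    "dA x (a + b) v = dA x a v + dA x b v" "dA x (a - b) v = dA x a v - dA x b v" "dA x (c *\<^sub>R a) v = c * dA x a v"
  using gh_linear(1-3)[OF x] christoffel_linear(1)[OF x] J_linear[OF x]
  by (simp_all add: linear_add[OF gh_linear(1)[OF x]] linear_diff[OF gh_linear(1)[OF x]] linear_scale[OF gh_linear(1)[OF x]]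
    linear_add[OF gh_linear(2)[OF x]] linear_diff[OF gh_linear(2)[OF x]] linear_scale[OF gh_linear(2)[OF x]]
    linear_add[OF gh_linear(3)[OF x]] linear_diff[OF gh_linear(3)[OF x]] linear_scale[OF gh_linear(3)[OF x]]
    linear_add[OF christoffel_linear(1)[OF x]] linear_diff[OF christoffel_linear(1)[OF x]] linear_scale[OF christoffel_linear(1)[OF x]]
    linear_add[OF J_linear[OF x]] linear_diff[OF J_linear[OF x]] linear_scale[OF J_linear[OF x]])

lemmas trace_simps = trace_op_add trace_op_sub trace_op_scale trace_op_rank1 trace_op_ident
  linear_real_mult linear_compose_add linear_compose_sub

lemma du_J: "x \<in> D \<Longrightarrow> du x (J x v) = 0"
  by (simp add: du_G G_J)

lemma trace_hess:
  assumes "x \<in> D" "laplacian H u x = 0"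
  shows "trace_op (hess x) = 0"
  using laplacian_trace[OF smooth_u assms(1)] assms(2) by (simp add: hess_def[abs_def])

text \<open>Harmonicity removes the trace of the Hessian and \<open>div_J\<close> the derivative of
  \<open>J\<close>. The Hessian on \<open>w\<close>, \<open>z\<close> stays with coefficient 1/u; it
  cancels in \<open>ricci_gm\<close> against -3/2 of it from
  \<open>trace_base_derivative_slot\<close> and 1/2 of it from the fibre direction.\<close>

lemma trace_base_derivative:
  assumes x: "x \<in> D" and lap: "laplacian H u x = 0"
  shows "trace_op (gh_base' x q s w z) = trace_op (diff (\<lambda>y. \<Gamma> y w z) x) + (
    i x * (2 * H x (hess x w) z + 2 * du x (\<Gamma> x w z)
      - (H x (\<Gamma> x (G x) w) z + H x w (\<Gamma> x (G x) z)) + H x w z * trace_op (\<lambda>e. \<Gamma> x e (G x)))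
    - i x * i x * (2 * du x w * du x z - H x w z * du x (G x))
    + i x * i x * (dA x (J x w) z + dA x (J x z) w
      + s * (trace_op (\<lambda>e. J x (\<Gamma> x e w)) - trace_op (\<lambda>e. \<Gamma> x e (J x w)))
      + q * (trace_op (\<lambda>e. J x (\<Gamma> x e z)) - trace_op (\<lambda>e. \<Gamma> x e (J x z))))
    + i x * i x * i x * (dA x (G x) w * s + q * dA x (G x) z - q * s * trace_op (\<lambda>e. \<Gamma> x e (G x)))
    - 3 * (i x * i x * i x * i x) * (q * s) * du x (G x)) / 2"
proof -
  have h: "H x (hess x z) w = H x (hess x w) z" using hess_sym[OF x, of z w] metric_sym[OF x, of z] by simp
  show ?thesis
    unfolding gh_base'_def[abs_def]
    by (simp add: trace_simps gh_linear[OF x] gh_linear_simps[OF x] trace_hess[OF x lap] div_J[OF x] du_J[OF x]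
        h christoffel_sym[OF x, of z w] algebra_simps add_divide_distrib diff_divide_distrib del: scaleR_scaleR)
qed


text \<open>The slot over which the trace runs carries the value 0 of \<open>dt + A\<close>, because
  base traces are taken over horizontal lifts.\<close>

lemma trace_base_derivative_slot:
  assumes x: "x \<in> D"
  shows "trace_op (\<lambda>e. gh_base' x 0 s e z w) = trace_op (\<lambda>e. diff (\<lambda>y. \<Gamma> y e z) x w) + (
    3 * i x * (H x (hess x w) z + du x (\<Gamma> x w z)) - 3 * (i x * i x) * (du x w * du x z)
    + i x * i x * dA x w (J x z) + i x * i x * i x * (dA x w (G x) * s)) / 2"
proof -
  have c: "trace_op (\<lambda>e. J x (\<Gamma> x w e)) = trace_op (\<lambda>e. \<Gamma> x w (J x e))"
    by (rule trace_op_commute[OF J_linear[OF x] christoffel_linear(1)[OF x]])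
  have g: "H x (G x) v = du x v" for v by (rule du_G[OF x, symmetric])
  show ?thesis
    unfolding gh_base'_def
    by (simp add: trace_simps gh_linear[OF x] gh_linear_simps[OF x] trace_nabla_J[OF x] trace_J[OF x] du_J[OF x] g c
        metric_simps[OF x] algebra_simps add_divide_distrib diff_divide_distrib del: scaleR_scaleR)
qed

lemma trace_base_slot:
  assumes x: "x \<in> D"
  shows "trace_op (\<lambda>e. gh_base x 0 r e c) = trace_op (\<lambda>e. \<Gamma> x e c) + 3 / 2 * i x * du x c"
proof -
  have g: "H x (G x) v = du x v" for v by (rule du_G[OF x, symmetric])
  show ?thesis
    unfolding gh_base_def
    by (simp add: trace_simps gh_linear[OF x] gh_linear_simps[OF x] trace_J[OF x] g
        algebra_simps add_divide_distrib diff_divide_distrib del: scaleR_scaleR)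
qed

lemma trace_christoffel_base:
  assumes x: "x \<in> D"
  shows "trace_op (\<lambda>e. \<Gamma> x e (gh_base x q s w z)) = trace_op (\<lambda>e. \<Gamma> x e (\<Gamma> x w z)) + (
    i x * (du x w * trace_op (\<lambda>e. \<Gamma> x e z) + du x z * trace_op (\<lambda>e. \<Gamma> x e w) - H x w z * trace_op (\<lambda>e. \<Gamma> x e (G x)))
    + i x * i x * (s * trace_op (\<lambda>e. \<Gamma> x e (J x w)) + q * trace_op (\<lambda>e. \<Gamma> x e (J x z)))
    + i x * i x * i x * (q * s) * trace_op (\<lambda>e. \<Gamma> x e (G x))) / 2"
  unfolding gh_base_def
  by (simp add: trace_simps gh_linear[OF x] gh_linear_simps[OF x]
        algebra_simps add_divide_distrib diff_divide_distrib del: scaleR_scaleR)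

lemma du_base:
  assumes x: "x \<in> D"
  shows "du x (gh_base x q s w z) = du x (\<Gamma> x w z) + (i x * (2 * du x w * du x z - H x w z * du x (G x))
    + i x * i x * i x * (q * s) * du x (G x)) / 2"
  unfolding gh_base_def by (simp add: gh_linear_simps[OF x] du_J[OF x] algebra_simps add_divide_distrib diff_divide_distrib)

lemma trace_J_J:
  assumes x: "x \<in> D"
  shows "trace_op (\<lambda>e. J x (J x e)) = - 2 * du x (G x)"
proof -
  have "J x (J x e) = du x e *\<^sub>R G x - du x (G x) *\<^sub>R e" for e
    by (rule metric_cancel[OF x]) (simp add: J_J[OF x] metric_simps[OF x] du_G[OF x])
  then show ?thesis by (simp add: trace_simps gh_linear[OF x])
qed

text \<open>The trace of a product of two Christoffel operators. The inner vector has base part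
  \<open>gh_base x 0 s e z\<close> and \<open>dt + A\<close> takes the value
  \<open>gh_fibre x 0 s e z\<close> on it, so both enter the outer one.\<close>

lemma trace_base_base:
  assumes x: "x \<in> D"
  shows "trace_op (\<lambda>e. gh_base x q (gh_fibre x 0 s e z) w (gh_base x 0 s e z)) = trace_op (\<lambda>e. \<Gamma> x w (\<Gamma> x e z)) + (
      i x * (du x (\<Gamma> x w z) + du x z * trace_op (\<lambda>e. \<Gamma> x e w) - H x (\<Gamma> x w (G x)) z)
      + i x * i x * s * trace_op (\<lambda>e. \<Gamma> x w (J x e))) / 2
    + i x * (du x w * (trace_op (\<lambda>e. \<Gamma> x e z) + 3 / 2 * i x * du x z)
        + (du x (\<Gamma> x w z) + i x * (2 * du x w * du x z - H x w z * du x (G x)) / 2)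
        - (H x w (\<Gamma> x (G x) z) + i x * (du x (G x) * H x w z) / 2)) / 2
    + i x * i x * ((dA x (J x w) z + dA x z (J x w)) / 2
        + q * (trace_op (\<lambda>e. J x (\<Gamma> x e z)) - i x * i x * s * du x (G x))) / 2
    + i x * i x * i x * q * ((dA x (G x) z + dA x z (G x)) / 2 - i x * s * du x (G x) / 2) / 2"
proof -
  have g: "H x (G x) v = du x v" "H x v (G x) = du x v" for v
    using du_G[OF x, of v] metric_sym[OF x, of v] by simp_all
  have l: "linear (\<lambda>e. H x w (J x e))" "linear (\<lambda>e. dA x (J x e) z)" "linear (\<lambda>e. H x w e)"
    using inner_form_linear(1)[OF metric[OF x]] linear_compose[OF J_linear[OF x] inner_form_linear(1)[OF metric[OF x]]]
      linear_compose[OF J_linear[OF x] gh_linear(2)[OF x]] by (simp_all add: o_def)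
  have c: "trace_op (\<lambda>e. \<Gamma> x w e) = trace_op (\<lambda>e. \<Gamma> x e w)"
    using christoffel_sym[OF x, of w] by simp
  have j: "H x z (J x w) = - H x w (J x z)" for z w
    using J_works[OF x, of w z] J_works[OF x, of z w] F_skew[of x z w] metric_sym[OF x, of z] metric_sym[OF x, of w] by simp
  show ?thesis
    unfolding gh_base_def gh_fibre_def
    by (simp add: trace_simps gh_linear[OF x] gh_linear_simps[OF x] trace_J[OF x] trace_J_J[OF x] g l c J_G[OF x] du_J[OF x]
        metric_simps[OF x] algebra_simps add_divide_distrib diff_divide_distrib del: scaleR_scaleR)
qed


lemma u_nonzero: "x \<in> D \<Longrightarrow> u x \<noteq> 0"
  using u_pos by (metis less_irrefl)

lemma smooth_gh_fibre: "smooth_on D (\<lambda>y. gh_fibre y (r + A y v) (s + A y w) v w)"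
  unfolding gh_fibre_def divide_inverse
  by (intro smooth_on_add smooth_on_diff_op smooth_on_mult smooth_on_const smooth_on_inverse
      smooth_on_diff smooth_u smooth_A open_D)
    (simp_all add: u_nonzero)

lemma christoffel_gm_has_derivative:
  assumes x: "x \<in> D"
  defines "B \<equiv> \<lambda>v r w s y. gh_base y (r + A y v) (s + A y w) v w"
    and "T \<equiv> \<lambda>v r w s y. gh_fibre y (r + A y v) (s + A y w) v w"
  shows "((\<lambda>y. christoffel gm y (v, r) (w, s)) has_derivative (\<lambda>X.
    (gh_base' x (r + A x v) (s + A x w) v w (fst X),
     diff (T v r w s) x (fst X) - (dA x (fst X) (B v r w s x) + A x (gh_base' x (r + A x v) (s + A x w) v w (fst X))))))
    (at (x, t))"
proof -
  have "((\<lambda>y. A y (B v r w s y)) has_derivative (\<lambda>X. dA x X (B v r w s x)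
      + A x (gh_base' x (r + A x v) (s + A x w) v w X))) (at x)"
    using has_derivative_form[OF open_D x linear_A smooth_on_differentiable[OF smooth_A x] gh_base_has_derivative[OF x]]
    unfolding B_def .
  from has_derivative_Pair[OF gh_base_has_derivative[OF x]
      has_derivative_diff[OF smooth_on_has_derivative[OF smooth_gh_fibre x] this]]
  have "((\<lambda>y. (B v r w s y, T v r w s y - A y (B v r w s y))) has_derivative (\<lambda>X.
    (gh_base' x (r + A x v) (s + A x w) v w X,
     diff (T v r w s) x X - (dA x X (B v r w s x) + A x (gh_base' x (r + A x v) (s + A x w) v w X))))) (at x)"
    by (simp add: B_def T_def)
  note this[THEN has_derivative_compose_fst, of t]
  then show ?thesis
    by (rule has_derivative_cong_on[OF open_Times[OF open_D open_UNIV], rotated -1])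
      (use x in \<open>auto simp: christoffel_gm B_def T_def\<close>)
qed

lemma christoffel_gm_bilinear:
  assumes x: "x \<in> D"
  shows "bilinear (christoffel gm (x, t))"
  unfolding bilinear_def
  by (intro conjI allI linearI)
    (auto simp: christoffel_gm[OF x] gh_base_def gh_fibre_def gh_linear_simps[OF x] metric_simps[OF x]
      linear_add[OF christoffel_linear(2)[OF x]] linear_scale[OF christoffel_linear(2)[OF x]]
      linear_add[OF linear_A[OF x]] linear_diff[OF linear_A[OF x]] linear_scale[OF linear_A[OF x]]
      algebra_simps add_divide_distrib)

text \<open>Linearity in the first slot permits a change of the frame in which the Ricci trace is
  taken.\<close>

lemma riemann_gm_linear:
  assumes x: "x \<in> D"
  shows "linear (\<lambda>E. riemann gm (x, t) E W Z)"
proof -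
  have d: "(\<lambda>y. christoffel gm y V W) differentiable (at (x, t))" for V W
    using christoffel_gm_has_derivative[OF x, of "fst V" "snd V" "fst W" "snd W" t]
    unfolding differentiable_def by auto
  have b: "bilinear (christoffel gm y)" if "y \<in> D \<times> UNIV" for y
    using that christoffel_gm_bilinear by (cases y) auto
  then have l: "linear (\<lambda>V. christoffel gm y V Z)" "linear (christoffel gm y W)" if "y \<in> D \<times> UNIV" for y Z W
    using b[OF that] unfolding bilinear_def by blast+
  have X: "(x, t) \<in> D \<times> UNIV" using x by simp
  have "linear (\<lambda>E. diff (\<lambda>y. christoffel gm y E Z) (x, t) W)"
    by (rule diff_form_linear[OF open_Times[OF open_D open_UNIV] X l(1) d])
  then show ?thesis
    unfolding riemann_def
    using linear_diff_at[OF d[of W Z]] l[OF X]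
      linear_compose[OF l(1)[OF X, of Z] l(2)[OF X, of W]]
    by (intro linear_compose_add linear_compose_sub) (simp_all add: o_def)
qed

text \<open>The trace is moved from the coordinate basis to the horizontal lifts
  \<open>(e, - A x e)\<close> and the fibre direction. On the lifts \<open>dt + A\<close> vanishes,
  which removes many Christoffel terms; the last summand is \<open>dt + A\<close> applied to the
  image of the fibre direction.\<close>

lemma ricci_gm_trace:
  assumes x: "x \<in> D"
  shows "ricci gm (x, t) W Z = trace_op (\<lambda>e. fst (riemann gm (x, t) (e, - A x e) W Z))
    + (snd (riemann gm (x, t) (0, 1) W Z) + A x (fst (riemann gm (x, t) (0, 1) W Z)))"
proof -
  let ?R = "\<lambda>E. riemann gm (x, t) E W Z"
  have "?R (e, 0) = ?R (e, - A x e) + A x e *\<^sub>R ?R (0, 1)" for e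
    using linear_add[OF riemann_gm_linear[OF x, of t W Z], of "(e, - A x e)" "A x e *\<^sub>R (0, 1)"]
      linear_scale[OF riemann_gm_linear[OF x, of t W Z], of "A x e" "(0, 1)"] by simp
  then have "fst (?R (e, 0)) \<bullet> e = fst (?R (e, - A x e)) \<bullet> e + (A x e *\<^sub>R fst (?R (0, 1))) \<bullet> e" for e
    by (simp add: inner_add_left)
  moreover have "(\<Sum>e\<in>Basis. (A x e *\<^sub>R fst (?R (0, 1))) \<bullet> e) = A x (fst (?R (0, 1)))"
    using trace_op_rank1[OF linear_A[OF x]] by (simp add: trace_op_def)
  ultimately show ?thesis
    unfolding ricci_def sum_Basis_prod trace_op_def by (simp add: inner_Pair_0 sum.distrib)
qed

lemma ricci_gm:
  assumes x: "x \<in> D" and lap: "laplacian H u x = 0"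
  shows "ricci gm (x, t) (w, k) (z, l) = ricci H x w z"
proof -
  define q s where "q = k + A x w" and "s = l + A x z"
  define C T where "C = gh_base x q s w z" and "T = gh_fibre x q s w z"
  \<comment> \<open>The base part of the Christoffel vector of the fibre direction, on which
    \<open>dt + A\<close> is 1, and \<open>(z, l)\<close>.\<close>
  define Y where "Y = gh_base x 1 s 0 z"
  define j where "j = i x"
  have A0: "A x 0 = 0" "- A x e + A x e = 0" for e using linear_0[OF linear_A[OF x]] by auto
  note d = diff_eq[OF christoffel_gm_has_derivative[OF x]]
  note ch = christoffel_gm[OF x]
  have R1: "fst (riemann gm (x, t) (e, - A x e) (w, k) (z, l)) =
      gh_base' x q s w z e - gh_base' x 0 s e z w + gh_base x 0 T e C
      - gh_base x q (gh_fibre x 0 s e z) w (gh_base x 0 s e z)" for e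
    by (simp add: riemann_def d ch A0 q_def[symmetric] s_def[symmetric] C_def[symmetric] T_def[symmetric])
  have z0: "gh_base' x p r v y 0 = 0" "diff (\<lambda>y. gh_fibre y (m + A y a) (n + A y b) a b) x 0 = 0" if "p = m + A x v" "r = n + A x y" for p r m n v y a b
    using linear_0[OF has_derivative_linear[OF gh_base_has_derivative[OF x, of m v n y]]] that
      linear_0[OF smooth_on_linear_diff[OF smooth_gh_fibre x]] by simp_all
  have G0: "\<Gamma> x 0 v = 0" "dA x 0 v = 0" "dA x v 0 = 0" "J x 0 = 0" "du x 0 = 0" for v
    using linear_0[OF christoffel_linear(2)[OF x]] linear_0[OF gh_linear(2)[OF x]] linear_0[OF gh_linear(3)[OF x]]
      linear_0[OF J_linear[OF x]] linear_0[OF gh_linear(1)[OF x]] by simp_all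
  have Y: "Y = (1 / 2) *\<^sub>R ((i x * i x) *\<^sub>R J x z + (i x * i x * i x * s) *\<^sub>R G x)"
    by (simp add: Y_def gh_base_def G0 metric_simps[OF x])
  have f1: "gh_fibre x 1 r 0 v = - (i x * du x v) / 2" for r v
    by (simp add: gh_fibre_def G0)
  have T': "diff (\<lambda>y. gh_fibre y (1 + A y 0) (l + A y z) 0 z) x w
      = - (i x * (H x (hess x w) z + du x (\<Gamma> x w z)) - i x * i x * du x w * du x z) / 2"
  proof -
    have "((\<lambda>y. - (1 / 2) * (i y * du y z)) has_derivative (\<lambda>X. - (1 / 2) *
        (i x * (H x (hess x X) z + du x (\<Gamma> x X z)) + - (i x * du x X * i x) * du x z))) (at x)"
      by (intro has_derivative_mult_right has_derivative_mult inverse_u_has_derivative[OF x] du_has_derivative[OF x])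
    moreover have "- (1 / 2) * (i y * du y z) = gh_fibre y (1 + A y 0) (l + A y z) 0 z" if "y \<in> D" for y
      using linear_0[OF linear_A[OF that]] linear_0[OF gh_linear(2)[OF that]] linear_0[OF gh_linear(3)[OF that]]
        linear_0[OF gh_linear(1)[OF that]] by (simp add: gh_fibre_def)
    ultimately have "((\<lambda>y. gh_fibre y (1 + A y 0) (l + A y z) 0 z) has_derivative (\<lambda>X. - (1 / 2) *
        (i x * (H x (hess x X) z + du x (\<Gamma> x X z)) + - (i x * du x X * i x) * du x z))) (at x)"
      by (rule has_derivative_cong_on[OF open_D x, rotated]) simp
    from fun_cong[OF diff_eq[OF this], of w] show ?thesis by (simp add: algebra_simps)
  qed
  have A_lin: "A x (a + b) = A x a + A x b" "A x (a - b) = A x a - A x b" for a b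
    using linear_add[OF linear_A[OF x]] linear_diff[OF linear_A[OF x]] by auto
  let ?R = "riemann gm (x, t) (0, 1) (w, k) (z, l)"
  have R2: "snd ?R + A x (fst ?R) = - diff (\<lambda>y. gh_fibre y (1 + A y 0) (l + A y z) 0 z) x w + dA x w Y
      + gh_fibre x 1 T 0 C - gh_fibre x q (gh_fibre x 1 s 0 z) w Y"
    by (simp add: riemann_def d ch A0 z0 G0 A_lin q_def[symmetric] s_def[symmetric] C_def[symmetric] T_def[symmetric] Y_def[symmetric])
  have ricH: "ricci H x w z = trace_op (diff (\<lambda>y. \<Gamma> y w z) x) - trace_op (\<lambda>e. diff (\<lambda>y. \<Gamma> y e z) x w)
      + trace_op (\<lambda>e. \<Gamma> x e (\<Gamma> x w z)) - trace_op (\<lambda>e. \<Gamma> x w (\<Gamma> x e z))"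
    by (simp add: ricci_def riemann_def trace_op_def inner_add_left inner_diff_left sum.distrib sum_subtractf)
  have c: "trace_op (\<lambda>e. J x (\<Gamma> x e w)) = trace_op (\<lambda>e. \<Gamma> x w (J x e))"
    using trace_op_commute[OF J_linear[OF x] christoffel_linear(1)[OF x, of w]] christoffel_sym[OF x, of w] by simp
  have dAF: "dA x v y = dA x y v + F x v y" for v y by (simp add: ext_deriv_def)
  have FJ: "F x (J x v) y = du x v * du x y - du x (G x) * H x v y" for v y
    by (simp add: J_works[OF x, symmetric] J_J[OF x] du_G[OF x])
  \<comment> \<open>Exchanging the direction and the argument in a derivative of \<open>A\<close>
    costs a value of dA, which \<open>J_J\<close> and \<open>F_G\<close> evaluate. With all
    derivatives of \<open>A\<close> in one order they cancel in the final sum.\<close>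
  have r: "dA x (J x w) z = dA x z (J x w) + (du x w * du x z - du x (G x) * H x w z)"
    "dA x (J x z) w = dA x w (J x z) + (du x w * du x z - du x (G x) * H x w z)"
    "dA x (G x) w = dA x w (G x)" "dA x (G x) z = dA x z (G x)"
    using dAF[where v = "J x w" and y = z] dAF[where v = "J x z" and y = w]
      dAF[where v = "G x" and y = w] dAF[where v = "G x" and y = z]
    unfolding FJ F_G(1)[OF x] metric_sym[OF x, of z w] by (simp_all add: mult.commute[of "du x z"])
  have h: "\<Gamma> x (G x) w = \<Gamma> x w (G x)" by (rule christoffel_sym[OF x])
  have dY: "dA x w Y = (i x * i x * dA x w (J x z) + i x * i x * i x * s * dA x w (G x)) / 2"
    "dA x Y w = (i x * i x * dA x (J x z) w + i x * i x * i x * s * dA x (G x) w) / 2"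
    "du x Y = i x * i x * i x * s * du x (G x) / 2"
    by (simp_all add: Y gh_linear_simps[OF x] du_J[OF x])
  have "ricci gm (x, t) (w, k) (z, l) =
    trace_op (gh_base' x q s w z) - trace_op (\<lambda>e. gh_base' x 0 s e z w) + trace_op (\<lambda>e. gh_base x 0 T e C)
     - trace_op (\<lambda>e. gh_base x q (gh_fibre x 0 s e z) w (gh_base x 0 s e z))
     + (- diff (\<lambda>y. gh_fibre y (1 + A y 0) (l + A y z) 0 z) x w + dA x w Y
      + gh_fibre x 1 T 0 C - gh_fibre x q (gh_fibre x 1 s 0 z) w Y)"
    by (simp only: ricci_gm_trace[OF x] R1 R2 trace_op_add trace_op_sub)
  also have "\<dots> = ricci H x w z"
    unfolding ricH trace_base_derivative[OF x lap] trace_base_derivative_slot[OF x] trace_base_slot[OF x]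
      trace_base_base[OF x] T' f1 C_def trace_christoffel_base[OF x] du_base[OF x] c r h
      gh_fibre_def[of x q _ w Y] dY j_def[symmetric]
    by (simp add: field_simps)
  finally show ?thesis .
qed

end

section \<open>Lie derivatives of the base metric\<close>

context chart_metric begin

lemma form_derivative:
  assumes x: "x \<in> D" and "(s has_derivative s') (at x)" "(r has_derivative r') (at x)"
  shows "((\<lambda>y. H y (s y) (r y)) has_derivative
    (\<lambda>v. H x (s' v + \<Gamma> x v (s x)) (r x) + H x (s x) (r' v + \<Gamma> x v (r x)))) (at x)"
  by (rule has_derivative_eq_rhs[OF metric_derivative[OF assms]])
    (simp add: fun_eq_iff metric_compatible[OF x] metric_simps[OF x])

text \<open>The connection is metric and free of torsion, so the derivative of the metric along
  \<open>X\<close> is absorbed when the derivatives of \<open>X\<close> become covariant.\<close>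

lemma lie_deriv_nabla:
  assumes x: "x \<in> D"
  shows "lie_deriv X H x v w = H x (diff X x v + \<Gamma> x v (X x)) w + H x v (diff X x w + \<Gamma> x w (X x))"
  using christoffel_sym[OF x, of "X x"]
  by (simp add: lie_deriv_def metric_compatible[OF x] metric_simps[OF x])

lemma lie_deriv_sym: "x \<in> D \<Longrightarrow> lie_deriv X H x v w = lie_deriv X H x w v"
  using metric_sym[of x v] metric_sym[of x w] by (simp add: lie_deriv_nabla)

lemma lie_deriv_scale:
  assumes x: "x \<in> D" and f: "f differentiable (at x)" and X: "X differentiable (at x)"
  shows "lie_deriv (\<lambda>x. f x *\<^sub>R X x) H x v w =
    f x * lie_deriv X H x v w + diff f x v * H x (X x) w + diff f x w * H x (X x) v"
proof -
  have "diff (\<lambda>x. f x *\<^sub>R X x) x = (\<lambda>v. f x *\<^sub>R diff X x v + diff f x v *\<^sub>R X x)"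
    by (rule diff_eq[OF has_derivative_scaleR[OF diff_works[OF f] diff_works[OF X]]])
  then show ?thesis
    by (simp add: lie_deriv_nabla[OF x] metric_simps[OF x] linear_scale[OF christoffel_linear(1)[OF x]]
        metric_sym[OF x, of v] algebra_simps)
qed

lemma lie_deriv_combination:
  assumes x: "x \<in> D" and X: "X differentiable (at x)" and Y: "Y differentiable (at x)"
  shows "lie_deriv (\<lambda>x. X x - a *\<^sub>R Y x) H x v w = lie_deriv X H x v w - a * lie_deriv Y H x v w"
proof -
  have "diff (\<lambda>x. X x - a *\<^sub>R Y x) x = (\<lambda>v. diff X x v - a *\<^sub>R diff Y x v)"
    by (rule diff_eq[OF has_derivative_diff[OF diff_works[OF X] has_derivative_scaleR_right[OF diff_works[OF Y]]]])
  then show ?thesis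
    by (simp add: lie_deriv_nabla[OF x] metric_simps[OF x] linear_scale[OF christoffel_linear(1)[OF x]]
        linear_diff[OF christoffel_linear(1)[OF x]] algebra_simps)
qed

lemma lie_deriv_grad:
  assumes f: "smooth_on D f" and x: "x \<in> D"
  shows "lie_deriv (grad H f) H x v w = 2 * cov_deriv H (diff f) x v w"
  using hessian_sym[OF f x, of v w] metric_sym[OF x, of v]
  by (simp add: lie_deriv_nabla[OF x] grad_derivative[OF f x])

end

section \<open>The soliton equation as a polynomial in the fibre coordinate\<close>

context chart_monopole begin

text \<open>The terms are, in this order: the Lie derivative of u h along t S, the change of the
  fibre length, the curvature dA contracted with S, the derivative of the factor t in front of S,
  and the derivative of the vertical component.\<close>

lemma lie_gm:
  assumes x: "x \<in> D" and S: "S differentiable (at x)" and f: "f differentiable (at (x, t))"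
    and E: "\<forall>y\<in>D. \<forall>t. E (y, t) = (t *\<^sub>R S y, f (y, t) - t * A y (S y))"
  shows "lie_deriv E gm (x, t) (v, r) (w, s) =
    t * (du x (S x) * H x v w + u x * lie_deriv S H x v w)
    - t * (i x * i x) * du x (S x) * ((r + A x v) * (s + A x w))
    + t * i x * ((s + A x w) * F x (S x) v + (r + A x v) * F x (S x) w)
    + u x * (r * H x (S x) w + s * H x (S x) v)
    + i x * ((s + A x w) * diff f (x, t) (v, r) + (r + A x v) * diff f (x, t) (w, s))"
proof -
  have AS: "((\<lambda>y. A y (S y)) has_derivative (\<lambda>X. dA x X (S x) + A x (diff S x X))) (at x)"
    using has_derivative_form[OF open_D x linear_A smooth_on_differentiable[OF smooth_A x] diff_works[OF S]] .
  have "((\<lambda>p. (snd p *\<^sub>R S (fst p), f p - snd p * A (fst p) (S (fst p)))) has_derivative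
    (\<lambda>X. (snd (x, t) *\<^sub>R diff S x (fst X) + snd X *\<^sub>R S (fst (x, t)), diff f (x, t) X -
      (snd (x, t) * (dA x (fst X) (S x) + A x (diff S x (fst X))) + snd X * A (fst (x, t)) (S (fst (x, t))))))) (at (x, t))"
    by (intro has_derivative_Pair has_derivative_diff has_derivative_mult has_derivative_scaleR has_derivative_snd
        has_derivative_ident has_derivative_compose_fst AS diff_works f S)
  then have "(E has_derivative
    (\<lambda>X. (snd (x, t) *\<^sub>R diff S x (fst X) + snd X *\<^sub>R S (fst (x, t)), diff f (x, t) X -
      (snd (x, t) * (dA x (fst X) (S x) + A x (diff S x (fst X))) + snd X * A (fst (x, t)) (S (fst (x, t))))))) (at (x, t))"
    by (rule has_derivative_cong_on[OF open_Times[OF open_D open_UNIV], rotated -1]) (use x E in auto)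
  note dE = diff_eq[OF this]
  note E = E[rule_format]
  have F: "F x (S x) v = dA x (S x) v - dA x v (S x)" "F x (S x) w = dA x (S x) w - dA x w (S x)"
    by (simp_all add: ext_deriv_def)
  have D: "dA x (t *\<^sub>R S x) v = t * dA x (S x) v" "dA x (t *\<^sub>R S x) w = t * dA x (S x) w"
    "du x (t *\<^sub>R S x) = t * du x (S x)" by (simp_all add: gh_linear_simps[OF x])
  have Al: "A x (p + q) = A x p + A x q" "A x (c *\<^sub>R p) = c * A x p" for p q c
    using linear_add[OF linear_A[OF x]] linear_scale[OF linear_A[OF x]] by auto
  have g: "\<Gamma> x (t *\<^sub>R S x) y = t *\<^sub>R \<Gamma> x y (S x)" for y
    using christoffel_sym[OF x] by (simp add: gh_linear_simps[OF x])
  define j where "j = i x"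
  have L: "lie_deriv E gm (x, t) (v, r) (w, s) = diff (\<lambda>y. gm y (v, r) (w, s)) (x, t) (E (x, t))
      + gm (x, t) (diff E (x, t) (v, r)) (w, s) + gm (x, t) (v, r) (diff E (x, t) (w, s))"
    by (rule lie_deriv_def)
  show ?thesis
    unfolding L dE E[OF x] gm_derivative[OF x] D g F lie_deriv_nabla[OF x] j_def[symmetric]
    by (simp add: gh_form_def metric_simps[OF x] Al metric_sym[OF x, of v "S x"] metric_sym[OF x, of "S x" w] j_def[symmetric] algebra_simps)
qed

lemma soliton_tensor_gm:
  assumes x: "x \<in> D" and lap: "laplacian H u x = 0"
    and S: "S differentiable (at x)" and f: "f differentiable (at (x, t))"
    and E: "\<forall>y\<in>D. \<forall>t. E (y, t) = (t *\<^sub>R S y, f (y, t) - t * A y (S y))"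
  shows "soliton_tensor gm E a (x, t) (v, r) (w, s) =
    ricci H x v w + a * (u x * H x v w + i x * ((r + A x v) * (s + A x w))) + (
    t * (du x (S x) * H x v w + u x * lie_deriv S H x v w)
    - t * (i x * i x) * du x (S x) * ((r + A x v) * (s + A x w))
    + t * i x * ((s + A x w) * F x (S x) v + (r + A x v) * F x (S x) w)
    + u x * (r * H x (S x) w + s * H x (S x) v)
    + i x * ((s + A x w) * diff f (x, t) (v, r) + (r + A x v) * diff f (x, t) (w, s))) / 2"
  unfolding soliton_tensor_def lie_gm[OF x S f E] ricci_gm[OF x lap]
  by (simp add: gh_form_def)

text \<open>Serves for the fibre direction, whose base part is 0.\<close>

lemma ricci_zero:
  assumes x: "x \<in> D"
  shows "ricci H x 0 w = 0"
proof -
  have z: "\<Gamma> y 0 v = 0" if "y \<in> D" for y v using linear_0[OF christoffel_linear(2)[OF that]] .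
  have "diff (\<lambda>y. \<Gamma> y 0 w) x = diff (\<lambda>y. 0) x" by (rule diff_cong_on[OF open_D x z])
  also have "\<dots> = (\<lambda>v. 0)" by (rule diff_eq[OF has_derivative_const])
  finally have "riemann H x e 0 w = 0" for e
    using linear_0[OF smooth_on_linear_diff[OF smooth_christoffel x]]
      linear_0[OF christoffel_linear(1)[OF x]] by (simp add: riemann_def z[OF x])
  then show ?thesis by (simp add: ricci_def)
qed

lemma soliton_tensor_fibre:
  assumes x: "x \<in> D" and lap: "laplacian H u x = 0"
    and S: "S differentiable (at x)" and f: "f differentiable (at (x, t))"
    and E: "\<forall>y\<in>D. \<forall>t. E (y, t) = (t *\<^sub>R S y, f (y, t) - t * A y (S y))"
  shows "soliton_tensor gm E a (x, t) (0, 1) (w, s) = a * i x * (s + A x w) + (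
    - t * (i x * i x) * du x (S x) * (s + A x w) + t * i x * F x (S x) w + u x * H x (S x) w
    + i x * ((s + A x w) * diff f (x, t) (0, 1) + diff f (x, t) (w, s))) / 2"
proof -
  have z: "A x 0 = 0" "F x (S x) 0 = 0" "\<Gamma> x 0 (S x) = 0" "diff S x 0 = 0"
    using linear_0[OF linear_A[OF x]] linear_0[OF F_linear(1)[OF x]] linear_0[OF christoffel_linear(2)[OF x]]
      linear_0[OF linear_diff_at[OF S]] by auto
  show ?thesis
    unfolding soliton_tensor_gm[OF x lap S f E] ricci_zero[OF x] lie_deriv_nabla[OF x] z metric_simps[OF x]
    by simp
qed

lemma quadratic_zero:
  fixes a b c :: real
  assumes "\<And>t. a + b * t + c * t\<^sup>2 = 0"
  shows "a = 0" "b = 0" "c = 0"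
  using assms[of 0] assms[of 1] assms[of "-1"] by simp_all

lemma has_derivative_potential:
  fixes f0 \<beta> :: "real^3 \<Rightarrow> real" and a t :: real
  assumes f0: "(f0 has_derivative f0') (at x)" and \<beta>: "(\<beta> has_derivative \<beta>') (at x)"
  shows "((\<lambda>p. f0 (fst p) - a * snd p + 1/4 * \<beta> (fst p) * (snd p)\<^sup>2) has_derivative
    (\<lambda>X. f0' (fst X) + (- a + \<beta> x * t / 2) * snd X + 1/4 * t\<^sup>2 * \<beta>' (fst X))) (at (x, t))"
  apply (rule has_derivative_eq_rhs)
   apply (rule has_derivative_add has_derivative_diff has_derivative_mult has_derivative_power has_derivative_const
      has_derivative_compose_fst[OF f0] has_derivative_compose_fst[OF \<beta>] has_derivative_snd[OF has_derivative_ident])+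
  apply (simp add: fun_eq_iff power2_eq_square algebra_simps)
  done

text \<open>The algebra of \<open>soliton_along_iff\<close> with tensors replaced by numbers and
  \<open>j\<close> for 1/u. The constants -a and b/2 in the derivative of the potential are exactly
  those for which all terms in \<open>s\<close> cancel.\<close>

lemma fibre_identity:
  fixes U :: real
  assumes "U * j = 1"
  shows "a * j * (s + c) + (- t * (j * j) * (b * U) * (s + c) + t * j * k + U * l
      + j * ((s + c) * (- a + b * t / 2) + (m + (- a + b * t / 2) * s))) / 2
    = j / 2 * ((m + a * c + U * U * l) + (k - b / 2 * c) * t)"
proof -
  have U: "U \<noteq> 0" using assms by auto
  then have j: "j = 1 / U" using assms by (simp add: nonzero_eq_divide_eq mult.commute)
  show ?thesis unfolding j using U by (simp add: field_simps)
qed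

text \<open>After the fibre equations are substituted, every term with the fibre coordinate
  \<open>t\<close> or the fibre components \<open>r\<close>, \<open>s\<close> cancels. This is why
  what is left of the soliton equation lives on the base.\<close>

lemma base_identity:
  fixes U :: real
  assumes "U * j = 1"
  shows "R + a * (U * h + j * ((r + c) * (s + d))) + (t * (b * U * h + U * (- b * h))
      - t * (j * j) * (b * U) * ((r + c) * (s + d)) + t * j * ((s + d) * (b / 2 * c) + (r + c) * (b / 2 * d))
      + U * (r * l + s * m) + j * ((s + d) * (- (a * c + U * U * m) + (- a + b * t / 2) * r)
        + (r + c) * (- (a * d + U * U * l) + (- a + b * t / 2) * s))) / 2
    = R + a * U * h - U / 2 * (c * l + d * m)"
proof -
  have U: "U \<noteq> 0" using assms by auto
  then have j: "j = 1 / U" using assms by (simp add: nonzero_eq_divide_eq mult.commute)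
  show ?thesis unfolding j using U by (simp add: field_simps)
qed

text \<open>For the prescribed potential the fibre component is affine in \<open>t\<close>. The
  coefficient of \<open>t\<close> gives the equation for dA contracted with S, the constant term the
  one for df0.\<close>

lemma soliton_along_iff:
  assumes x: "x \<in> D" and lap: "laplacian H u x = 0"
    and S: "S differentiable (at x)" and f0: "f0 differentiable (at x)"
    and E: "\<forall>y\<in>D. \<forall>t. E (y, t) = (t *\<^sub>R S y, f0 y - a * t + 1/4 * b * t\<^sup>2 - t * A y (S y))"
    and b: "du x (S x) = b * u x"
  shows "(\<forall>t V. soliton_tensor gm E a (x, t) (0, 1) V = 0) \<longleftrightarrow>
    (\<forall>w. F x (S x) w = b / 2 * A x w \<and> diff f0 x w + a * A x w + u x * u x * H x (S x) w = 0)"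
proof -
  let ?f = "\<lambda>p. f0 (fst p) - a * snd p + 1/4 * b * (snd p)\<^sup>2"
  have d: "(?f has_derivative (\<lambda>X. diff f0 x (fst X) + (- a + b * t / 2) * snd X)) (at (x, t))" for t
    using has_derivative_potential[OF diff_works[OF f0] has_derivative_const[of b], of a t] by simp
  have fd: "?f differentiable (at (x, t))" for t using d differentiable_def by blast
  have ui: "u x * i x = 1" using u_nonzero[OF x] by simp
  define j where "j = i x"
  have E': "\<forall>y\<in>D. \<forall>t. E (y, t) = (t *\<^sub>R S y, ?f (y, t) - t * A y (S y))" using E by simp
  have eq: "soliton_tensor gm E a (x, t) (0, 1) (w, s) = j / 2 * ((diff f0 x w + a * A x w + u x * u x * H x (S x) w)
      + (F x (S x) w - b / 2 * A x w) * t)" for t w s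
  proof -
    have e: "soliton_tensor gm E a (x, t) (0, 1) (w, s) = a * j * (s + A x w) + (
    - t * (j * j) * (b * u x) * (s + A x w) + t * j * F x (S x) w + u x * H x (S x) w
    + j * ((s + A x w) * (- a + b * t / 2) + (diff f0 x w + (- a + b * t / 2) * s))) / 2"
      unfolding soliton_tensor_fibre[OF x lap S fd E'] diff_eq[OF d] b j_def[symmetric] fst_conv snd_conv
        linear_0[OF linear_diff_at[OF f0]] by simp
    have "u x * j = 1" using ui by (simp add: j_def)
    then show ?thesis unfolding e by (rule fibre_identity)
  qed
  have j: "j \<noteq> 0" using ui by (auto simp: j_def)
  have "(\<forall>t V. soliton_tensor gm E a (x, t) (0, 1) V = 0) \<longleftrightarrow>
    (\<forall>w t. (diff f0 x w + a * A x w + u x * u x * H x (S x) w) + (F x (S x) w - b / 2 * A x w) * t = 0)"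
    using j by (simp add: split_paired_all eq) blast
  also have "\<dots> \<longleftrightarrow> (\<forall>w. F x (S x) w = b / 2 * A x w \<and> diff f0 x w + a * A x w + u x * u x * H x (S x) w = 0)"
  proof (intro iff_allI iffI)
    fix w assume *: "\<forall>t. (diff f0 x w + a * A x w + u x * u x * H x (S x) w) + (F x (S x) w - b / 2 * A x w) * t = 0"
    show "F x (S x) w = b / 2 * A x w \<and> diff f0 x w + a * A x w + u x * u x * H x (S x) w = 0"
      using *[rule_format, of 0] *[rule_format, of 1] by simp
  qed simp
  finally show ?thesis .
qed

lemma soliton_tensor_base:
  assumes x: "x \<in> D" and lap: "laplacian H u x = 0"
    and S: "S differentiable (at x)" and f0: "f0 differentiable (at x)"
    and E: "\<forall>y\<in>D. \<forall>t. E (y, t) = (t *\<^sub>R S y, f0 y - a * t + 1/4 * b * t\<^sup>2 - t * A y (S y))"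
    and b: "du x (S x) = b * u x" and lie: "\<And>v w. lie_deriv S H x v w = - b * H x v w"
    and along: "\<And>w. F x (S x) w = b / 2 * A x w"
      "\<And>w. diff f0 x w + a * A x w + u x * u x * H x (S x) w = 0"
  shows "soliton_tensor gm E a (x, t) (v, r) (w, s) =
    ricci H x v w + a * u x * H x v w - u x / 2 * (A x v * H x (S x) w + A x w * H x (S x) v)"
proof -
  let ?f = "\<lambda>p. f0 (fst p) - a * snd p + 1/4 * b * (snd p)\<^sup>2"
  have d: "(?f has_derivative (\<lambda>X. diff f0 x (fst X) + (- a + b * t / 2) * snd X)) (at (x, t))" for t
    using has_derivative_potential[OF diff_works[OF f0] has_derivative_const[of b], of a t] by simp
  have fd: "?f differentiable (at (x, t))" for t using d differentiable_def by blast
  define j where "j = i x"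
  have ui: "u x * j = 1" using u_nonzero[OF x] by (simp add: j_def)
  have E': "\<forall>y\<in>D. \<forall>t. E (y, t) = (t *\<^sub>R S y, ?f (y, t) - t * A y (S y))" using E by simp
  have e: "diff f0 x w = - (a * A x w + u x * u x * H x (S x) w)" for w using along(2)[of w] by simp
  show ?thesis
    unfolding soliton_tensor_gm[OF x lap S fd E'] lie along(1) b j_def[symmetric] diff_eq[OF d] fst_conv snd_conv e
    by (rule base_identity[OF ui])
qed

text \<open>The soliton equation is polynomial in the fibre coordinate; its coefficients give
  the equations on the base.\<close>

lemma soliton_converse:
  assumes lap: "\<And>x. x \<in> D \<Longrightarrow> laplacian H u x = 0"
    and S: "smooth_on D S" and f: "\<And>x t. x \<in> D \<Longrightarrow> f differentiable (at (x, t))"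
    and E: "\<forall>y\<in>D. \<forall>t. E (y, t) = (t *\<^sub>R S y, f (y, t) - t * A y (S y))"
    and soliton: "\<And>x t V W. x \<in> D \<Longrightarrow> soliton_tensor gm E a (x, t) V W = 0"
    and x: "x \<in> D"
  defines "\<beta> \<equiv> \<lambda>x. i x * du x (S x)"
  shows "f (x, t) = f (x, 0) - a * t + 1/4 * \<beta> x * t\<^sup>2" "diff \<beta> x w = 0" "F x (S x) w = \<beta> x / 2 * A x w"
    "diff (\<lambda>x. f (x, 0)) x w + a * A x w + u x * u x * H x (S x) w = 0"
    "du x (S x) * H x v w + u x * lie_deriv S H x v w = 0"
    "ricci H x v w + a * u x * H x v w - u x / 2 * (A x v * H x (S x) w + A x w * H x (S x) v) = 0"
proof -
  have du_S: "du x (S x) = u x * \<beta> x" if "x \<in> D" for x using u_nonzero[OF that] by (simp add: \<beta>_def)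
  \<comment> \<open>With both arguments along the fibre, the only derivative of \<open>f\<close> in
    the equation is the one along the fibre. Integrating it makes \<open>f\<close> quadratic in
    \<open>t\<close>.\<close>
  have ft: "diff f (x, t) (0, 1) = - a + \<beta> x * t / 2" if "x \<in> D" for x t
  proof -
    have "soliton_tensor gm E a (x, t) (0, 1) (0, 1) = 0" by (rule soliton[OF that])
    moreover define j where "j = i x"
    ultimately have "a * j + (- t * (j * j) * (u x * \<beta> x) + j * (diff f (x, t) (0, 1) + diff f (x, t) (0, 1))) / 2 = 0"
      unfolding soliton_tensor_fibre[OF that lap[OF that] smooth_on_differentiable[OF S that] f[OF that] E]
      by (simp add: linear_0[OF linear_A[OF that]] linear_0[OF F_linear(1)[OF that]] metric_simps[OF that] du_S[OF that])
    moreover have "u x * j = 1" using u_nonzero[OF that] by (simp add: j_def)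
    ultimately show ?thesis by algebra
  qed
  have f_eq: "f (x, t) = f (x, 0) - a * t + 1/4 * \<beta> x * t\<^sup>2" if "x \<in> D" for x t
  proof -
    let ?g = "\<lambda>t. f (x, t) + a * t - 1/4 * \<beta> x * t\<^sup>2"
    have "(?g has_real_derivative 0) (at t)" for t
    proof -
      have p: "((\<lambda>t. (x, t)) has_derivative (\<lambda>h. (0, h))) (at t)" by (auto intro!: derivative_eq_intros)
      have "((\<lambda>t. f (x, t)) has_derivative (\<lambda>h. diff f (x, t) (0, h))) (at t)"
        using diff_chain_at[OF p diff_works[OF f[OF that]]] by (simp add: o_def)
      moreover have "diff f (x, t) (0, h) = (- a + \<beta> x * t / 2) * h" for h
        using linear_scale[OF linear_diff_at[OF f[OF that, of t]], of h "(0, 1)"] by (simp add: ft[OF that])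
      ultimately have "((\<lambda>t. f (x, t)) has_real_derivative (- a + \<beta> x * t / 2)) (at t)"
        by (simp add: has_field_derivative_def)
      then show ?thesis by (auto intro!: derivative_eq_intros)
    qed
    then have "?g t = ?g 0" by (intro DERIV_isconst_all) auto
    then show ?thesis by simp
  qed
  show "f (x, t) = f (x, 0) - a * t + 1/4 * \<beta> x * t\<^sup>2" by (rule f_eq[OF x])
  have sm\<beta>: "smooth_on D \<beta>"
    unfolding \<beta>_def
    by (intro smooth_on_mult smooth_on_inverse smooth_u open_D u_nonzero
        smooth_on_form[OF open_D smooth_on_linear_diff[OF smooth_u] smooth_on_diff[OF smooth_u] S])
  have f0: "((\<lambda>x. f (x, 0)) has_derivative diff (\<lambda>x. f (x, 0)) x) (at x)" 
  proof -
    have "((\<lambda>y. (y, 0::real)) has_derivative (\<lambda>h. (h, 0))) (at x)" by (auto intro!: derivative_eq_intros)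
    from diff_chain_at[OF this diff_works[OF f[OF x]]]
    show ?thesis by (intro diff_works) (auto simp: differentiable_def o_def)
  qed
  \<comment> \<open>The factor \<open>\<beta>\<close> is not yet known to be constant, so it is
    differentiated too; its derivative will be the coefficient of \<open>t\<^sup>2\<close> in the
    next equation.\<close>
  have df: "diff f (x, t) (w, s) = diff (\<lambda>x. f (x, 0)) x w + (- a + \<beta> x * t / 2) * s + 1/4 * t\<^sup>2 * diff \<beta> x w" for t w s
  proof -
    have "(f has_derivative (\<lambda>X. diff (\<lambda>x. f (x, 0)) x (fst X) + (- a + \<beta> x * t / 2) * snd X + 1/4 * t\<^sup>2 * diff \<beta> x (fst X))) (at (x, t))"
      by (rule has_derivative_cong_on[OF open_Times[OF open_D open_UNIV] _ _
            has_derivative_potential[OF f0 smooth_on_has_derivative[OF sm\<beta> x], of a t]])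
        (use x f_eq[symmetric] in auto)
    from fun_cong[OF diff_eq[OF this], of "(w, s)"] show ?thesis by simp
  qed
  note st = soliton_tensor_gm[OF x lap[OF x] smooth_on_differentiable[OF S x] f[OF x] E]
  note sf = soliton_tensor_fibre[OF x lap[OF x] smooth_on_differentiable[OF S x] f[OF x] E]
  define j where "j = i x"
  have ui: "u x * j = 1" using u_nonzero[OF x] by (simp add: j_def)
  \<comment> \<open>On the horizontal vector \<open>(w, - A x w)\<close> the form
    \<open>dt + A\<close> is 0, and the fibre component is a quadratic polynomial in
    \<open>t\<close>, whose three coefficients are separate equations on the base.\<close>
  have 1: "(diff (\<lambda>x. f (x, 0)) x w + a * A x w + u x * u x * H x (S x) w) + (F x (S x) w - \<beta> x / 2 * A x w) * t
      + (1/4 * diff \<beta> x w) * t\<^sup>2 = 0" for t w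
  proof -
    have "soliton_tensor gm E a (x, t) (0, 1) (w, - A x w) = 0" by (rule soliton[OF x])
    then have "(t * j * F x (S x) w + u x * H x (S x) w + j * (diff (\<lambda>x. f (x, 0)) x w
        + (- a + \<beta> x * t / 2) * (- A x w) + 1/4 * t\<^sup>2 * diff \<beta> x w)) / 2 = 0"
      unfolding sf df j_def[symmetric] by simp
    then have "u x * (t * j * F x (S x) w + u x * H x (S x) w + j * (diff (\<lambda>x. f (x, 0)) x w
        + (- a + \<beta> x * t / 2) * (- A x w) + 1/4 * t\<^sup>2 * diff \<beta> x w)) = 0" by simp
    then have "(u x * j) * (t * F x (S x) w) + u x * u x * H x (S x) w + (u x * j) * (diff (\<lambda>x. f (x, 0)) x w
        + (- a + \<beta> x * t / 2) * (- A x w) + 1/4 * t\<^sup>2 * diff \<beta> x w) = 0"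
      by (simp only: algebra_simps)
    then show ?thesis unfolding ui by (simp add: algebra_simps)
  qed
  show "diff \<beta> x w = 0" "F x (S x) w = \<beta> x / 2 * A x w"
    "diff (\<lambda>x. f (x, 0)) x w + a * A x w + u x * u x * H x (S x) w = 0"
    using quadratic_zero[OF 1, of w] by simp_all
  \<comment> \<open>With two horizontal arguments the derivatives of \<open>f\<close> are multiplied
    by values of \<open>dt + A\<close> and drop out, so the tensor is affine in \<open>t\<close>;
    the zero term only fits the shape of \<open>quadratic_zero\<close>.\<close>
  have 2: "(ricci H x v w + a * u x * H x v w - u x / 2 * (A x v * H x (S x) w + A x w * H x (S x) v))
      + ((du x (S x) * H x v w + u x * lie_deriv S H x v w) / 2) * t + 0 * t\<^sup>2 = 0" for t
  proof -
    have "soliton_tensor gm E a (x, t) (v, - A x v) (w, - A x w) = 0" by (rule soliton[OF x])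
    then show ?thesis unfolding st by (simp add: algebra_simps add_divide_distrib diff_divide_distrib)
  qed
  show "du x (S x) * H x v w + u x * lie_deriv S H x v w = 0"
    "ricci H x v w + a * u x * H x v w - u x / 2 * (A x v * H x (S x) w + A x w * H x (S x) v) = 0"
    using quadratic_zero[OF 2] by simp_all
qed


section \<open>The equations for w and for the field S on the base\<close>

context includes cross3_syntax begin

text \<open>Differentiating the factor \<open>i y * i y\<close> produces the products of du with dw
  - aB. The last term of the third equation for \<open>w\<close> is made to cancel them, so that
  only a multiple of the metric remains.\<close>

lemma lie_S_identity:
  assumes x: "x \<in> D" and w: "smooth_on D w" and B: "\<And>x. x \<in> D \<Longrightarrow> linear (B x)" "\<And>v. smooth_on D (\<lambda>x. B x v)"
    and S: "\<And>y. y \<in> D \<Longrightarrow> S y = (i y * i y) *\<^sub>R (grad H w y - a *\<^sub>R sharp_field H B y)"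
  defines "\<beta> \<equiv> \<lambda>v. diff w x v - a * B x v"
  shows "H x (S x) v = i x * i x * \<beta> v"
    "lie_deriv S H x y z = i x * i x * (2 * cov_deriv H (diff w) x y z - a * lie_deriv (sharp_field H B) H x y z)
      - 2 * (i x * i x * i x) * (du x y * \<beta> z + du x z * \<beta> y)"
    "smooth_on D S"
proof -
  have b: "H x (grad H w x - a *\<^sub>R sharp_field H B x) v = \<beta> v" for v
    by (simp add: metric_simps[OF x] grad_works[OF x smooth_on_differentiable[OF w x]] sharp_field_works[where \<alpha> = B, OF x B(1)[OF x]] \<beta>_def)
  then show "H x (S x) v = i x * i x * \<beta> v" by (simp add: S[OF x] metric_simps[OF x])
  have smB: "smooth_on D (sharp_field H B)" by (rule smooth_sharp_field[OF B])
  have smX: "smooth_on D (\<lambda>y. grad H w y - a *\<^sub>R sharp_field H B y)"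
    by (intro smooth_on_diff_op smooth_on_scaleR smooth_on_const smooth_grad w smB open_D)
  have smi: "smooth_on D (\<lambda>y. i y * i y)"
    by (intro smooth_on_mult smooth_on_inverse smooth_u open_D u_nonzero)
  show "smooth_on D S"
    by (rule smooth_on_cong[OF open_D _ smooth_on_scaleR[OF open_D smi smX]]) (simp add: S)
  have di: "diff (\<lambda>y. i y * i y) x v = - 2 * (i x * i x * i x) * du x v" for v
    using fun_cong[OF diff_eq[OF has_derivative_mult[OF inverse_u_has_derivative[OF x] inverse_u_has_derivative[OF x]]], of v]
    by simp
  have dS: "diff S x = diff (\<lambda>y. (i y * i y) *\<^sub>R (grad H w y - a *\<^sub>R sharp_field H B y)) x"
    by (rule diff_cong_on[OF open_D x S])
  have "lie_deriv S H x y z = lie_deriv (\<lambda>y. (i y * i y) *\<^sub>R (grad H w y - a *\<^sub>R sharp_field H B y)) H x y z"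
    by (simp only: lie_deriv_def dS S[OF x])
  also have "\<dots> = i x * i x * (2 * cov_deriv H (diff w) x y z - a * lie_deriv (sharp_field H B) H x y z)
      - 2 * (i x * i x * i x) * (du x y * \<beta> z + du x z * \<beta> y)"
    unfolding lie_deriv_scale[OF x smooth_on_differentiable[OF smi x] smooth_on_differentiable[OF smX x]]
      lie_deriv_combination[OF x smooth_on_differentiable[OF smooth_grad[OF w] x]
        smooth_on_differentiable[OF smB x]] lie_deriv_grad[OF w x] b di
    by (simp add: algebra_simps)
  finally show "lie_deriv S H x y z = i x * i x * (2 * cov_deriv H (diff w) x y z - a * lie_deriv (sharp_field H B) H x y z)
      - 2 * (i x * i x * i x) * (du x y * \<beta> z + du x z * \<beta> y)" .
qed

text \<open>The second equation for \<open>w\<close> is the derivative of the first one, combined with the third.\<close>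

lemma second_equation:
  fixes a b :: real
  assumes x: "x \<in> D" and w: "smooth_on D w" and B: "\<And>x. x \<in> D \<Longrightarrow> linear (B x)" "\<And>v. smooth_on D (\<lambda>x. B x v)"
  defines "gw \<equiv> grad H w" and "Bs \<equiv> sharp_field H B" and "\<beta> \<equiv> \<lambda>v. diff w x v - a * B x v"
  assumes eq1: "\<And>x. x \<in> D \<Longrightarrow> du x (gw x) = b * u x ^ 3 + a * du x (Bs x)"
    and eq3: "\<And>y z. cov_deriv H (diff w) x y z = 1/2 * a * lie_deriv Bs H x y z - 1/2 * b * u x ^ 2 * H x y z
       + i x * (du x y * \<beta> z + \<beta> y * du x z)"
  shows "cov_deriv H du x (gw x) z = - i x * H x (G x) (G x) * \<beta> z + 5/2 * b * u x ^ 2 * du x z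
    - a * H x (lie_bracket G Bs x) z + 1/2 * a * lie_deriv Bs H x (G x) z"
proof -
  have smB: "smooth_on D Bs" unfolding Bs_def by (rule smooth_sharp_field[OF B])
  have smw: "smooth_on D gw" unfolding gw_def by (rule smooth_grad[OF w])
  have D: "((\<lambda>y. H y (G y) (X y)) has_derivative (\<lambda>v. H x (hess x v) (X x) + H x (G x) (diff X x v + \<Gamma> x v (X x)))) (at x)"
    if "smooth_on D X" for X
    by (rule has_derivative_eq_rhs[OF form_derivative[OF x smooth_on_has_derivative[OF smooth_G x] smooth_on_has_derivative[OF that x]]])
      (simp add: hess_def)
  have u3: "((\<lambda>y. b * u y ^ 3) has_derivative (\<lambda>v. 3 * b * u x ^ 2 * du x v)) (at x)"
    by (rule has_derivative_eq_rhs[OF has_derivative_mult_right[OF has_derivative_power[OF smooth_on_has_derivative[OF smooth_u x]]]])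
      (simp add: fun_eq_iff)
  have "((\<lambda>y. b * u y ^ 3 + a * H y (G y) (Bs y)) has_derivative (\<lambda>v. 3 * b * u x ^ 2 * du x v +
      a * (H x (hess x v) (Bs x) + H x (G x) (diff Bs x v + \<Gamma> x v (Bs x))))) (at x)"
    by (intro has_derivative_add u3 has_derivative_mult_right D smB)
  then have "((\<lambda>y. H y (G y) (gw y)) has_derivative (\<lambda>v. 3 * b * u x ^ 2 * du x v +
      a * (H x (hess x v) (Bs x) + H x (G x) (diff Bs x v + \<Gamma> x v (Bs x))))) (at x)"
    by (rule has_derivative_cong_on[OF open_D x, rotated]) (use eq1 in \<open>simp add: du_G\<close>)
  from has_derivative_unique[OF this D[OF smw]]
  have e: "3 * b * u x ^ 2 * du x z + a * (H x (hess x z) (Bs x) + H x (G x) (diff Bs x z + \<Gamma> x z (Bs x)))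
      = H x (hess x z) (gw x) + H x (G x) (diff gw x z + \<Gamma> x z (gw x))"
    by (rule fun_cong)
  have h: "H x (hess x z) (gw x) = cov_deriv H du x (gw x) z"
    using hess_sym[OF x, of z "gw x"] metric_sym[OF x, of z "hess x (gw x)"] hess_works[OF x, of "gw x" z] by simp
  have c: "H x (G x) (diff gw x z + \<Gamma> x z (gw x)) = cov_deriv H (diff w) x z (G x)"
    using grad_derivative[OF w x, of z "G x"] metric_sym[OF x, of "G x"] by (simp add: gw_def)
  have \<beta>: "\<beta> (G x) = b * u x ^ 3"
    using eq1[OF x] grad_works[OF x smooth_on_differentiable[OF w x], of "G x"] sharp_field_works[where \<alpha> = B, OF x B(1)[OF x], of "G x"]
    by (simp add: \<beta>_def gw_def Bs_def du_G[OF x] metric_sym[OF x, of "G x"])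
  \<comment> \<open>By absence of torsion, \<open>hess x (Bs x)\<close> is the covariant derivative
    of \<open>Bs\<close> along grad u minus the bracket of the two fields. This is where the last
    two terms of the second equation come from.\<close>
  have l: "a * (H x (hess x z) (Bs x) + H x (G x) (diff Bs x z + \<Gamma> x z (Bs x)))
      = a * lie_deriv Bs H x (G x) z - a * H x (lie_bracket G Bs x) z"
  proof -
    have "diff G x (Bs x) = hess x (Bs x) - \<Gamma> x (G x) (Bs x)"
      by (simp add: hess_def christoffel_sym[OF x, of "G x"])
    then have "H x (lie_bracket G Bs x) z = H x (diff Bs x (G x) + \<Gamma> x (G x) (Bs x)) z - H x (hess x z) (Bs x)"
      using hess_sym[OF x, of "Bs x" z] metric_sym[OF x, of "Bs x"] by (simp add: lie_bracket_def metric_simps[OF x])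
    then have e2: "H x (hess x z) (Bs x) = H x (diff Bs x (G x) + \<Gamma> x (G x) (Bs x)) z - H x (lie_bracket G Bs x) z" by simp
    show ?thesis unfolding lie_deriv_nabla[OF x] e2 by (simp add: algebra_simps)
  qed
  define j where "j = i x"
  have ui: "u x * j = 1" using u_nonzero[OF x] by (simp add: j_def)
  have "cov_deriv H (diff w) x z (G x) = 1/2 * a * lie_deriv Bs H x (G x) z - 1/2 * b * u x ^ 2 * du x z
       + j * (du x z * (b * u x ^ 3) + \<beta> z * H x (G x) (G x))"
    unfolding eq3 \<beta> j_def[symmetric] using lie_deriv_sym[OF x, of Bs z "G x"] metric_sym[OF x, of z "G x"] du_G[OF x]
    by simp
  also have "j * (du x z * (b * u x ^ 3) + \<beta> z * H x (G x) (G x)) = (u x * j) * (b * u x ^ 2 * du x z) + j * \<beta> z * H x (G x) (G x)"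
    by (simp add: power3_eq_cube power2_eq_square algebra_simps)
  finally have c': "cov_deriv H (diff w) x z (G x) = 1/2 * a * lie_deriv Bs H x (G x) z + 1/2 * b * u x ^ 2 * du x z
      + j * \<beta> z * H x (G x) (G x)"
    unfolding ui by (simp add: algebra_simps)
  show ?thesis using e unfolding l h c c' j_def[symmetric] by (simp add: algebra_simps)
qed

text \<open>The density times grad u is the Euclidean curl of \<open>A\<close>, so its coordinate
  divergence vanishes by symmetry of second derivatives; and that divergence is the density times
  the Laplacian. In the converse direction this is how \<open>u\<close> is seen to be
  harmonic.\<close>

lemma curl_divergence_zero:
  assumes x: "x \<in> D"
  shows "laplacian H u x = 0"
proof -
  note p = vol_density_pos[OF metric]
  define W where "W = (\<lambda>y. \<rho> y *\<^sub>R G y)"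
  have W: "W y \<bullet> (v \<times> w) = dA y v w - dA y w v" if "y \<in> D" for y v w
    using F_eq[OF that, of v w] by (simp add: W_def ext_deriv_def)
  have dW: "(W has_derivative (\<lambda>v. \<rho> x *\<^sub>R diff G x v + diff \<rho> x v *\<^sub>R G x)) (at x)"
    unfolding W_def by (rule has_derivative_scaleR[OF diff_works[OF vol_density_parallel(2)[OF x]] smooth_on_has_derivative[OF smooth_G x]])
  have comp: "diff W x e \<bullet> (v \<times> w) = diff (\<lambda>y. dA y v w) x e - diff (\<lambda>y. dA y w v) x e" for e v w
  proof -
    have "((\<lambda>y. W y \<bullet> (v \<times> w)) has_derivative (\<lambda>e. diff W x e \<bullet> (v \<times> w))) (at x)"
      using has_derivative_inner_left[OF dW] by (simp add: diff_eq[OF dW])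
    from has_derivative_cong_on[OF open_D x _ this, of "\<lambda>y. dA y v w - dA y w v"]
    have 1: "((\<lambda>y. dA y v w - dA y w v) has_derivative (\<lambda>e. diff W x e \<bullet> (v \<times> w))) (at x)" using W by simp
    have 2: "((\<lambda>y. dA y v w - dA y w v) has_derivative (\<lambda>e. diff (\<lambda>y. dA y v w) x e - diff (\<lambda>y. dA y w v) x e)) (at x)"
      by (intro has_derivative_diff smooth_on_has_derivative[OF smooth_on_diff[OF smooth_A] x])
    show ?thesis using fun_cong[OF has_derivative_unique[OF 1 2], of e] .
  qed
  have s: "diff (\<lambda>y. dA y v w) x e = diff (\<lambda>y. dA y e w) x v" for v w e
    by (rule diff_diff_commute[OF open_D smooth_A x])
  have "trace_op (diff W x) = 0"
    unfolding trace_op_def sum_Basis_real3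
    using comp[of "axis 1 1" "axis 2 1" "axis 3 1", unfolded cross_basis]
      comp[of "axis 2 1" "axis 3 1" "axis 1 1", unfolded cross_basis]
      comp[of "axis 3 1" "axis 1 1" "axis 2 1", unfolded cross_basis]
      s[of "axis 2 1" "axis 3 1" "axis 1 1"] s[of "axis 3 1" "axis 2 1" "axis 1 1"] s[of "axis 1 1" "axis 2 1" "axis 3 1"]
    by linarith
  moreover have "trace_op (diff W x) = \<rho> x * (trace_op (diff G x) + trace_op (\<Gamma> x (G x)))"
  proof -
    have l: "linear (diff \<rho> x)" by (rule linear_diff_at[OF vol_density_parallel(2)[OF x]])
    show ?thesis
      unfolding diff_eq[OF dW] trace_op_add trace_op_scale trace_op_rank1[OF l]
      unfolding vol_density_parallel(1)[OF x] by (simp add: algebra_simps)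
  qed
  moreover have "trace_op (diff G x) + trace_op (\<Gamma> x (G x)) = laplacian H u x"
  proof -
    have "\<Gamma> x (G x) = (\<lambda>v. \<Gamma> x v (G x))" by (rule ext) (rule christoffel_sym[OF x])
    then show ?thesis unfolding laplacian_trace[OF smooth_u x] trace_op_add by (rule arg_cong)
  qed
  ultimately show ?thesis using p[OF x] by simp
qed

text \<open>A field that scales \<open>u\<close> and the metric scales \<open>dA\<close>: this is the integrability condition for the
  function \<open>v\<close> of the theorem.\<close>

lemma contraction_ext_deriv:
  assumes x: "x \<in> D" and S: "smooth_on D S" and b: "\<And>x. x \<in> D \<Longrightarrow> du x (S x) = b * u x"
    and lie: "\<And>v w. lie_deriv S H x v w = - b * H x v w"
  shows "ext_deriv (\<lambda>y. F y (S y)) x v w = b / 2 * F x v w"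
proof -
  let ?L = "diff S x"
  have lin: "linear ?L" by (rule smooth_on_linear_diff[OF S x])
  have dF: "((\<lambda>y. F y (S y) w) has_derivative (\<lambda>v. diff (\<lambda>y. F y (S x) w) x v + F x (?L v) w)) (at x)" for w
    using has_derivative_form[where \<alpha> = "\<lambda>y v. F y v w", OF open_D x F_linear(2)
        smooth_on_differentiable[OF smooth_F x] smooth_on_has_derivative[OF S x]] .
  \<comment> \<open>This says that dA is closed. With it, the exterior derivative of the contraction
    becomes the Lie derivative of dA along \<open>S\<close>, as in Cartan's formula.\<close>
  have closed: "diff (\<lambda>y. F y s w) x v = diff (\<lambda>y. F y s v) x w + diff (\<lambda>y. F y v w) x s" for s v w
  proof -
    have d: "diff (\<lambda>y. F y v w) x X = diff (\<lambda>y. dA y v w) x X - diff (\<lambda>y. dA y w v) x X" for v w X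
      unfolding ext_deriv_def
      by (rule fun_cong[OF diff_eq[OF has_derivative_diff]])
        (intro smooth_on_has_derivative[OF smooth_on_diff[OF smooth_A] x])+
    have s: "diff (\<lambda>y. dA y v w) x e = diff (\<lambda>y. dA y e w) x v" for v w e
      by (rule diff_diff_commute[OF open_D smooth_A x])
    show ?thesis unfolding d using s[of s w v] s[of w s v] s[of v s w] s[of v w s] s[of w v s] s[of s v w] by simp
  qed
  have "ext_deriv (\<lambda>y. F y (S y)) x v w = diff (\<lambda>y. F y v w) x (S x) + F x (?L v) w + F x v (?L w)"
  proof -
    have "ext_deriv (\<lambda>y. F y (S y)) x v w = diff (\<lambda>y. F y (S y) w) x v - diff (\<lambda>y. F y (S y) v) x w"
      by (rule ext_deriv_def)
    also have "\<dots> = diff (\<lambda>y. F y (S x) w) x v + F x (?L v) w - (diff (\<lambda>y. F y (S x) v) x w + F x (?L w) v)"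
      by (simp only: diff_eq[OF dF])
    finally show ?thesis using closed[of "S x" w v] F_skew[of x v "?L w"] by linarith
  qed
  also have "\<dots> = b / 2 * F x v w"
  proof -
    \<comment> \<open>The hypothesis on the Lie derivative, read as a formula for the derivative of
      the metric along \<open>S\<close> in the shape that \<open>vol_density_derivative\<close>
      accepts.\<close>
    have dH: "diff (\<lambda>y. H y v w) x (S x) = H x (- (b / 2) *\<^sub>R v - ?L v) w + H x v (- (b / 2) *\<^sub>R w - ?L w)" for v w
      using lie[of v w] by (simp add: lie_deriv_def metric_simps[OF x])
    have linM: "linear (\<lambda>v. - (b / 2) *\<^sub>R v - ?L v)"
      by (intro linear_compose_sub lin) (auto intro!: linearI simp: algebra_simps)
    have "trace_op (\<lambda>v. - (b / 2) *\<^sub>R v - ?L v) = - (3 * b / 2) - trace_op ?L"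
      unfolding trace_op_sub trace_op_scale trace_op_ident by simp
    then have d\<rho>: "diff \<rho> x (S x) = (- (3 * b / 2) - trace_op ?L) * \<rho> x"
      using vol_density_derivative(1)[OF x linM dH] by simp
    \<comment> \<open>The bracket of \<open>S\<close> with grad u is 2 b grad u: one b comes from
      \<open>u\<close>, the other from the inverse metric. Together with the weight - 3 b / 2 of the
      volume form this leaves the factor b / 2 for dA.\<close>
    have bracket: "diff G x (S x) - ?L (G x) = (2 * b) *\<^sub>R G x"
    proof (rule metric_cancel[OF x])
      fix z
      have 1: "((\<lambda>y. H y (G y) (S y)) has_derivative (\<lambda>v. H x (hess x v) (S x) + H x (G x) (?L v + \<Gamma> x v (S x)))) (at x)"
        by (rule has_derivative_eq_rhs[OF form_derivative[OF x smooth_on_has_derivative[OF smooth_G x] smooth_on_has_derivative[OF S x]]])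
          (simp add: hess_def)
      have 2: "((\<lambda>y. H y (G y) (S y)) has_derivative (\<lambda>v. b * du x v)) (at x)"
        by (rule has_derivative_cong_on[OF open_D x _ has_derivative_mult_right[OF smooth_on_has_derivative[OF smooth_u x]]])
          (simp add: b[symmetric] du_G)
      have e: "H x (hess x z) (S x) + H x (G x) (?L z + \<Gamma> x z (S x)) = b * du x z"
        by (rule fun_cong[OF has_derivative_unique[OF 1 2]])
      have l: "H x (?L (G x) + \<Gamma> x (G x) (S x)) z + H x (G x) (?L z + \<Gamma> x z (S x)) = - b * du x z"
        using lie[of "G x" z] by (simp add: lie_deriv_nabla[OF x] du_G[OF x])
      have g: "diff G x (S x) = hess x (S x) - \<Gamma> x (G x) (S x)"
        by (simp add: hess_def christoffel_sym[OF x, of "G x"])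
      show "H x (diff G x (S x) - ?L (G x)) z = H x ((2 * b) *\<^sub>R G x) z"
        using e l hess_sym[OF x, of "S x" z] metric_sym[OF x, of "S x" "hess x z"]
        by (simp add: g metric_simps[OF x] du_G[OF x])
    qed
    have dF: "diff (\<lambda>y. F y v w) x (S x) = \<rho> x * (diff G x (S x) \<bullet> (v \<times> w)) + diff \<rho> x (S x) * (G x \<bullet> (v \<times> w))"
    proof -
      have "((\<lambda>y. \<rho> y * (G y \<bullet> (v \<times> w))) has_derivative
          (\<lambda>X. \<rho> x * (diff G x X \<bullet> (v \<times> w)) + diff \<rho> x X * (G x \<bullet> (v \<times> w)))) (at x)"
        by (intro has_derivative_mult has_derivative_inner_left diff_works vol_density_parallel(2)[OF x]
            smooth_on_differentiable[OF smooth_G x])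
      from has_derivative_cong_on[OF open_D x _ this, of "\<lambda>y. F y v w"]
      show ?thesis using F_eq by (simp add: diff_eq)
    qed
    have "diff G x (S x) = (2 * b) *\<^sub>R G x + ?L (G x)" using bracket by (simp add: algebra_simps)
    then show ?thesis
      unfolding dF d\<rho> using arg_cong[OF cross3_trace[OF lin, of "G x" v w], of "(*) (\<rho> x)"]
      by (simp add: F_eq[OF x] inner_add_left algebra_simps)
  qed
  finally show ?thesis .
qed

end

text \<open>A vector whose contraction with dA vanishes has zero cross product with grad u, hence is
  parallel to it; one that annihilates \<open>u\<close> is orthogonal to it. Where du is not zero
  only the zero vector is both.\<close>

lemma contraction_zero:
  assumes x: "x \<in> D" and F: "\<And>w. F x (S x) w = 0" and u: "du x (S x) = 0" and ne: "du x v \<noteq> 0"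
  shows "S x = 0"
proof -
  have n: "H x (G x) (G x) > 0"
  proof -
    have "G x \<noteq> 0"
    proof
      assume "G x = 0"
      then have "du x v = 0" by (simp only: du_G[OF x] metric_simps[OF x])
      then show False using ne by simp
    qed
    then show ?thesis using metric[OF x] unfolding inner_form_def by blast
  qed
  have "J x (S x) = 0" by (rule metric_cancel[OF x]) (simp add: J_works[OF x] F metric_simps[OF x])
  then have "H x (G x) (G x) * H x (S x) w = 0" for w
    using J_J[OF x, of "S x" w] u by (simp add: linear_0[OF J_linear[OF x]] metric_simps[OF x] du_G[OF x])
  then have "H x (S x) w = H x 0 w" for w using n by (simp add: metric_simps[OF x])
  then show ?thesis by (rule metric_cancel[OF x])
qed

end

text \<open>Gronwall argument: the squared norm of \<open>y\<close> times
  \<open>exp (- 2 * K * s)\<close> does not increase. The operator norms are bounded by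
  \<open>K\<close> through the finitely many images of basis vectors, so continuity on fixed vectors
  suffices.\<close>

lemma linear_ode_zero:
  fixes y :: "real \<Rightarrow> 'n::euclidean_space"
  assumes d: "\<And>s. s \<in> {0..1} \<Longrightarrow> (y has_vector_derivative M s (y s)) (at s)"
    and lin: "\<And>s. s \<in> {0..1} \<Longrightarrow> linear (M s)"
    and cont: "\<And>e. continuous_on {0..1} (\<lambda>s. M s e)"
    and y0: "y 0 = 0"
  shows "y 1 = 0"
proof -
  have "continuous_on {0..1} (\<lambda>s. \<Sum>e\<in>Basis. norm (M s e))" by (intro continuous_intros cont)
  then have "compact ((\<lambda>s. \<Sum>e\<in>Basis. norm (M s e)) ` {0..1::real})"
    by (intro compact_continuous_image) auto
  then obtain K where K: "\<And>s. s \<in> {0..1} \<Longrightarrow> (\<Sum>e\<in>Basis. norm (M s e)) \<le> K"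
    using compact_imp_bounded[THEN bounded_imp_bdd_above] by (force simp: bdd_above_def)
  have bound: "norm (M s v) \<le> K * norm v" if s: "s \<in> {0..1}" for s v
  proof -
    have "norm (M s v) \<le> (\<Sum>e\<in>Basis. norm ((v \<bullet> e) *\<^sub>R M s e))"
      unfolding linear_Basis_expand[OF lin[OF s], of v] by (rule norm_sum)
    also have "\<dots> \<le> (\<Sum>e\<in>Basis. norm v * norm (M s e))"
      by (intro sum_mono) (auto intro!: mult_right_mono Basis_le_norm)
    also have "\<dots> = norm v * (\<Sum>e\<in>Basis. norm (M s e))" by (simp add: sum_distrib_left)
    also have "\<dots> \<le> norm v * K" using K[OF s] by (intro mult_left_mono) auto
    finally show ?thesis by (simp add: mult.commute)
  qed
  let ?\<phi> = "\<lambda>s. exp (- 2 * K * s) * (y s \<bullet> y s)"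
  have "?\<phi> 1 \<le> ?\<phi> 0"
  proof (rule DERIV_nonpos_imp_nonincreasing[of 0 1 ?\<phi>])
    fix s :: real assume s: "0 \<le> s" "s \<le> 1"
    then have s': "s \<in> {0..1}" by simp
    have "((\<lambda>s. y s \<bullet> y s) has_real_derivative 2 * (M s (y s) \<bullet> y s)) (at s)"
      using has_derivative_inner[OF d[OF s', unfolded has_vector_derivative_def] d[OF s', unfolded has_vector_derivative_def]]
      by (rule has_derivative_imp_has_field_derivative) (simp add: inner_commute algebra_simps)
    then have "(?\<phi> has_real_derivative exp (- 2 * K * s) * (2 * (M s (y s) \<bullet> y s) - 2 * K * (y s \<bullet> y s))) (at s)"
      by (auto intro!: derivative_eq_intros simp: algebra_simps)
    moreover have "M s (y s) \<bullet> y s \<le> K * (y s \<bullet> y s)"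
    proof -
      have "M s (y s) \<bullet> y s \<le> norm (M s (y s)) * norm (y s)" by (rule norm_cauchy_schwarz)
      also have "\<dots> \<le> K * norm (y s) * norm (y s)" by (intro mult_right_mono bound[OF s']) simp
      finally show ?thesis by (simp add: dot_square_norm power2_eq_square)
    qed
    then have "exp (- 2 * K * s) * (2 * (M s (y s) \<bullet> y s) - 2 * K * (y s \<bullet> y s)) \<le> 0"
      by (intro mult_nonneg_nonpos) auto
    ultimately show "\<exists>l. (?\<phi> has_real_derivative l) (at s) \<and> l \<le> 0" by blast
  qed simp
  then have "exp (- 2 * K) * (y 1 \<bullet> y 1) \<le> 0" using y0 by simp
  then have "y 1 \<bullet> y 1 \<le> 0" by (simp add: mult_le_0_iff)
  then show ?thesis by (metis inner_eq_zero_iff inner_ge_zero order_antisym)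
qed

section \<open>Unique continuation of Killing fields\<close>

text \<open>The value and the first derivatives of a vector field at a point form an element of the
  following type; \<open>jet_map\<close> is the derivative as a linear map.\<close>

type_synonym jet = "(real^3) \<times> (real^3) \<times> (real^3) \<times> (real^3)"

definition jet_map :: "jet \<Rightarrow> real^3 \<Rightarrow> real^3" where
  "jet_map Y v = v $ 1 *\<^sub>R fst (snd Y) + v $ 2 *\<^sub>R fst (snd (snd Y)) + v $ 3 *\<^sub>R snd (snd (snd Y))"

lemma jet_map_linear: "linear (jet_map Y)" "linear (\<lambda>Y. jet_map Y v)"
  by (auto intro!: linearI simp: jet_map_def algebra_simps)

context chart_metric begin

text \<open>The terms of order at most one in the derivative of the Killing equation along \<open>m\<close>.\<close>

definition killing_low :: "real^3 \<Rightarrow> jet \<Rightarrow> real^3 \<Rightarrow> real^3 \<Rightarrow> real^3 \<Rightarrow> real" where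
  "killing_low x Y m k j = diff (\<lambda>y. diff (\<lambda>z. H z k j) y (fst Y)) x m + diff (\<lambda>z. H z k j) x (jet_map Y m)
     + diff (\<lambda>y. H y (jet_map Y k) j) x m + diff (\<lambda>y. H y k (jet_map Y j)) x m"

definition killing_second :: "real^3 \<Rightarrow> jet \<Rightarrow> real^3 \<Rightarrow> real^3 \<Rightarrow> real^3" where
  "killing_second x Y m k = sharp (H x) (\<lambda>j.
     - (killing_low x Y m k j + killing_low x Y k m j - killing_low x Y j m k) / 2)"

lemma diff_diff_metric_linear:
  assumes x: "x \<in> D"
  shows "linear (\<lambda>v. diff (\<lambda>y. diff (\<lambda>z. H z k j) y v) x m)"
    "linear (\<lambda>j. diff (\<lambda>y. diff (\<lambda>z. H z k j) y v) x m)"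
    "linear (diff (\<lambda>y. diff (\<lambda>z. H z k j) y v) x)"
  using diff_form_linear[where \<alpha> = "\<lambda>y v. diff (\<lambda>z. H z k j) y v", OF open_D x diff_metric_linear(3)
      smooth_on_differentiable[OF smooth_on_diff[OF smooth_metric] x]]
    diff_form_linear[where \<alpha> = "\<lambda>y j. diff (\<lambda>z. H z k j) y v", OF open_D x diff_metric_linear(2)
      smooth_on_differentiable[OF smooth_on_diff[OF smooth_metric] x]]
    smooth_on_linear_diff[OF smooth_on_diff[OF smooth_metric] x]
  by blast+

lemma killing_low_linear:
  assumes x: "x \<in> D"
  shows "linear (\<lambda>Y. killing_low x Y m k j)" "linear (\<lambda>j. killing_low x Y m k j)" "linear (\<lambda>m. killing_low x Y m k j)"
proof -
  have f: "linear (fst :: jet \<Rightarrow> _)" by (rule linear_fst)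
  note c = linear_compose[unfolded o_def]
  show "linear (\<lambda>Y. killing_low x Y m k j)" unfolding killing_low_def
    by (intro linear_compose_add c[OF f diff_diff_metric_linear(1)[OF x]] c[OF jet_map_linear(2) diff_metric_linear(3)[OF x]]
        c[OF jet_map_linear(2) diff_metric_linear(1)[OF x]] c[OF jet_map_linear(2) diff_metric_linear(2)[OF x]])
  show "linear (\<lambda>j. killing_low x Y m k j)" unfolding killing_low_def
    by (intro linear_compose_add diff_diff_metric_linear(2)[OF x] diff_metric_linear(2)[OF x]
        c[OF jet_map_linear(1) diff_metric_linear(2)[OF x]])
  show "linear (\<lambda>m. killing_low x Y m k j)" unfolding killing_low_def
    by (intro linear_compose_add diff_diff_metric_linear(3)[OF x] diff_metric_linear(3)[OF x]
        c[OF jet_map_linear(1) diff_metric_linear(3)[OF x]])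
qed

lemma smooth_killing_low: "smooth_on D (\<lambda>x. killing_low x Y m k j)"
  unfolding killing_low_def by (intro smooth_on_add smooth_on_diff smooth_metric open_D)

lemma killing_rhs_linear:
  assumes x: "x \<in> D"
  shows "linear (\<lambda>j. - (killing_low x Y m k j + killing_low x Y k m j - killing_low x Y j m k) / 2)"
    "linear (\<lambda>Y. - (killing_low x Y m k j + killing_low x Y k m j - killing_low x Y j m k) / 2)"
  by (intro linear_real_mult linear_compose_add linear_compose_sub killing_low_linear[OF x])+

lemma killing_second_linear: "x \<in> D \<Longrightarrow> linear (\<lambda>Y. killing_second x Y m k)"
proof -
  assume x: "x \<in> D"
  note l = killing_rhs_linear[OF x]
  show "linear (\<lambda>Y. killing_second x Y m k)" unfolding killing_second_def
    by (rule linearI; rule sharp_unique[OF metric[OF x]])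
      (simp_all only: metric_simps[OF x] sharp_works[OF metric[OF x] l(1)] linear_add[OF l(2)] linear_scale[OF l(2)] real_scaleR_def)
qed

lemma smooth_killing_second: "smooth_on D (\<lambda>x. killing_second x Y m k)"
  unfolding killing_second_def
proof (rule smooth_on_sharp[OF open_D metric smooth_metric killing_rhs_linear(1)])
  show "smooth_on D (\<lambda>x. - (killing_low x Y m k v + killing_low x Y k m v - killing_low x Y v m k) / 2)" for v
    by (rule smooth_on_divide[OF open_D _ smooth_on_minus[OF open_D smooth_on_diff_op[OF open_D
            smooth_on_add[OF open_D]]] smooth_on_const[OF open_D]])
      (simp_all add: smooth_killing_low)
qed

text \<open>The second derivatives of a Killing field are recovered from its derivative by the same
  permutation of indices that gives the Christoffel symbols.\<close>

lemma killing_second_derivative: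
  assumes S: "smooth_on D S" and killing: "\<And>x v w. x \<in> D \<Longrightarrow> lie_deriv S H x v w = 0" and x: "x \<in> D"
    and Y: "fst Y = S x" "\<And>v. jet_map Y v = diff S x v"
  shows "diff (\<lambda>y. diff S y k) x m = killing_second x Y m k"
proof -
  define c where "c = (\<lambda>m k. diff (\<lambda>y. diff S y k) x m)"
  have csym: "c m k = c k m" for m k unfolding c_def by (rule diff_diff_commute[OF open_D S x])
  have low: "killing_low x Y m k j + H x (c m k) j + H x k (c m j) = 0" for m k j
  proof -
    note dS = smooth_on_has_derivative[OF S x] smooth_on_has_derivative[OF smooth_on_diff[OF S] x]
    have 1: "((\<lambda>y. diff (\<lambda>z. H z k j) y (S y)) has_derivative
        (\<lambda>m. diff (\<lambda>y. diff (\<lambda>z. H z k j) y (S x)) x m + diff (\<lambda>z. H z k j) x (diff S x m))) (at x)"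
      by (rule has_derivative_form[OF open_D x diff_metric_linear(3)
            smooth_on_differentiable[OF smooth_on_diff[OF smooth_metric] x] dS(1)])
    have "((\<lambda>y. lie_deriv S H y k j) has_derivative (\<lambda>m.
        diff (\<lambda>y. diff (\<lambda>z. H z k j) y (S x)) x m + diff (\<lambda>z. H z k j) x (diff S x m)
        + (diff (\<lambda>y. H y (diff S x k) j) x m + H x (diff (\<lambda>y. diff S y k) x m) j + H x (diff S x k) 0)
        + (diff (\<lambda>y. H y k (diff S x j)) x m + H x 0 (diff S x j) + H x k (diff (\<lambda>y. diff S y j) x m)))) (at x)"
      unfolding lie_deriv_def
      by (intro has_derivative_add 1 metric_derivative[OF x] dS has_derivative_const)
    moreover have "((\<lambda>y. lie_deriv S H y k j) has_derivative (\<lambda>m. 0)) (at x)"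
      by (rule has_derivative_cong_on[OF open_D x _ has_derivative_const[of 0]]) (simp add: killing)
    ultimately have "diff (\<lambda>y. diff (\<lambda>z. H z k j) y (S x)) x m + diff (\<lambda>z. H z k j) x (diff S x m)
        + (diff (\<lambda>y. H y (diff S x k) j) x m + H x (diff (\<lambda>y. diff S y k) x m) j + H x (diff S x k) 0)
        + (diff (\<lambda>y. H y k (diff S x j)) x m + H x 0 (diff S x j) + H x k (diff (\<lambda>y. diff S y j) x m)) = 0"
      using has_derivative_unique by (metis (no_types, lifting))
    then show ?thesis by (simp add: killing_low_def Y c_def metric_simps[OF x])
  qed
  have "killing_second x Y m k = c m k"
    unfolding killing_second_def
  proof (rule sharp_unique[OF metric[OF x]])
    fix j
    show "H x (c m k) j = - (killing_low x Y m k j + killing_low x Y k m j - killing_low x Y j m k) / 2"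
      using low[of m k j] low[of k m j] low[of j m k] csym[of m k] csym[of m j] csym[of k j]
        metric_sym[OF x, of k "c j m"] metric_sym[OF x, of m "c j k"] by simp
  qed
  then show ?thesis by (simp add: c_def)
qed

text \<open>Since \<open>killing_second\<close> expresses the second derivatives linearly by the
  jet, the jet of \<open>S\<close> along the segment solves a linear differential equation with zero
  initial value.\<close>

lemma killing_unique_continuation:
  assumes S: "smooth_on D S" and killing: "\<And>x v w. x \<in> D \<Longrightarrow> lie_deriv S H x v w = 0"
    and segment: "\<And>s. s \<in> {0..1} \<Longrightarrow> x + s *\<^sub>R d \<in> D"
    and zero: "S x = 0" "\<And>v. diff S x v = 0"
  shows "S (x + d) = 0"
proof -
  let ?e = "\<lambda>k. axis k 1 :: real^3"
  let ?\<gamma> = "\<lambda>s. x + s *\<^sub>R d"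
  define y where "y = (\<lambda>s. (S (?\<gamma> s), diff S (?\<gamma> s) (?e 1), diff S (?\<gamma> s) (?e 2), diff S (?\<gamma> s) (?e 3)))"
  define M where "M = (\<lambda>s Y. (jet_map Y d, killing_second (?\<gamma> s) Y d (?e 1), killing_second (?\<gamma> s) Y d (?e 2),
      killing_second (?\<gamma> s) Y d (?e 3)))"
  have jet: "jet_map (y s) v = diff S (?\<gamma> s) v" if "s \<in> {0..1}" for s v
    using linear_Basis_expand[OF smooth_on_linear_diff[OF S segment[OF that]], of v]
    by (simp add: jet_map_def y_def sum_Basis_real3 inner_axis)
  have "y 1 = 0"
  proof (rule linear_ode_zero[of y M])
    fix s :: real assume s: "s \<in> {0..1}"
    note D = segment[OF s]
    have p: "((\<lambda>s. ?\<gamma> s) has_derivative (\<lambda>h. h *\<^sub>R d)) (at s)" by (auto intro!: derivative_eq_intros)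
    have v: "((\<lambda>s. f (?\<gamma> s)) has_vector_derivative diff f (?\<gamma> s) d) (at s)" if "smooth_on D f" for f :: "real^3 \<Rightarrow> real^3"
      using diff_chain_at[OF p smooth_on_has_derivative[OF that D]] linear_scale[OF smooth_on_linear_diff[OF that D]]
      by (simp add: has_vector_derivative_def o_def)
    have k: "killing_second (?\<gamma> s) (y s) d k = diff (\<lambda>y. diff S y k) (?\<gamma> s) d" for k
      using killing_second_derivative[OF S killing D, of "y s" k d] jet[OF s] by (simp add: y_def)
    show "(y has_vector_derivative M s (y s)) (at s)"
      unfolding M_def k jet[OF s] unfolding y_def
      by (intro has_vector_derivative_Pair v S smooth_on_diff)
    show "linear (M s)"
      unfolding M_def
      by (intro linearI) (simp_all add: linear_add[OF jet_map_linear(2)] linear_scale[OF jet_map_linear(2)]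
          linear_add[OF killing_second_linear[OF D]] linear_scale[OF killing_second_linear[OF D]])
  next
    fix Y
    have "continuous_on {0..1} (\<lambda>s. killing_second (?\<gamma> s) Y d k)" for k
      by (rule continuous_on_compose2[OF smooth_on_continuous[OF smooth_killing_second]])
        (use segment in \<open>auto intro!: continuous_intros\<close>)
    then show "continuous_on {0..1} (\<lambda>s. M s Y)" unfolding M_def by (intro continuous_intros)
  next
    show "y 0 = 0" by (simp add: y_def zero zero_prod_def)
  qed
  then show ?thesis by (simp add: y_def zero_prod_def)
qed

end

section \<open>Exterior derivatives and the passage from charts to atlases\<close>

lemma ext_deriv_add_exact:
  fixes B :: "'e::euclidean_space \<Rightarrow> 'e \<Rightarrow> real"
  assumes "open D" "x \<in> D" "\<And>v. smooth_on D (\<lambda>y. B y v)" "smooth_on D f"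
  shows "ext_deriv (\<lambda>y v. B y v + diff f y v) x v w = ext_deriv B x v w"
proof -
  have "diff (\<lambda>y. B y v + diff f y v) x w = diff (\<lambda>y. B y v) x w + diff (\<lambda>y. diff f y v) x w" for v w
    by (rule fun_cong[OF diff_eq[OF has_derivative_add]])
      (intro smooth_on_has_derivative[OF assms(3) assms(2)] smooth_on_has_derivative[OF smooth_on_diff[OF assms(4)] assms(2)])+
  then show ?thesis
    using diff_diff_commute[OF assms(1,4,2), of v w] by (simp add: ext_deriv_def)
qed

text \<open>The product rule also produces second derivatives of the map, which are symmetric and
  drop out of the alternating difference.\<close>

lemma ext_deriv_pullback:
  fixes \<tau> :: "'e::euclidean_space \<Rightarrow> 'f::euclidean_space" and \<alpha> :: "'f \<Rightarrow> 'f \<Rightarrow> real" and \<beta> :: "'e \<Rightarrow> 'e \<Rightarrow> real"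
  assumes D: "open D" "open D'" "x \<in> D" "\<And>y. y \<in> D \<Longrightarrow> \<tau> y \<in> D'" and \<tau>: "smooth_on D \<tau>"
    and \<alpha>: "\<And>y. y \<in> D' \<Longrightarrow> linear (\<alpha> y)" "\<And>v. smooth_on D' (\<lambda>y. \<alpha> y v)"
    and eq: "\<And>y v. y \<in> D \<Longrightarrow> \<alpha> (\<tau> y) (diff \<tau> y v) = \<beta> y v"
  shows "ext_deriv \<beta> x v w = ext_deriv \<alpha> (\<tau> x) (diff \<tau> x v) (diff \<tau> x w)"
proof -
  have d: "diff (\<lambda>y. \<beta> y w) x v = diff (\<lambda>y. \<alpha> y (diff \<tau> x w)) (\<tau> x) (diff \<tau> x v)
      + \<alpha> (\<tau> x) (diff (\<lambda>y. diff \<tau> y w) x v)" for v w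
  proof -
    have c: "((\<lambda>y. \<alpha> (\<tau> y) e) has_derivative (\<lambda>v. diff (\<lambda>y. \<alpha> y e) (\<tau> x) (diff \<tau> x v))) (at x)" for e
      using diff_chain_at[OF smooth_on_has_derivative[OF \<tau> D(3)] smooth_on_has_derivative[OF \<alpha>(2) D(4)[OF D(3)]]]
      by (simp add: o_def)
    have "((\<lambda>y. \<alpha> (\<tau> y) (diff \<tau> y w)) has_derivative (\<lambda>v. diff (\<lambda>y. \<alpha> (\<tau> y) (diff \<tau> x w)) x v
        + \<alpha> (\<tau> x) (diff (\<lambda>y. diff \<tau> y w) x v))) (at x)"
      by (rule has_derivative_form[where \<alpha> = "\<lambda>y. \<alpha> (\<tau> y)", OF D(1,3) \<alpha>(1)[OF D(4)] _
            smooth_on_has_derivative[OF smooth_on_diff[OF \<tau>] D(3)]])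
        (use c in \<open>auto simp: differentiable_def\<close>)
    from has_derivative_cong_on[OF D(1,3) eq this] show ?thesis by (simp add: diff_eq diff_eq[OF c])
  qed
  show ?thesis
    using diff_diff_commute[OF D(1) \<tau> D(3), of v w] by (simp add: ext_deriv_def d)
qed

lemma smooth_on_empty: "smooth_on {} f"
proof -
  have "Ck_on k {} f" for k by (induction k arbitrary: f) (simp_all add: Ck_on_Suc_diff)
  then show ?thesis by (simp add: smooth_on_def)
qed

lemma has_derivative_zero_ball:
  fixes f :: "'e::euclidean_space \<Rightarrow> real"
  assumes "\<And>x. x \<in> ball c r \<Longrightarrow> (f has_derivative (\<lambda>v. 0)) (at x)" "x \<in> ball c r" "y \<in> ball c r"
  shows "f x = f y"
  using has_derivative_zero_unique[OF convex_ball has_derivative_at_withinI[OF assms(1)] assms(2,3)] by metis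

lemma index_times_line [simp]: "index (times_line N) = index N"
  by (simp add: times_line_def)

lemma cimage_times_line [simp]: "cimage (times_line N) i (W \<times> UNIV) = cimage N i W \<times> UNIV"
  by (force simp: times_line_def cimage_def)

lemma gh_metric_gh_form: "gh_metric N h u A i = gh_form (h i) (rep N i u) (A i)"
  by (simp add: gh_metric_def gh_form_def)

section \<open>Atlases\<close>

locale chart_atlas =
  fixes N :: "('i, 'a::{t2_space,second_countable_topology}, real^3) atlas"
  assumes manifold: "analytic_manifold N"
begin

lemma covered: "\<exists>i\<in>index N. p \<in> cdom N i"
  using manifold unfolding analytic_manifold_def by blast

context fixes i assumes i: "i \<in> index N" begin

lemma chart_open: "open (cdom N i)" "open (cimage N i UNIV)"
  and chart_homeomorphism: "homeomorphism (cdom N i) (cimage N i UNIV) (cmap N i) (cinv N i)"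
  using manifold i unfolding analytic_manifold_def by blast+

lemma cinv_cmap: "p \<in> cdom N i \<Longrightarrow> cinv N i (cmap N i p) = p"
  using chart_homeomorphism by (simp add: homeomorphism_def)

lemma cmap_cinv: "x \<in> cimage N i W \<Longrightarrow> cmap N i (cinv N i x) = x"
  using cinv_cmap by (auto simp: cimage_def)

lemma cinv_in: "x \<in> cimage N i W \<Longrightarrow> cinv N i x \<in> cdom N i \<inter> W"
  using cinv_cmap by (auto simp: cimage_def)

lemma cmap_in: "p \<in> cdom N i \<Longrightarrow> p \<in> W \<Longrightarrow> cmap N i p \<in> cimage N i W"
  by (auto simp: cimage_def)

lemma cimage_iff: "x \<in> cimage N i W \<longleftrightarrow> x \<in> cimage N i UNIV \<and> cinv N i x \<in> W"
  using cinv_cmap by (auto simp: cimage_def)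

lemma open_cimage:
  assumes "open W"
  shows "open (cimage N i W)"
proof -
  have "openin (top_of_set (cdom N i)) (cdom N i \<inter> W)" using assms by (rule openin_open_Int)
  from homeomorphism_imp_open_map[OF chart_homeomorphism this]
  show ?thesis unfolding cimage_def[symmetric] using openin_open_trans chart_open(2) by blast
qed

lemma open_chart_preimage:
  assumes "open B" "B \<subseteq> cimage N i UNIV"
  shows "open (cinv N i ` B)"
proof -
  have "openin (top_of_set (cimage N i UNIV)) B" using assms by (simp add: openin_open_eq chart_open)
  from homeomorphism_imp_open_map[OF homeomorphism_symD[OF chart_homeomorphism] this]
  show ?thesis using openin_open_trans chart_open(1) by blast
qed

end

text \<open>Neighbourhoods that a chart maps onto a ball are connected and allow the primitive on a
  ball, the mean value argument and continuation along segments.\<close>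

lemma chart_ball:
  assumes "open W" "p \<in> W"
  obtains i r T where "i \<in> index N" "r > 0" "p \<in> T" "open T" "connected T" "T \<subseteq> W" "T \<subseteq> cdom N i"
    "cimage N i T = ball (cmap N i p) r" "cmap N i ` T = ball (cmap N i p) r"
proof -
  obtain i where i: "i \<in> index N" "p \<in> cdom N i" using covered by blast
  have "cmap N i p \<in> cimage N i W" using cmap_in[OF i(1,2) assms(2)] .
  then obtain r where r: "r > 0" "ball (cmap N i p) r \<subseteq> cimage N i W"
    using open_cimage[OF i(1) assms(1)] openE by blast
  let ?B = "ball (cmap N i p) r" and ?T = "cinv N i ` ball (cmap N i p) r"
  have BU: "?B \<subseteq> cimage N i UNIV" using r(2) cimage_iff[OF i(1)] by blast
  have T: "?T \<subseteq> cdom N i" "?T \<subseteq> W" using cinv_in[OF i(1)] r(2) by blast+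
  have "continuous_on ?B (cinv N i)"
    by (rule continuous_on_subset[OF homeomorphism_cont2[OF chart_homeomorphism[OF i(1)]] BU])
  then have "connected ?T" by (rule connected_continuous_image) simp
  moreover have "p \<in> ?T" using cinv_cmap[OF i] r(1) by (intro image_eqI[of _ _ "cmap N i p"]) auto
  moreover have im: "cmap N i ` ?T = ?B" using cmap_cinv[OF i(1)] BU by (force simp: image_image)
  moreover have "cimage N i ?T = ?B" unfolding cimage_def using T(1) im by (simp add: inf_absorb2)
  ultimately show ?thesis using that i(1) r(1) T open_chart_preimage[OF i(1) open_ball BU] by blast
qed

lemma transition_in:
  assumes "i \<in> index N" "j \<in> index N" "x \<in> cimage N i (cdom N j \<inter> W)"
  shows "transition N i j x \<in> cimage N j (cdom N i \<inter> W)" "cinv N j (transition N i j x) = cinv N i x"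
proof -
  have p: "cinv N i x \<in> cdom N i \<inter> (cdom N j \<inter> W)" using cinv_in[OF assms(1,3)] .
  then show "transition N i j x \<in> cimage N j (cdom N i \<inter> W)" "cinv N j (transition N i j x) = cinv N i x"
    using cmap_in[OF assms(2)] cinv_cmap[OF assms(2)] by (auto simp: transition_def)
qed

lemma rep_transition:
  assumes "i \<in> index N" "j \<in> index N" "x \<in> cimage N i (cdom N j \<inter> W)"
  shows "rep N i f x = rep N j f (transition N i j x)"
  using transition_in(2)[OF assms] by (simp add: rep_def)

lemma smooth_transition:
  assumes "i \<in> index N" "j \<in> index N"
  shows "smooth_on (cimage N i (cdom N j)) (transition N i j)" "open (cimage N i (cdom N j))"
  using manifold assms open_cimage[OF assms(1) chart_open(1)[OF assms(2)]]
  unfolding analytic_manifold_def real_analytic_on_def by blast+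

lemma overlap_open: "i \<in> index N \<Longrightarrow> j \<in> index N \<Longrightarrow> open W \<Longrightarrow> open (cimage N i (cdom N j \<inter> W))"
  by (intro open_cimage open_Int chart_open)

lemma overlap_subset: "i \<in> index N \<Longrightarrow> cimage N i (cdom N j \<inter> W) \<subseteq> cimage N i (cdom N j)"
  "i \<in> index N \<Longrightarrow> cimage N i (cdom N j \<inter> W) \<subseteq> cimage N i W"
  by (auto simp: cimage_def)

lemma smooth_transition_overlap:
  "i \<in> index N \<Longrightarrow> j \<in> index N \<Longrightarrow> smooth_on (cimage N i (cdom N j \<inter> W)) (transition N i j)"
  using smooth_on_subset[OF smooth_transition(1) overlap_subset(1)] by blast

lemma diff_rep_transition:
  assumes i: "i \<in> index N" "j \<in> index N" and W: "open W" and x: "x \<in> cimage N i (cdom N j \<inter> W)"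
    and f: "smooth_on (cimage N j W) (rep N j f)"
  shows "diff (rep N i f) x v = diff (rep N j f) (transition N i j x) (diff (transition N i j) x v)"
proof -
  have "transition N i j x \<in> cimage N j W"
    using transition_in(1)[OF i x] overlap_subset(2)[OF i(2)] by blast
  from diff_chain_at[OF smooth_on_has_derivative[OF smooth_transition_overlap[OF i] x] smooth_on_has_derivative[OF f this]]
  have "((\<lambda>x. rep N j f (transition N i j x)) has_derivative
      (\<lambda>v. diff (rep N j f) (transition N i j x) (diff (transition N i j) x v))) (at x)" by (simp add: o_def)
  then have "(rep N i f has_derivative
      (\<lambda>v. diff (rep N j f) (transition N i j x) (diff (transition N i j) x v))) (at x)"
    by (rule has_derivative_cong_on[OF overlap_open[OF i W] x, rotated]) (simp add: rep_transition[OF i])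
  then show ?thesis by (simp add: diff_eq)
qed

lemma diff_transition_inverse:
  assumes i: "i \<in> index N" "j \<in> index N" and x: "x \<in> cimage N i (cdom N j)"
  shows "diff (transition N j i) (transition N i j x) (diff (transition N i j) x v) = v"
proof -
  have x': "x \<in> cimage N i (cdom N j \<inter> UNIV)" using x by simp
  have "transition N i j x \<in> cimage N j (cdom N i)" using transition_in(1)[OF i x'] by simp
  from diff_chain_at[OF smooth_on_has_derivative[OF smooth_transition(1)[OF i] x]
      smooth_on_has_derivative[OF smooth_transition(1)[OF i(2,1)] this]]
  have 1: "((\<lambda>y. transition N j i (transition N i j y)) has_derivative
      (\<lambda>v. diff (transition N j i) (transition N i j x) (diff (transition N i j) x v))) (at x)" by (simp add: o_def)
  have "transition N j i (transition N i j y) = y" if "y \<in> cimage N i (cdom N j)" for y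
    using transition_in(2)[OF i, of y UNIV] that cmap_cinv[OF i(1) that] by (simp add: transition_def)
  from has_derivative_cong_on[OF smooth_transition(2)[OF i] x _ 1, of "\<lambda>y. y"] this
  have "((\<lambda>y. y) has_derivative (\<lambda>v. diff (transition N j i) (transition N i j x) (diff (transition N i j) x v))) (at x)"
    by simp
  from fun_cong[OF has_derivative_unique[OF this has_derivative_ident]] show ?thesis .
qed

text \<open>Identities between tensors in the target chart can therefore be tested on transported
  vectors.\<close>

lemma diff_transition_surj:
  assumes i: "i \<in> index N" "j \<in> index N" and x: "x \<in> cimage N i (cdom N j)"
  shows "\<exists>v. z = diff (transition N i j) x v"
proof -
  have "transition N i j x \<in> cimage N j (cdom N i)" "transition N j i (transition N i j x) = x"
    using transition_in[OF i, of x UNIV] x cmap_cinv[OF i(1) x] by (simp_all add: transition_def)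
  from diff_transition_inverse[OF i(2,1) this(1), of z] this(2) show ?thesis by metis
qed

text \<open>On chart balls the function is constant by convexity; connectedness of \<open>U\<close>
  turns local constancy into constancy.\<close>

lemma constant_of_zero_derivative:
  assumes U: "open U" "connected U"
    and d: "\<And>i x. i \<in> index N \<Longrightarrow> x \<in> cimage N i U \<Longrightarrow> (rep N i f has_derivative (\<lambda>v. 0)) (at x)"
  shows "\<exists>c. \<forall>q\<in>U. f q = c"
proof (cases "U = {}")
  case False
  then obtain p where p: "p \<in> U" by blast
  have loc: "\<exists>T. open T \<and> q \<in> T \<and> T \<subseteq> U \<and> (\<forall>q'\<in>T. f q = f q')" if q: "q \<in> U" for q
  proof -
    obtain i r T where T: "i \<in> index N" "r > 0" "q \<in> T" "open T" "connected T" "T \<subseteq> U" "T \<subseteq> cdom N i"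
      "cimage N i T = ball (cmap N i q) r" "cmap N i ` T = ball (cmap N i q) r"
      using chart_ball[OF U(1) q] by blast
    have sub: "ball (cmap N i q) r \<subseteq> cimage N i U" using T(6) unfolding T(8)[symmetric] cimage_def by blast
    have "f q' = f q" if "q' \<in> T" for q'
    proof -
      have "cmap N i q' \<in> ball (cmap N i q) r" using T(9) that by blast
      then have "rep N i f (cmap N i q') = rep N i f (cmap N i q)"
        using has_derivative_zero_ball[OF d[OF T(1)], of "cmap N i q" r] sub T(2) by (meson centre_in_ball subsetD)
      moreover have "q' \<in> cdom N i" "q \<in> cdom N i" using that T(3,7) by blast+
      ultimately show ?thesis by (simp add: rep_def cinv_cmap[OF T(1)])
    qed
    then have "\<forall>q'\<in>T. f q = f q'" by (metis (no_types))
    with T(3,4,6) show ?thesis by (intro exI[of _ T] conjI)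
  qed
  have "\<forall>q\<in>U. eventually (\<lambda>q'. f q = f q') (at q within U)"
  proof
    fix q assume "q \<in> U"
    from loc[OF this] obtain T where "open T \<and> q \<in> T \<and> T \<subseteq> U \<and> (\<forall>q'\<in>T. f q = f q')" ..
    then show "eventually (\<lambda>q'. f q = f q') (at q within U)"
      unfolding eventually_at_topological by (intro exI[of _ T]) blast
  qed
  from connected_local_const[OF U(2) _ p this] show ?thesis by blast
qed simp

text \<open>At each point the value is read off in one chosen chart, and compatibility makes it
  agree with all others. This turns the chartwise ratio S(u) / u and the vertical component at t = 0
  into functions on the manifold.\<close>

lemma glue_functions:
  fixes f :: "'i \<Rightarrow> real^3 \<Rightarrow> real"
  assumes "\<And>i j x. i \<in> index N \<Longrightarrow> j \<in> index N \<Longrightarrow> x \<in> cimage N i (cdom N j) \<Longrightarrow> f j (transition N i j x) = f i x"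
  shows "\<exists>g. \<forall>i\<in>index N. \<forall>x\<in>cimage N i UNIV. rep N i g x = f i x"
proof -
  define c where "c p = (SOME i. i \<in> index N \<and> p \<in> cdom N i)" for p
  have "c p \<in> index N \<and> p \<in> cdom N (c p)" for p
    using covered[of p] someI_ex[of "\<lambda>i. i \<in> index N \<and> p \<in> cdom N i"] unfolding c_def Bex_def by simp
  note c = this[THEN conjunct1] this[THEN conjunct2]
  show ?thesis
  proof (intro exI ballI)
    fix i x assume i: "i \<in> index N" and x: "x \<in> cimage N i UNIV"
    let ?p = "cinv N i x"
    have "x \<in> cimage N i (cdom N (c ?p))" using x c(2)[of ?p] cimage_iff[OF i, of x "cdom N (c ?p)"] by simp
    then show "rep N i (\<lambda>p. f (c p) (cmap N (c p) p)) x = f i x"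
      using assms[OF i c(1), of x ?p] by (simp add: rep_def transition_def)
  qed
qed

end

section \<open>Metrics and monopoles on an atlas\<close>

locale metric_atlas = chart_atlas N
  for N :: "('i, 'a::{t2_space,second_countable_topology}, real^3) atlas" +
  fixes h :: "'i \<Rightarrow> real^3 \<Rightarrow> real^3 \<Rightarrow> real^3 \<Rightarrow> real" and u :: "'a \<Rightarrow> real"
  assumes riemannian: "riemannian_metric N h" and u_pos: "u p > 0"
begin

lemma chart_metric_at:
  assumes i: "i \<in> index N" and W: "open W"
  shows "chart_metric (cimage N i W) (h i)"
proof
  show "open (cimage N i W)" by (rule open_cimage[OF i W])
  have sub: "cimage N i W \<subseteq> cimage N i UNIV" by (auto simp: cimage_def)
  show "inner_form (h i x)" if "x \<in> cimage N i W" for x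
    using riemannian i that sub unfolding riemannian_metric_def inner_form_def by blast
  show "smooth_on (cimage N i W) (\<lambda>x. h i x v w)" for v w
    using smooth_on_subset[OF _ sub] riemannian i unfolding riemannian_metric_def by blast
qed

lemma metric_transition:
  assumes "i \<in> index N" "j \<in> index N" "x \<in> cimage N i (cdom N j)"
  shows "h j (transition N i j x) (diff (transition N i j) x v) (diff (transition N i j) x w) = h i x v w"
  using riemannian assms unfolding riemannian_metric_def by blast

lemma chart_monopole_at:
  assumes i: "i \<in> index N" and W: "open W" and u: "smooth_function N W u"
    and A: "one_form N W A" "monopole N h W u A"
  shows "chart_monopole (cimage N i W) (h i) (rep N i u) (A i)"
proof -
  interpret chart_metric "cimage N i W" "h i" by (rule chart_metric_at[OF i W])
  show ?thesis
  proof (intro chart_monopole.intro chart_monopole_axioms.intro chart_metric_at[OF i W])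
    show "smooth_on (cimage N i W) (rep N i u)" using u i unfolding smooth_function_def by blast
    show "rep N i u x > 0" for x by (simp add: rep_def u_pos)
    show "linear (A i x)" if "x \<in> cimage N i W" for x using A(1) i that unfolding one_form_def by blast
    show "smooth_on (cimage N i W) (\<lambda>x. A i x v)" for v using A(1) i unfolding one_form_def by blast
    show "diff (rep N i u) x z = hodge (h i x) (ext_deriv (A i) x) z" if "x \<in> cimage N i W" for x z
      using A(2) i that unfolding monopole_def by blast
  qed
qed

end

section \<open>From solutions on the base to soliton flows\<close>

locale solution_atlas = metric_atlas N h u
  for N :: "('i, 'a::{t2_space,second_countable_topology}, real^3) atlas" and h u +
  fixes W :: "'a set" and B :: "'i \<Rightarrow> real^3 \<Rightarrow> real^3 \<Rightarrow> real" and w :: "'a \<Rightarrow> real" and a b :: real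
  assumes u_harmonic: "harmonic_function N h u" and open_W: "open W" and b: "b \<noteq> 0"
    and data: "soliton_data N h W u B w a b"
begin

abbreviation "S \<equiv> base_field N h u B w a"
abbreviation "\<beta> \<equiv> dw_aB N w B a"

text \<open>The value of dv that is forced when dA contracted with S is to equal (b / 2) A for A = B
  + dv, because dA = dB.\<close>

definition potential_form :: "'i \<Rightarrow> real^3 \<Rightarrow> real^3 \<Rightarrow> real" where
  "potential_form j x z = 2 / b * ext_deriv (B j) x (S j x) z - B j x z"

lemma smooth_u: "smooth_function N V u"
  using u_harmonic smooth_on_subset[of "cimage N _ UNIV" "rep N _ u" "cimage N _ V"]
  unfolding harmonic_function_def smooth_function_def by (auto simp: cimage_def image_mono)

lemma B: "one_form N W B" "monopole N h W u B" and smooth_w: "smooth_function N W w"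
  using data unfolding soliton_data_def by blast+

lemma smooth_function_subset: "smooth_function N V f \<Longrightarrow> V' \<subseteq> V \<Longrightarrow> smooth_function N V' f"
  unfolding smooth_function_def
  using smooth_on_subset by (metis (no_types, lifting) cimage_def image_mono inf_mono subset_refl)

context
  fixes i assumes i: "i \<in> index N"
begin

interpretation chart_monopole "cimage N i W" "h i" "rep N i u" "B i"
  by (rule chart_monopole_at[OF i open_W smooth_u B])

lemma chart_w: "smooth_on (cimage N i W) (rep N i w)"
  using smooth_w i unfolding smooth_function_def by blast

lemma base_field_eq:
  "S i y = (inverse (rep N i u y) * inverse (rep N i u y)) *\<^sub>R (grad (h i) (rep N i w) y - a *\<^sub>R sharp_field (h i) (B i) y)"
  by (simp add: base_field_def power2_eq_square)

lemma chart_base_field: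
  assumes x: "x \<in> cimage N i W"
  shows "h i x (S i x) v = inverse (rep N i u x) * inverse (rep N i u x) * \<beta> i x v"
    "diff (rep N i u) x (S i x) = b * rep N i u x"
    "lie_deriv (S i) (h i) x y z = - b * h i x y z"
    "smooth_on (cimage N i W) (S i)"
    "laplacian (h i) (rep N i u) x = 0"
proof -
  let ?U = "rep N i u x" and ?du = "diff (rep N i u) x"
  note ids = lie_S_identity[OF x chart_w linear_A smooth_A base_field_eq]
  show *: "h i x (S i x) v = inverse ?U * inverse ?U * \<beta> i x v" for v
    unfolding dw_aB_def by (rule ids(1))
  show "smooth_on (cimage N i W) (S i)" by (rule ids(3))
  have U: "?U \<noteq> 0" by (rule u_nonzero[OF x])
  define j where "j = inverse ?U"
  have j: "?U * j = 1" using U by (simp add: j_def)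
  from data i x have e:
    "?du (grad (h i) (rep N i w) x) = b * ?U ^ 3 + a * ?du (sharp_field (h i) (B i) x)"
    "cov_deriv (h i) (diff (rep N i w)) x y z = 1/2 * a * lie_deriv (sharp_field (h i) (B i)) (h i) x y z
       - 1/2 * b * ?U ^ 2 * h i x y z + 2 * inverse ?U * sym_prod ?du (\<beta> i x) y z"
    unfolding soliton_data_def Let_def by blast+
  have "?du (S i x) = j * j * (b * ?U ^ 3)"
    unfolding base_field_eq j_def[symmetric] using e(1) by (simp add: gh_linear_simps[OF x])
  also have "\<dots> = (?U * j) * (?U * j) * (b * ?U)" by (simp add: power3_eq_cube)
  finally show "?du (S i x) = b * ?U" unfolding j by simp
  have "lie_deriv (S i) (h i) x y z = - b * ((?U * j) * (?U * j)) * h i x y z"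
  proof -
    have "lie_deriv (S i) (h i) x y z = j * j * (2 * cov_deriv (h i) (diff (rep N i w)) x y z
        - a * lie_deriv (sharp_field (h i) (B i)) (h i) x y z)
        - 2 * (j * j * j) * (?du y * \<beta> i x z + ?du z * \<beta> i x y)"
      unfolding dw_aB_def j_def by (rule ids(2))
    then show ?thesis
      unfolding e(2) sym_prod_def j_def[symmetric] by (simp add: power2_eq_square field_simps)
  qed
  then show "lie_deriv (S i) (h i) x y z = - b * h i x y z" unfolding j by simp
  show "laplacian (h i) (rep N i u) x = 0"
    using u_harmonic i x cimage_iff[OF i, of x W] by (simp add: harmonic_function_def)
qed

lemma chart_potential_form:
  assumes x: "x \<in> cimage N i W"
  shows "linear (potential_form i x)" "smooth_on (cimage N i W) (\<lambda>x. potential_form i x v)"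
    "ext_deriv (potential_form i) x v z = 0"
proof -
  note S = chart_base_field(4)[OF x]
  show "linear (potential_form i x)" unfolding potential_form_def
    by (intro linear_compose_sub linear_real_mult F_linear(1)[OF x] linear_A[OF x])
  have c: "smooth_on (cimage N i W) (\<lambda>x. ext_deriv (B i) x (S i x) v)" for v
    by (rule smooth_on_form[where \<alpha> = "\<lambda>x y. ext_deriv (B i) x y v", OF open_D F_linear(2) smooth_F S])
  show "smooth_on (cimage N i W) (\<lambda>x. potential_form i x v)" for v unfolding potential_form_def
    by (intro smooth_on_diff_op smooth_on_mult smooth_on_const c smooth_A open_D)
  have "diff (\<lambda>y. potential_form i y w) x v =
      2 / b * diff (\<lambda>y. ext_deriv (B i) y (S i y) w) x v - diff (\<lambda>y. B i y w) x v" for v w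
    unfolding potential_form_def
    by (rule fun_cong[OF diff_eq[OF has_derivative_diff[OF has_derivative_mult_right]]])
      (intro smooth_on_has_derivative[OF c x] smooth_on_has_derivative[OF smooth_A x])+
  then have "ext_deriv (potential_form i) x v z = 2 / b * ext_deriv (\<lambda>y. ext_deriv (B i) y (S i y)) x v z - ext_deriv (B i) x v z"
    by (simp add: ext_deriv_def[of "potential_form i"] ext_deriv_def[of "\<lambda>y. ext_deriv (B i) y (S i y)"]
        ext_deriv_def[of "B i" x v] right_diff_distrib)
  moreover have "ext_deriv (\<lambda>y. ext_deriv (B i) y (S i y)) x v z = b / 2 * ext_deriv (B i) x v z"
    by (rule contraction_ext_deriv[OF x S chart_base_field(2) chart_base_field(3)[OF x]])
  ultimately show "ext_deriv (potential_form i) x v z = 0" using b by simp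
qed

end

section \<open>Change of chart for the data\<close>

context
  fixes i j x assumes i: "i \<in> index N" "j \<in> index N" and x: "x \<in> cimage N i (cdom N j \<inter> W)"
begin

lemma chart_points: "x \<in> cimage N i W" "transition N i j x \<in> cimage N j W" "x \<in> cimage N i (cdom N j)"
  using x transition_in(1)[OF i x] overlap_subset i by blast+

lemma one_form_transition: "B j (transition N i j x) (diff (transition N i j) x v) = B i x v"
  using B(1) i x unfolding one_form_def by blast

lemma dw_aB_transition: "\<beta> j (transition N i j x) (diff (transition N i j) x v) = \<beta> i x v"
  using diff_rep_transition[OF i open_W x chart_w[OF i(2)], of v] by (simp add: dw_aB_def one_form_transition)

text \<open>The field is defined chart by chart through \<open>sharp\<close>, but its metric dual is
  a multiple of dw - aB, which transforms as a one-form. The metric being nondegenerate, the field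
  transforms accordingly.\<close>

lemma base_field_transition: "S j (transition N i j x) = diff (transition N i j) x (S i x)"
proof -
  interpret j: chart_metric "cimage N j W" "h j" by (rule chart_metric_at[OF i(2) open_W])
  show ?thesis
  proof (rule j.metric_cancel[OF chart_points(2)])
    fix z
    obtain v where z: "z = diff (transition N i j) x v" using diff_transition_surj[OF i chart_points(3)] by blast
    show "h j (transition N i j x) (S j (transition N i j x)) z = h j (transition N i j x) (diff (transition N i j) x (S i x)) z"
      unfolding z metric_transition[OF i chart_points(3)] chart_base_field(1)[OF i(1) chart_points(1)]
        chart_base_field(1)[OF i(2) chart_points(2)] dw_aB_transition rep_transition[OF i x, symmetric] ..
  qed
qed

lemma ext_deriv_transition:
  "ext_deriv (B i) x v z = ext_deriv (B j) (transition N i j x) (diff (transition N i j) x v) (diff (transition N i j) x z)"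
proof (rule ext_deriv_pullback[OF overlap_open[OF i open_W] open_cimage[OF i(2) open_W] x _ smooth_transition_overlap[OF i]])
  show "transition N i j y \<in> cimage N j W" if "y \<in> cimage N i (cdom N j \<inter> W)" for y
    using transition_in(1)[OF i that] overlap_subset(2)[OF i(2)] by blast
  show "linear (B j y)" if "y \<in> cimage N j W" for y using B(1) i that unfolding one_form_def by blast
  show "smooth_on (cimage N j W) (\<lambda>y. B j y v)" for v using B(1) i unfolding one_form_def by blast
  show "B j (transition N i j y) (diff (transition N i j) y v) = B i y v" if "y \<in> cimage N i (cdom N j \<inter> W)" for y v
    using B(1) i that unfolding one_form_def by blast
qed

lemma potential_form_transition:
  "potential_form j (transition N i j x) (diff (transition N i j) x v) = potential_form i x v"
  by (simp add: potential_form_def base_field_transition ext_deriv_transition one_form_transition)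

end

section \<open>The soliton equation for A = B + dv\<close>

lemma chart_add_exact:
  assumes i: "i \<in> index N" and U: "open U" "U \<subseteq> W" and v: "smooth_function N U v"
  shows "chart_monopole (cimage N i U) (h i) (rep N i u) (add_exact N B v i)"
    and "x \<in> cimage N i U \<Longrightarrow> ext_deriv (add_exact N B v i) x y z = ext_deriv (B i) x y z"
proof -
  have sub: "cimage N i U \<subseteq> cimage N i W" using U(2) by (auto simp: cimage_def)
  interpret B: chart_monopole "cimage N i W" "h i" "rep N i u" "B i"
    by (rule chart_monopole_at[OF i open_W smooth_u B])
  have sv: "smooth_on (cimage N i U) (rep N i v)" using v i unfolding smooth_function_def by blast
  have sB: "smooth_on (cimage N i U) (\<lambda>y. B i y z)" for z by (rule smooth_on_subset[OF B.smooth_A sub])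
  have F: "ext_deriv (add_exact N B v i) x y z = ext_deriv (B i) x y z" if "x \<in> cimage N i U" for x y z
    using ext_deriv_add_exact[OF open_cimage[OF i U(1)] that sB sv] by (simp add: add_exact_def[abs_def])
  then show "x \<in> cimage N i U \<Longrightarrow> ext_deriv (add_exact N B v i) x y z = ext_deriv (B i) x y z" .
  show "chart_monopole (cimage N i U) (h i) (rep N i u) (add_exact N B v i)"
  proof (intro chart_monopole.intro chart_monopole_axioms.intro chart_metric_at[OF i U(1)])
    show "smooth_on (cimage N i U) (rep N i u)" by (rule smooth_on_subset[OF B.smooth_u sub])
    show "rep N i u x > 0" for x by (simp add: rep_def u_pos)
    show "linear (add_exact N B v i x)" if "x \<in> cimage N i U" for x
      unfolding add_exact_def using that sub
      by (intro linear_compose_add B.linear_A smooth_on_linear_diff[OF sv]) auto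
    show "smooth_on (cimage N i U) (\<lambda>x. add_exact N B v i x z)" for z
      unfolding add_exact_def by (intro smooth_on_add sB smooth_on_diff sv open_cimage[OF i U(1)])
    show "diff (rep N i u) x z = hodge (h i x) (ext_deriv (add_exact N B v i) x) z" if "x \<in> cimage N i U" for x z
    proof -
      have "ext_deriv (add_exact N B v i) x = ext_deriv (B i) x" using F[OF that] by blast
      then show ?thesis using B.monopole_eq that sub by auto
    qed
  qed
qed

text \<open>The fibre part of the soliton equation, solved for the differentials of \<open>v\<close>
  and \<open>f0\<close>. Existence and uniqueness of both functions are read off from it.\<close>

definition potential_pair :: "'i \<Rightarrow> ('a \<Rightarrow> real) \<Rightarrow> ('a \<Rightarrow> real) \<Rightarrow> real^3 \<Rightarrow> bool" where
  "potential_pair i v f0 x \<longleftrightarrow> (\<forall>z. diff (rep N i v) x z = potential_form i x z \<and>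
     diff (rep N i f0) x z = - a * diff (rep N i v) x z - diff (rep N i w) x z)"

lemma chart_soliton:
  assumes i: "i \<in> index N" and U: "open U" "U \<subseteq> W" and v: "smooth_function N U v" "smooth_function N U f0"
    and x: "x \<in> cimage N i U"
  defines "A \<equiv> add_exact N B v"
  shows "(\<forall>t V. soliton_tensor (gh_metric N h u A i) (gh_field N h u A B w f0 a b i) a (x, t) (0, 1) V = 0)
      \<longleftrightarrow> potential_pair i v f0 x"
    and "potential_pair i v f0 x \<Longrightarrow>
      soliton_tensor (gh_metric N h u A i) (gh_field N h u A B w f0 a b i) a (x, t) (y, r) (z, s) =
      ricci (h i) x y z + a * rep N i u x * h i x y z - inverse (rep N i u x) * sym_prod (A i x) (\<beta> i x) y z"
proof -
  have sub: "cimage N i U \<subseteq> cimage N i W" using U(2) by (auto simp: cimage_def)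
  then have xW: "x \<in> cimage N i W" using x by blast
  interpret chart_monopole "cimage N i U" "h i" "rep N i u" "A i"
    unfolding A_def by (rule chart_add_exact(1)[OF i U v(1)])
  let ?E = "gh_field N h u A B w f0 a b i"
  note c = chart_base_field[OF i xW]
  have Sd: "S i differentiable (at x)" by (rule smooth_on_differentiable[OF c(4) xW])
  have f0: "rep N i f0 differentiable (at x)"
    using v(2) i x smooth_on_differentiable unfolding smooth_function_def by blast
  have E: "\<forall>y\<in>cimage N i U. \<forall>t. ?E (y, t) = (t *\<^sub>R S i y, rep N i f0 y - a * t + 1/4 * b * t\<^sup>2 - t * A i y (S i y))"
    by (simp add: gh_field_def horizontal_lift_def)
  define j where "j = inverse (rep N i u x)"
  have j: "rep N i u x * j = 1" using u_nonzero[OF x] by (simp add: j_def)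
  have hS: "rep N i u x * rep N i u x * h i x (S i x) z = \<beta> i x z" for z
  proof -
    have "rep N i u x * rep N i u x * h i x (S i x) z = (rep N i u x * j) * (rep N i u x * j) * \<beta> i x z"
      unfolding c(1) j_def[symmetric] by simp
    then show ?thesis unfolding j by simp
  qed
  have F: "ext_deriv (A i) x y z = ext_deriv (B i) x y z" for y z
    unfolding A_def by (rule chart_add_exact(2)[OF i U v(1) x])
  \<comment> \<open>Since dA = dB, the first condition determines dv. In the second, df0 = - a A -
    (dw - aB), the two multiples of B cancel.\<close>
  have pair: "(\<forall>z. ext_deriv (A i) x (S i x) z = b / 2 * A i x z \<and> diff (rep N i f0) x z + a * A i x z
      + rep N i u x * rep N i u x * h i x (S i x) z = 0) \<longleftrightarrow> potential_pair i v f0 x"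
    unfolding potential_pair_def F hS
    unfolding A_def add_exact_def potential_form_def dw_aB_def
    using b by (intro iff_allI) (auto simp: field_simps)
  show "(\<forall>t V. soliton_tensor (gh_metric N h u A i) ?E a (x, t) (0, 1) V = 0) \<longleftrightarrow> potential_pair i v f0 x"
    unfolding pair[symmetric] gh_metric_gh_form by (rule soliton_along_iff[OF x c(5) Sd f0 E c(2)])
  assume "potential_pair i v f0 x"
  then have along: "ext_deriv (A i) x (S i x) z = b / 2 * A i x z" "diff (rep N i f0) x z + a * A i x z
      + rep N i u x * rep N i u x * h i x (S i x) z = 0" for z unfolding pair[symmetric] by blast+
  have "soliton_tensor (gh_metric N h u A i) ?E a (x, t) (y, r) (z, s) =
      ricci (h i) x y z + a * rep N i u x * h i x y z - rep N i u x / 2 * (A i x y * h i x (S i x) z + A i x z * h i x (S i x) y)"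
    unfolding gh_metric_gh_form by (rule soliton_tensor_base[OF x c(5) Sd f0 E c(2) c(3) along])
  also have "rep N i u x / 2 * (A i x y * h i x (S i x) z + A i x z * h i x (S i x) y)
      = (rep N i u x * j) * j * sym_prod (A i x) (\<beta> i x) y z"
    unfolding c(1) sym_prod_def j_def[symmetric] by (simp add: field_simps)
  finally show "soliton_tensor (gh_metric N h u A i) ?E a (x, t) (y, r) (z, s) =
      ricci (h i) x y z + a * rep N i u x * h i x y z - inverse (rep N i u x) * sym_prod (A i x) (\<beta> i x) y z"
    unfolding j by (simp add: j_def)
qed

lemma soliton_along_fibres_iff:
  assumes U: "open U" "U \<subseteq> W" and v: "smooth_function N U v" "smooth_function N U f0"
  defines "A \<equiv> add_exact N B v"
  shows "soliton_along_fibres (times_line N) (gh_metric N h u A) (U \<times> UNIV) (gh_field N h u A B w f0 a b) a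
    \<longleftrightarrow> (\<forall>i\<in>index N. \<forall>x\<in>cimage N i U. potential_pair i v f0 x)"
  unfolding soliton_along_fibres_def index_times_line cimage_times_line A_def
  using chart_soliton(1)[OF _ U v] by (auto simp del: split_paired_All)

lemma soliton_flow_iff:
  assumes U: "open U" "U \<subseteq> W" and v: "smooth_function N U v" "smooth_function N U f0"
    and pair: "\<And>i x. i \<in> index N \<Longrightarrow> x \<in> cimage N i U \<Longrightarrow> potential_pair i v f0 x"
  defines "A \<equiv> add_exact N B v"
  shows "soliton_flow (times_line N) (gh_metric N h u A) (U \<times> UNIV) (gh_field N h u A B w f0 a b) a
    \<longleftrightarrow> base_equation N h U u A B w a"
  unfolding soliton_flow_def base_equation_def index_times_line cimage_times_line A_def
  by (simp add: chart_soliton(2)[OF _ U v _ pair])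

text \<open>A primitive is found in a single chart, on a ball; the transformation law of
  \<open>potential_form\<close> makes it a primitive in every other chart as well.\<close>

lemma local_potential:
  assumes p: "p \<in> W"
  shows "\<exists>U v. open U \<and> connected U \<and> p \<in> U \<and> U \<subseteq> W \<and>
    (\<forall>j\<in>index N. \<forall>x\<in>cimage N j U. (rep N j v has_derivative potential_form j x) (at x))"
proof -
  obtain i r T where i: "i \<in> index N" and T: "r > 0" "p \<in> T" "open T" "connected T" "T \<subseteq> W" "T \<subseteq> cdom N i"
    "cimage N i T = ball (cmap N i p) r" "cmap N i ` T = ball (cmap N i p) r"
    using chart_ball[OF open_W p] by metis
  let ?D = "ball (cmap N i p) r"
  have sub: "cimage N j T \<subseteq> cimage N j W" for j using T(5) by (auto simp: cimage_def)
  note D = sub[of i, unfolded T(7)]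
  have "\<exists>f. smooth_on ?D f \<and> (\<forall>x\<in>?D. (f has_derivative potential_form i x) (at x))"
  proof (rule poincare_ball)
    show "linear (potential_form i x)" if "x \<in> ?D" for x
      by (rule chart_potential_form(1)[OF i]) (use that D in blast)
    show "smooth_on ?D (\<lambda>x. potential_form i x v)" for v
      by (rule smooth_on_subset[OF chart_potential_form(2)[OF i, of "cmap N i p"] D]) (use D T(1) in force)
    show "ext_deriv (potential_form i) x v w = 0" if "x \<in> ?D" for x v w
      by (rule chart_potential_form(3)[OF i]) (use that D in blast)
  qed
  then obtain f where f: "\<And>x. x \<in> ?D \<Longrightarrow> (f has_derivative potential_form i x) (at x)" by blast
  have "(rep N j (\<lambda>q. f (cmap N i q)) has_derivative potential_form j x) (at x)"
    if j: "j \<in> index N" and x: "x \<in> cimage N j T" for j x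
  proof -
    have o: "cimage N j (cdom N i \<inter> T) = cimage N j T" using T(6) by (simp add: inf_absorb2)
    have x': "x \<in> cimage N j (cdom N i \<inter> T)" using x by (simp only: o)
    have x'': "x \<in> cimage N j (cdom N i \<inter> W)" using x' T(5) by (auto simp: cimage_def)
    have y: "transition N j i x \<in> ?D"
      using transition_in(1)[OF j i x'] overlap_subset(2)[OF i] unfolding T(7)[symmetric] by blast
    have "((f \<circ> transition N j i) has_derivative (potential_form i (transition N j i x) \<circ> diff (transition N j i) x)) (at x)"
      by (rule diff_chain_at[OF smooth_on_has_derivative[OF smooth_transition_overlap[OF j i] x'] f[OF y]])
    moreover have "potential_form i (transition N j i x) \<circ> diff (transition N j i) x = potential_form j x"
      using potential_form_transition[OF j i x''] by (simp add: fun_eq_iff)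
    moreover have "f \<circ> transition N j i = rep N j (\<lambda>q. f (cmap N i q))"
      by (simp add: fun_eq_iff rep_def transition_def)
    ultimately show ?thesis by simp
  qed
  then show ?thesis using T by blast
qed

lemma local_solution:
  assumes p: "p \<in> W"
  shows "\<exists>U. open U \<and> connected U \<and> p \<in> U \<and> U \<subseteq> W \<and>
          (\<exists>v f0. smooth_function N U v \<and> smooth_function N U f0 \<and>
             (let A = add_exact N B v;
                  g = gh_metric N h u A;
                  E = gh_field N h u A B w f0 a b
              in soliton_along_fibres (times_line N) g (U \<times> UNIV) E a \<and>
                 (soliton_flow (times_line N) g (U \<times> UNIV) E a
                    \<longleftrightarrow> base_equation N h U u A B w a)) \<and>
             (\<forall>v' f0'. smooth_function N U v' \<and> smooth_function N U f0' \<and>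
                (let A = add_exact N B v'
                 in soliton_along_fibres (times_line N) (gh_metric N h u A) (U \<times> UNIV)
                      (gh_field N h u A B w f0' a b) a) \<longrightarrow>
                (\<exists>c c'. \<forall>q\<in>U. v' q = v q + c \<and> f0' q = f0 q + c')))"
proof -
  obtain U v where U: "open U" "connected U" "p \<in> U" "U \<subseteq> W"
    and v: "\<And>j x. j \<in> index N \<Longrightarrow> x \<in> cimage N j U \<Longrightarrow> (rep N j v has_derivative potential_form j x) (at x)"
    using local_potential[OF p] by metis
  have sub: "cimage N j U \<subseteq> cimage N j W" for j using U(4) by (auto simp: cimage_def)
  have smv: "smooth_function N U v"
    unfolding smooth_function_def
  proof
    fix j assume j: "j \<in> index N"
    show "smooth_on (cimage N j U) (rep N j v)"
    \<comment> \<open>A chart that misses \<open>U\<close> offers no point at which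
      \<open>chart_potential_form\<close> could be applied.\<close>
    proof (cases "cimage N j U = {}")
      case False
      then obtain x where "x \<in> cimage N j W" using sub by blast
      then show ?thesis
        by (intro smooth_onI[OF open_cimage[OF j U(1)] v[OF j]] smooth_on_subset[OF chart_potential_form(2)[OF j] sub])
    qed (simp add: smooth_on_empty)
  qed
  \<comment> \<open>Integrates the second equation of \<open>potential_pair\<close>, df0 = - a dv -
    dw.\<close>
  define f0 where "f0 = (\<lambda>q. - a * v q - w q)"
  have rep_f0: "rep N j f0 = (\<lambda>x. - a * rep N j v x - rep N j w x)" for j by (simp add: rep_def f0_def fun_eq_iff)
  have chart: "smooth_on (cimage N j U) (rep N j v)" "smooth_on (cimage N j U) (rep N j w)" if "j \<in> index N" for j
    using smv smooth_function_subset[OF smooth_w U(4)] that unfolding smooth_function_def by blast+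
  have smf0: "smooth_function N U f0"
    unfolding smooth_function_def rep_f0
    by (intro ballI smooth_on_diff_op smooth_on_mult smooth_on_const chart open_cimage[OF _ U(1)])
  have dv: "diff (rep N j v) x = potential_form j x" if "j \<in> index N" "x \<in> cimage N j U" for j x
    by (rule diff_eq[OF v[OF that]])
  have df0: "diff (rep N j f0) x z = - a * diff (rep N j v) x z - diff (rep N j w) x z"
    if "j \<in> index N" "x \<in> cimage N j U" for j x z
    unfolding rep_f0
    by (rule fun_cong[OF diff_eq[OF has_derivative_diff[OF has_derivative_mult_right]]])
      (intro smooth_on_has_derivative[OF chart(1)[OF that(1)] that(2)] smooth_on_has_derivative[OF chart(2)[OF that(1)] that(2)])+
  have pair: "potential_pair j v f0 x" if "j \<in> index N" "x \<in> cimage N j U" for j x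
    unfolding potential_pair_def using dv[OF that] df0[OF that] by simp
  have unique: "\<exists>c. \<forall>q\<in>U. f' q = f q + c"
    if f: "smooth_function N U f" "smooth_function N U f'"
      and d: "\<And>j x. j \<in> index N \<Longrightarrow> x \<in> cimage N j U \<Longrightarrow> diff (rep N j f') x = diff (rep N j f) x" for f f'
  proof -
    have "\<exists>c. \<forall>q\<in>U. f' q - f q = c"
    proof (rule constant_of_zero_derivative[OF U(1,2)])
      fix j x assume j: "j \<in> index N" and x: "x \<in> cimage N j U"
      have "((\<lambda>x. rep N j f' x - rep N j f x) has_derivative (\<lambda>z. diff (rep N j f') x z - diff (rep N j f) x z)) (at x)"
        using f j x unfolding smooth_function_def by (intro has_derivative_diff smooth_on_has_derivative) auto
      then have "((\<lambda>x. rep N j f' x - rep N j f x) has_derivative (\<lambda>z. 0)) (at x)" by (simp add: d[OF j x])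
      moreover have "rep N j (\<lambda>q. f' q - f q) = (\<lambda>x. rep N j f' x - rep N j f x)" by (simp add: rep_def fun_eq_iff)
      ultimately show "(rep N j (\<lambda>q. f' q - f q) has_derivative (\<lambda>z. 0)) (at x)" by simp
    qed
    then show ?thesis by (metis diff_add_cancel add.commute)
  qed
  show ?thesis
    unfolding Let_def
  proof (rule exI[of _ U], intro conjI U, rule exI[of _ v], rule exI[of _ f0], intro conjI smv smf0 allI impI)
    show "soliton_along_fibres (times_line N) (gh_metric N h u (add_exact N B v)) (U \<times> UNIV)
        (gh_field N h u (add_exact N B v) B w f0 a b) a"
      using pair by (simp add: soliton_along_fibres_iff[OF U(1,4) smv smf0])
    show "soliton_flow (times_line N) (gh_metric N h u (add_exact N B v)) (U \<times> UNIV)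
        (gh_field N h u (add_exact N B v) B w f0 a b) a \<longleftrightarrow> base_equation N h U u (add_exact N B v) B w a"
      by (rule soliton_flow_iff[OF U(1,4) smv smf0 pair])
    fix v' f0'
    assume *: "smooth_function N U v' \<and> smooth_function N U f0' \<and>
      soliton_along_fibres (times_line N) (gh_metric N h u (add_exact N B v')) (U \<times> UNIV)
        (gh_field N h u (add_exact N B v') B w f0' a b) a"
    then have "\<forall>i\<in>index N. \<forall>x\<in>cimage N i U. potential_pair i v' f0' x"
      using soliton_along_fibres_iff[OF U(1,4), of v' f0'] by blast
    \<comment> \<open>\<open>potential_pair\<close> prescribes both differentials by the data alone,
      so they are the same for any two solutions, which then differ by constants on the connected
      set \<open>U\<close>.\<close>
    then have d: "diff (rep N j v') x = diff (rep N j v) x" "diff (rep N j f0') x = diff (rep N j f0) x"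
      if "j \<in> index N" "x \<in> cimage N j U" for j x
      using pair[OF that] that unfolding potential_pair_def by (simp_all add: fun_eq_iff)
    obtain c c' where "\<forall>q\<in>U. v' q = v q + c" "\<forall>q\<in>U. f0' q = f0 q + c'"
      using unique[OF smv _ d(1)] unique[OF smf0 _ d(2)] * by metis
    then show "\<exists>c c'. \<forall>q\<in>U. v' q = v q + c \<and> f0' q = f0 q + c'" by blast
  qed
qed

end

section \<open>Change of chart on the product with a line\<close>

context chart_atlas begin

lemma cinv_times_line:
  assumes i: "i \<in> index N" and y: "y \<in> cimage N i UNIV"
  shows "cinv (times_line N) i (y, t) = (cinv N i y, t)"
proof -
  have inj: "inj_on (cmap (times_line N) i) (cdom (times_line N) i)"
    by (rule inj_on_inverseI[where g = "\<lambda>(y, t). (cinv N i y, t)"]) (auto simp: times_line_def cinv_cmap[OF i])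
  have "(cinv N i y, t) \<in> cdom (times_line N) i" "cmap (times_line N) i (cinv N i y, t) = (y, t)"
    using cinv_in[OF i y] cmap_cinv[OF i y] by (auto simp: times_line_def)
  then show ?thesis unfolding cinv_def[of "times_line N"] using inv_into_f_eq[OF inj] by blast
qed

lemma diff_transition_times_line:
  assumes i: "i \<in> index N" "j \<in> index N" and x: "x \<in> cimage N i (cdom N j)"
  shows "transition (times_line N) i j (x, t) = (transition N i j x, t)"
    "diff (transition (times_line N) i j) (x, t) V = (diff (transition N i j) x (fst V), snd V)"
proof -
  have tr: "transition (times_line N) i j (y, t) = (transition N i j y, t)" if "y \<in> cimage N i (cdom N j)" for y t
  proof -
    have y: "y \<in> cimage N i UNIV" using that unfolding cimage_def by blast
    have "cmap (times_line N) j = (\<lambda>(p, t). (cmap N j p, t))" by (simp add: times_line_def)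
    then show ?thesis by (simp add: transition_def cinv_times_line[OF i(1) y])
  qed
  then show "transition (times_line N) i j (x, t) = (transition N i j x, t)" using x by blast
  have "((\<lambda>p. (transition N i j (fst p), snd p)) has_derivative (\<lambda>V. (diff (transition N i j) x (fst V), snd V))) (at (x, t))"
    by (intro has_derivative_Pair has_derivative_snd has_derivative_ident
        has_derivative_compose_fst[OF smooth_on_has_derivative[OF smooth_transition(1)[OF i] x]])
  then have "(transition (times_line N) i j has_derivative (\<lambda>V. (diff (transition N i j) x (fst V), snd V))) (at (x, t))"
    by (rule has_derivative_cong_on[OF open_Times[OF smooth_transition(2)[OF i] open_UNIV], rotated 2]) (use x tr in auto)
  then show "diff (transition (times_line N) i j) (x, t) V = (diff (transition N i j) x (fst V), snd V)"
    by (simp add: diff_eq)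
qed

end

section \<open>From soliton flows to solutions on the base\<close>

locale flow_atlas = metric_atlas N h u
  for N :: "('i, 'a::{t2_space,second_countable_topology}, real^3) atlas" and h u +
  fixes A :: "'i \<Rightarrow> real^3 \<Rightarrow> real^3 \<Rightarrow> real" and E :: "'i \<Rightarrow> (real^3) \<times> real \<Rightarrow> (real^3) \<times> real"
    and S :: "'i \<Rightarrow> real^3 \<Rightarrow> real^3" and a :: real
  assumes connected: "connected (UNIV :: 'a set)" and smooth_u: "smooth_function N UNIV u"
    and A: "one_form N UNIV A" "monopole N h UNIV u A" and nonconstant: "\<exists>p q. u p \<noteq> u q"
    and E: "vector_field (times_line N) UNIV E"
    and soliton: "soliton_flow (times_line N) (gh_metric N h u A) UNIV E a"
    and S: "vector_field N UNIV S" and nonzero: "\<exists>i\<in>index N. \<exists>x\<in>cimage N i UNIV. S i x \<noteq> 0"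
    and horizontal: "\<forall>i\<in>index N. \<forall>x\<in>cimage N i UNIV. \<forall>t.
           horizontal_part A E i (x, t) = t *\<^sub>R horizontal_lift A S i (x, t)"
begin

text \<open>The value of \<open>dt + A\<close> on \<open>E\<close>, that is, the coefficient of the
  fibre field once the horizontal part is split off.\<close>

definition vertical :: "'i \<Rightarrow> (real^3) \<times> real \<Rightarrow> real" where
  "vertical i p = snd (E i p) + A i (fst p) (fst (E i p))"

text \<open>The quotient S(u) / u, which turns out to be the constant b.\<close>

definition ratio :: "'i \<Rightarrow> real^3 \<Rightarrow> real" where
  "ratio i x = inverse (rep N i u x) * diff (rep N i u) x (S i x)"

lemma E_eq:
  assumes "i \<in> index N" "x \<in> cimage N i UNIV"
  shows "E i (x, t) = (t *\<^sub>R S i x, vertical i (x, t) - t * A i x (S i x))"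
proof -
  have "horizontal_part A E i (x, t) = t *\<^sub>R horizontal_lift A S i (x, t)" using horizontal assms by blast
  then have *: "E i (x, t) - (snd (E i (x, t)) + A i x (fst (E i (x, t)))) *\<^sub>R (0, 1) = t *\<^sub>R (S i x, - A i x (S i x))"
    by (simp add: horizontal_part_def horizontal_lift_def)
  show ?thesis using arg_cong[OF *, of fst] arg_cong[OF *, of snd]
    by (intro prod_eqI) (simp_all add: vertical_def)
qed

context
  fixes i assumes i: "i \<in> index N"
begin

interpretation chart_monopole "cimage N i UNIV" "h i" "rep N i u" "A i"
  by (rule chart_monopole_at[OF i open_UNIV smooth_u A])

lemma smooth_E: "smooth_on (cimage N i UNIV \<times> UNIV) (E i)"
  using E i cimage_times_line[of N i UNIV] unfolding vector_field_def by (simp add: UNIV_Times_UNIV[symmetric] del: UNIV_Times_UNIV)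

lemma smooth_S: "smooth_on (cimage N i UNIV) (S i)"
  using S i unfolding vector_field_def by blast

lemma vertical_differentiable:
  assumes x: "x \<in> cimage N i UNIV"
  shows "vertical i differentiable (at (x, t))"
proof -
  let ?D = "cimage N i UNIV \<times> (UNIV :: real set)"
  have D: "open ?D" "(x, t) \<in> ?D" using open_D x by (auto intro: open_Times)
  have dE: "(E i has_derivative diff (E i) (x, t)) (at (x, t))" by (rule smooth_on_has_derivative[OF smooth_E D(2)])
  have dA: "(\<lambda>p. A i (fst p) v) differentiable (at (x, t))" for v
    using has_derivative_compose_fst[OF smooth_on_has_derivative[OF smooth_A x]] differentiable_def by blast
  have lA: "linear (A i (fst p))" if "p \<in> ?D" for p using linear_A that by auto
  have "((\<lambda>p. A i (fst p) (fst (E i p))) has_derivative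
      (\<lambda>v. diff (\<lambda>p. A i (fst p) (fst (E i (x, t)))) (x, t) v + A i (fst (x, t)) (fst (diff (E i) (x, t) v)))) (at (x, t))"
    by (rule has_derivative_form[where \<alpha> = "\<lambda>p. A i (fst p)", OF D lA dA has_derivative_fst[OF dE]])
  from has_derivative_add[OF has_derivative_snd[OF dE] this]
  show ?thesis unfolding differentiable_def vertical_def[abs_def] by blast
qed

lemma chart_soliton_tensor:
  "x \<in> cimage N i UNIV \<Longrightarrow> soliton_tensor (gh_form (h i) (rep N i u) (A i)) (E i) a (x, t) V W = 0"
  using soliton i cimage_times_line[of N i UNIV]
  unfolding soliton_flow_def gh_metric_gh_form[symmetric] by (cases V; cases W) (auto simp: UNIV_Times_UNIV[symmetric] simp del: UNIV_Times_UNIV)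

lemma chart_laplacian: "x \<in> cimage N i UNIV \<Longrightarrow> laplacian (h i) (rep N i u) x = 0"
  by (rule curl_divergence_zero)

lemma chart_E: "\<forall>y\<in>cimage N i UNIV. \<forall>t. E i (y, t) = (t *\<^sub>R S i y, vertical i (y, t) - t * A i y (S i y))"
  using E_eq[OF i] by blast

lemma chart_converse:
  assumes x: "x \<in> cimage N i UNIV"
  shows "vertical i (x, t) = vertical i (x, 0) - a * t + 1/4 * ratio i x * t\<^sup>2"
    "(ratio i has_derivative (\<lambda>z. 0)) (at x)"
    "ext_deriv (A i) x (S i x) z = ratio i x / 2 * A i x z"
    "diff (\<lambda>x. vertical i (x, 0)) x z + a * A i x z + rep N i u x * rep N i u x * h i x (S i x) z = 0"
    "diff (rep N i u) x (S i x) * h i x y z + rep N i u x * lie_deriv (S i) (h i) x y z = 0"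
    "ricci (h i) x y z + a * rep N i u x * h i x y z - rep N i u x / 2 * (A i x y * h i x (S i x) z + A i x z * h i x (S i x) y) = 0"
proof -
  note c = soliton_converse[OF chart_laplacian smooth_S vertical_differentiable chart_E chart_soliton_tensor x]
  show "vertical i (x, t) = vertical i (x, 0) - a * t + 1/4 * ratio i x * t\<^sup>2"
    unfolding ratio_def by (rule c(1))
  show "ext_deriv (A i) x (S i x) z = ratio i x / 2 * A i x z"
    unfolding ratio_def by (rule c(3))
  show "diff (\<lambda>x. vertical i (x, 0)) x z + a * A i x z + rep N i u x * rep N i u x * h i x (S i x) z = 0" by (rule c(4))
  show "diff (rep N i u) x (S i x) * h i x y z + rep N i u x * lie_deriv (S i) (h i) x y z = 0" by (rule c(5))
  show "ricci (h i) x y z + a * rep N i u x * h i x y z - rep N i u x / 2 * (A i x y * h i x (S i x) z + A i x z * h i x (S i x) y) = 0" by (rule c(6))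
  have "diff (ratio i) x = (\<lambda>z. 0)" unfolding ratio_def[abs_def] using c(2) by (simp add: fun_eq_iff)
  moreover have "smooth_on (cimage N i UNIV) (ratio i)"
    unfolding ratio_def
    by (intro smooth_on_mult smooth_on_inverse smooth_u open_D u_nonzero
        smooth_on_form[OF open_D smooth_on_linear_diff[OF smooth_u] smooth_on_diff[OF smooth_u] smooth_S])
  ultimately show "(ratio i has_derivative (\<lambda>z. 0)) (at x)"
    using smooth_on_has_derivative[OF _ x, of "ratio i"] by simp
qed

lemma vertical_zero: "x \<in> cimage N i UNIV \<Longrightarrow> vertical i (x, 0) = snd (E i (x, 0))"
  using E_eq[OF i, of x 0] by simp

text \<open>With ratio 0, the equations on the base say that \<open>S\<close> is a Killing field.
  Vanishing on an open set gives a vanishing first jet at \<open>x\<close>, and inside a ball every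
  other point is reached by a segment.\<close>

lemma chart_killing_continuation:
  assumes ratio: "\<And>x. x \<in> cimage N i UNIV \<Longrightarrow> ratio i x = 0"
    and B: "ball c r \<subseteq> cimage N i UNIV" and x: "x \<in> ball c r" "y \<in> ball c r"
    and V: "open V" "x \<in> V" "\<And>z. z \<in> V \<Longrightarrow> z \<in> cimage N i UNIV \<Longrightarrow> S i z = 0"
  shows "S i y = 0"
proof -
  have killing: "lie_deriv (S i) (h i) z v w = 0" if "z \<in> cimage N i UNIV" for z v w
    using chart_converse(5)[OF that, of v w] ratio[OF that] u_nonzero[OF that] by (simp add: ratio_def)
  have xD: "x \<in> cimage N i UNIV" using B x by blast
  have "diff (S i) x = diff (\<lambda>z. 0) x"
    by (rule diff_cong_on[OF open_Int[OF V(1) open_D]]) (use V xD in auto)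
  also have "\<dots> = (\<lambda>v. 0)" by (rule diff_eq[OF has_derivative_const])
  finally have zero: "S i x = 0" "\<And>v. diff (S i) x v = 0" using V xD by auto
  have "x + s *\<^sub>R (y - x) \<in> cimage N i UNIV" if "s \<in> {0..1}" for s
  proof -
    have "(1 - s) *\<^sub>R x + s *\<^sub>R y \<in> ball c r" using convexD_alt[OF convex_ball x, of s] that by simp
    then show ?thesis using B by (auto simp: algebra_simps)
  qed
  from killing_unique_continuation[OF smooth_S killing this zero] show ?thesis by simp
qed

lemma chart_zero:
  assumes ratio: "\<And>x. x \<in> cimage N i UNIV \<Longrightarrow> ratio i x = 0" and x: "x \<in> cimage N i UNIV"
    and d: "diff (rep N i u) x v \<noteq> 0"
  shows "S i x = 0"
proof (rule contraction_zero[OF x _ _ d])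
  show "ext_deriv (A i) x (S i x) z = 0" for z using chart_converse(3)[OF x] ratio[OF x] by simp
  show "diff (rep N i u) x (S i x) = 0" using ratio[OF x] u_nonzero[OF x] by (simp add: ratio_def)
qed

text \<open>\<open>A\<close> takes the role of \<open>B\<close>. The equation for df0 identifies dw
  - aA with \<open>u\<^sup>2\<close> times the metric dual of \<open>S\<close>, so \<open>S\<close>
  is recovered from \<open>w\<close>, and the conditions on \<open>S\<close> become the equations
  for \<open>w\<close>.\<close>

lemma chart_data:
  assumes ratio_eq: "\<forall>x\<in>cimage N i UNIV. ratio i x = b"
    and w_eq: "\<forall>x\<in>cimage N i UNIV. rep N i w x = - vertical i (x, 0)"
    and sw: "smooth_on (cimage N i UNIV) (rep N i w)" and x: "x \<in> cimage N i UNIV"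
  defines "\<delta> \<equiv> diff (rep N i u)" and "gu \<equiv> grad (h i) (rep N i u)" and "gw \<equiv> grad (h i) (rep N i w)"
    and "As \<equiv> sharp_field (h i) (A i)"
  shows "S i x = base_field N h u A w a i x"
    and "rep N i u x * h i x (S i x) z = inverse (rep N i u x) * dw_aB N w A a i x z"
    and "\<delta> x (gw x) = b * rep N i u x ^ 3 + a * \<delta> x (As x)"
    and "cov_deriv (h i) (diff (rep N i w)) x y z = 1/2 * a * lie_deriv As (h i) x y z
      - 1/2 * b * rep N i u x ^ 2 * h i x y z + 2 * inverse (rep N i u x) * sym_prod (\<delta> x) (dw_aB N w A a i x) y z"
    and "cov_deriv (h i) \<delta> x (gw x) z = - inverse (rep N i u x) * h i x (gu x) (gu x) * dw_aB N w A a i x z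
      + 5/2 * b * rep N i u x ^ 2 * \<delta> x z - a * h i x (lie_bracket gu As x) z
      + 1/2 * a * lie_deriv As (h i) x (gu x) z"
proof -
  note b = bspec[OF ratio_eq] and w = bspec[OF w_eq]
  let ?\<beta> = "dw_aB N w A a i"
  have dw: "?\<beta> y z = rep N i u y * rep N i u y * h i y (S i y) z" if y: "y \<in> cimage N i UNIV" for y z
  proof -
    have "(rep N i w has_derivative diff (rep N i w) y) (at y)" by (rule smooth_on_has_derivative[OF sw y])
    from has_derivative_minus[OF this]
    have "((\<lambda>y. - rep N i w y) has_derivative (\<lambda>z. - diff (rep N i w) y z)) (at y)" .
    then have "((\<lambda>y. vertical i (y, 0)) has_derivative (\<lambda>z. - diff (rep N i w) y z)) (at y)"
      by (rule has_derivative_cong_on[OF open_D y, rotated]) (simp add: w)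
    then show ?thesis using chart_converse(4)[OF y, of z] by (simp add: diff_eq dw_aB_def)
  qed
  have S_eq: "S i y = (inverse (rep N i u y) * inverse (rep N i u y)) *\<^sub>R (gw y - a *\<^sub>R As y)" if y: "y \<in> cimage N i UNIV" for y
  proof (rule metric_cancel[OF y])
    fix z
    define j where "j = inverse (rep N i u y)"
    have j: "rep N i u y * j = 1" using u_nonzero[OF y] by (simp add: j_def)
    have "h i y (gw y - a *\<^sub>R As y) z = ?\<beta> y z"
      unfolding gw_def As_def
      by (simp add: metric_simps[OF y] grad_works[OF y smooth_on_differentiable[OF sw y]]
          sharp_field_works[where \<alpha> = "A i", OF y linear_A[OF y]] dw_aB_def)
    then have "h i y ((j * j) *\<^sub>R (gw y - a *\<^sub>R As y)) z = (rep N i u y * j) * (rep N i u y * j) * h i y (S i y) z"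
      by (simp add: metric_simps[OF y] dw[OF y])
    then show "h i y (S i y) z = h i y ((inverse (rep N i u y) * inverse (rep N i u y)) *\<^sub>R (gw y - a *\<^sub>R As y)) z"
      unfolding j by (simp add: j_def)
  qed
  then show "S i x = base_field N h u A w a i x"
    using x by (simp add: base_field_def gw_def As_def power2_eq_square)
  define j where "j = inverse (rep N i u x)"
  have j: "rep N i u x * j = 1" using u_nonzero[OF x] by (simp add: j_def)
  have "j * ?\<beta> x z = (rep N i u x * j) * (rep N i u x * h i x (S i x) z)" for z by (simp add: dw[OF x])
  then show "rep N i u x * h i x (S i x) z = inverse (rep N i u x) * ?\<beta> x z" unfolding j by (simp add: j_def)
  have duS: "\<delta> y (S i y) = b * rep N i u y" if "y \<in> cimage N i UNIV" for y
    using b[OF that] u_nonzero[OF that] by (simp add: ratio_def \<delta>_def field_simps)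
  have first: "\<delta> y (gw y) = b * rep N i u y ^ 3 + a * \<delta> y (As y)" if y: "y \<in> cimage N i UNIV" for y
  proof -
    define k where "k = inverse (rep N i u y)"
    have k: "rep N i u y * k = 1" using u_nonzero[OF y] by (simp add: k_def)
    have "k * k * (\<delta> y (gw y) - a * \<delta> y (As y)) = b * rep N i u y"
      using duS[OF y] unfolding S_eq[OF y] \<delta>_def k_def[symmetric] by (simp add: gh_linear_simps[OF y])
    then have "rep N i u y * rep N i u y * (k * k * (\<delta> y (gw y) - a * \<delta> y (As y))) = b * rep N i u y ^ 3"
      by (simp add: power3_eq_cube)
    then have "(rep N i u y * k) * (rep N i u y * k) * (\<delta> y (gw y) - a * \<delta> y (As y)) = b * rep N i u y ^ 3"
      by (simp only: mult_ac)
    then show ?thesis unfolding k by simp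
  qed
  show "\<delta> x (gw x) = b * rep N i u x ^ 3 + a * \<delta> x (As x)" by (rule first[OF x])
  \<comment> \<open>Here \<open>lie_S_identity\<close> is read backwards: the Lie derivative of the
    metric is known to be - b times the metric, and the identity is solved for the Hessian of
    \<open>w\<close>.\<close>
  have third: "cov_deriv (h i) (diff (rep N i w)) x y z = 1/2 * a * lie_deriv As (h i) x y z
      - 1/2 * b * rep N i u x ^ 2 * h i x y z + inverse (rep N i u x) * (\<delta> x y * ?\<beta> x z + ?\<beta> x y * \<delta> x z)" for y z
  proof -
    have "lie_deriv (S i) (h i) x y z = j * j * (2 * cov_deriv (h i) (diff (rep N i w)) x y z - a * lie_deriv As (h i) x y z)
      - 2 * (j * j * j) * (\<delta> x y * ?\<beta> x z + \<delta> x z * ?\<beta> x y)"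
      unfolding dw_aB_def j_def As_def \<delta>_def
      by (rule lie_S_identity(2)[OF x sw linear_A smooth_A S_eq[unfolded gw_def As_def]])
    moreover have "rep N i u x * (b * h i x y z + lie_deriv (S i) (h i) x y z) = 0"
      using chart_converse(5)[OF x, of y z] duS[OF x] by (simp add: \<delta>_def algebra_simps)
    then have "lie_deriv (S i) (h i) x y z = - b * h i x y z" using u_nonzero[OF x] by simp
    ultimately have "j * j * (2 * cov_deriv (h i) (diff (rep N i w)) x y z - a * lie_deriv As (h i) x y z)
      - 2 * (j * j * j) * (\<delta> x y * ?\<beta> x z + \<delta> x z * ?\<beta> x y) = - b * h i x y z" by simp
    then have "rep N i u x * rep N i u x * (j * j * (2 * cov_deriv (h i) (diff (rep N i w)) x y z - a * lie_deriv As (h i) x y z)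
      - 2 * (j * j * j) * (\<delta> x y * ?\<beta> x z + \<delta> x z * ?\<beta> x y)) = rep N i u x * rep N i u x * (- b * h i x y z)" by simp
    then have "(rep N i u x * j) * (rep N i u x * j) * (2 * cov_deriv (h i) (diff (rep N i w)) x y z - a * lie_deriv As (h i) x y z)
      - 2 * ((rep N i u x * j) * (rep N i u x * j) * j) * (\<delta> x y * ?\<beta> x z + \<delta> x z * ?\<beta> x y) = rep N i u x * rep N i u x * (- b * h i x y z)"
      by (simp only: algebra_simps)
    then show ?thesis unfolding j j_def[symmetric] by (simp add: power2_eq_square algebra_simps)
  qed
  then show "cov_deriv (h i) (diff (rep N i w)) x y z = 1/2 * a * lie_deriv As (h i) x y z
      - 1/2 * b * rep N i u x ^ 2 * h i x y z + 2 * inverse (rep N i u x) * sym_prod (\<delta> x) (?\<beta> x) y z"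
    by (simp add: sym_prod_def)
  show "cov_deriv (h i) \<delta> x (gw x) z = - inverse (rep N i u x) * h i x (gu x) (gu x) * ?\<beta> x z
      + 5/2 * b * rep N i u x ^ 2 * \<delta> x z - a * h i x (lie_bracket gu As x) z
      + 1/2 * a * lie_deriv As (h i) x (gu x) z"
    unfolding dw_aB_def \<delta>_def gu_def gw_def As_def
    by (rule second_equation[OF x sw linear_A smooth_A])
      (use first third in \<open>simp_all add: dw_aB_def \<delta>_def gw_def As_def\<close>)
qed

end

section \<open>From single charts to the connected manifold\<close>

lemma S_transition:
  assumes "i \<in> index N" "j \<in> index N" "x \<in> cimage N i (cdom N j)"
  shows "S j (transition N i j x) = diff (transition N i j) x (S i x)"
  using S assms unfolding vector_field_def by simp

lemma ratio_transition:
  assumes i: "i \<in> index N" "j \<in> index N" and x: "x \<in> cimage N i (cdom N j)"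
  shows "ratio j (transition N i j x) = ratio i x"
proof -
  have x': "x \<in> cimage N i (cdom N j \<inter> UNIV)" using x by simp
  have "smooth_on (cimage N j UNIV) (rep N j u)" using smooth_u i unfolding smooth_function_def by blast
  from diff_rep_transition[OF i open_UNIV x' this] show ?thesis
    by (simp add: ratio_def S_transition[OF i x] rep_transition[OF i x', symmetric])
qed

lemma vertical_transition:
  assumes i: "i \<in> index N" "j \<in> index N" and x: "x \<in> cimage N i (cdom N j)"
  shows "vertical j (transition N i j x, 0) = vertical i (x, 0)"
proof -
  have xU: "x \<in> cimage N i UNIV" "transition N i j x \<in> cimage N j UNIV"
    using x transition_in(1)[OF i, of x UNIV] by (auto simp: cimage_def)
  have "(x, 0) \<in> cimage (times_line N) i (cdom (times_line N) j \<inter> UNIV)"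
    using x cimage_times_line[of N i "cdom N j"] by (simp add: times_line_def)
  then have "E j (transition (times_line N) i j (x, 0)) = diff (transition (times_line N) i j) (x, 0) (E i (x, 0))"
    using E i unfolding vector_field_def by simp
  then show ?thesis
    by (simp add: diff_transition_times_line[OF i x] vertical_zero[OF i(1) xU(1)] vertical_zero[OF i(2) xU(2)])
qed

lemma ratio_constant: "\<exists>b. \<forall>i\<in>index N. \<forall>x\<in>cimage N i UNIV. ratio i x = b"
proof -
  obtain g where g: "\<And>i x. i \<in> index N \<Longrightarrow> x \<in> cimage N i UNIV \<Longrightarrow> rep N i g x = ratio i x"
    using glue_functions[of ratio] ratio_transition by blast
  have "\<exists>c. \<forall>q\<in>UNIV. g q = c"
  proof (rule constant_of_zero_derivative[OF open_UNIV connected])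
    fix i x assume i: "i \<in> index N" and x: "x \<in> cimage N i UNIV"
    show "(rep N i g has_derivative (\<lambda>v. 0)) (at x)"
      by (rule has_derivative_cong_on[OF open_cimage[OF i open_UNIV] x _ chart_converse(2)[OF i x]]) (simp add: g[OF i])
  qed
  then obtain c where "\<And>q. g q = c" by blast
  then have *: "ratio i x = c" if "i \<in> index N" "x \<in> cimage N i UNIV" for i x
    using g[OF that] by (simp add: rep_def)
  show ?thesis by (intro exI[of _ c] ballI) (rule *)
qed

text \<open>If the ratio vanishes, then \<open>S\<close> is a Killing field which vanishes where \<open>du\<close> does not.\<close>

lemma ratio_nonzero:
  assumes b: "\<And>i x. i \<in> index N \<Longrightarrow> x \<in> cimage N i UNIV \<Longrightarrow> ratio i x = b"
  shows "b \<noteq> 0"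
proof
  assume b0: "b = 0"
  have r0: "ratio i x = 0" if "i \<in> index N" "x \<in> cimage N i UNIV" for i x using b[OF that] b0 by simp
  \<comment> \<open>The interior of the zero set of \<open>S\<close>, expressed in all charts at
    once so that it does not depend on a choice of chart.\<close>
  define Z where "Z = {p. \<exists>T. open T \<and> p \<in> T \<and> (\<forall>q\<in>T. \<forall>i\<in>index N. q \<in> cdom N i \<longrightarrow> S i (cmap N i q) = 0)}"
  have indep: "S j (cmap N j q) = 0"
    if "i \<in> index N" "q \<in> cdom N i" "S i (cmap N i q) = 0" "j \<in> index N" "q \<in> cdom N j" for i j q
  proof -
    have x: "cmap N i q \<in> cimage N i (cdom N j)" by (rule cmap_in[OF that(1,2,5)])
    have q: "transition N i j (cmap N i q) = cmap N j q" by (simp add: transition_def cinv_cmap[OF that(1,2)])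
    show ?thesis
      using S_transition[OF that(1,4) x] linear_0[OF smooth_on_linear_diff[OF smooth_transition(1)[OF that(1,4)] x]]
      unfolding q that(3) by (rule trans)
  qed
  have in_Z: "T \<subseteq> Z" if T: "open T" "i \<in> index N" "T \<subseteq> cdom N i" "\<And>q. q \<in> T \<Longrightarrow> S i (cmap N i q) = 0" for T i
  proof
    fix p assume "p \<in> T"
    moreover have "\<forall>q\<in>T. \<forall>j\<in>index N. q \<in> cdom N j \<longrightarrow> S j (cmap N j q) = 0"
    proof (intro ballI impI)
      fix q j assume q: "q \<in> T" and j: "j \<in> index N" "q \<in> cdom N j"
      show "S j (cmap N j q) = 0" by (rule indep[OF T(2) subsetD[OF T(3) q] T(4)[OF q] j])
    qed
    ultimately show "p \<in> Z" unfolding Z_def using T(1) by blast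
  qed
  have "open Z" unfolding open_subopen[of Z]
  proof
    fix p assume "p \<in> Z"
    then obtain T where T: "open T \<and> p \<in> T \<and> (\<forall>q\<in>T. \<forall>i\<in>index N. q \<in> cdom N i \<longrightarrow> S i (cmap N i q) = 0)"
      unfolding Z_def by blast
    then have "T \<subseteq> Z" unfolding Z_def by blast
    then show "\<exists>T. open T \<and> p \<in> T \<and> T \<subseteq> Z" using T by blast
  qed
  \<comment> \<open>If a chart ball around a point met \<open>Z\<close>, continuation along segments
    would make \<open>S\<close> zero on the whole ball, and the point would lie in
    \<open>Z\<close>.\<close>
  moreover have "open (- Z)" unfolding open_subopen[of "- Z"]
  proof
    fix p assume p: "p \<in> - Z"
    obtain i r T where i: "i \<in> index N" and T: "r > 0" "p \<in> T" "open T" "T \<subseteq> cdom N i"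
      "cimage N i T = ball (cmap N i p) r" "cmap N i ` T = ball (cmap N i p) r"
      using chart_ball[OF open_UNIV UNIV_I[of p]] by metis
    have sub: "ball (cmap N i p) r \<subseteq> cimage N i UNIV" unfolding T(5)[symmetric] by (auto simp: cimage_def)
    have "T \<inter> Z = {}"
    proof (rule ccontr)
      assume "T \<inter> Z \<noteq> {}"
      then obtain q where q: "q \<in> T" "q \<in> Z" by blast
      then obtain T' where T': "open T'" "q \<in> T'" "\<forall>q\<in>T'. \<forall>i\<in>index N. q \<in> cdom N i \<longrightarrow> S i (cmap N i q) = 0"
        unfolding Z_def by blast
      have "S i (cmap N i q') = 0" if q': "q' \<in> T" for q'
      proof (rule chart_killing_continuation[OF i r0[OF i] sub _ _ open_cimage[OF i T'(1)]])
        show "cmap N i q \<in> ball (cmap N i p) r" "cmap N i q' \<in> ball (cmap N i p) r" using T(6) q q' by blast+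
        show "cmap N i q \<in> cimage N i T'" using cmap_in[OF i _ T'(2)] q T(4) by blast
        show "S i z = 0" if "z \<in> cimage N i T'" for z
          using T'(3) i that unfolding cimage_def by blast
      qed
      then have "T \<subseteq> Z" using in_Z[OF T(3) i T(4)] by blast
      then show False using p T(2) by blast
    qed
    then show "\<exists>T. open T \<and> p \<in> T \<and> T \<subseteq> - Z" using T by blast
  qed
  ultimately have "Z = {} \<or> - Z = {}"
    using connectedD[OF connected, of Z "- Z"] by auto
  \<comment> \<open>The set where du is nonzero on a fixed coordinate vector is open, and
    \<open>S\<close> vanishes on it by \<open>chart_zero\<close>. If \<open>Z\<close> were empty, du
    would thus vanish everywhere and \<open>u\<close> would be constant.\<close>
  moreover have "Z \<noteq> {}"
  proof
    assume Z: "Z = {}"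
    have "\<exists>c. \<forall>q\<in>UNIV. u q = c"
    proof (rule constant_of_zero_derivative[OF open_UNIV connected])
      fix i x assume i: "i \<in> index N" and x: "x \<in> cimage N i UNIV"
      have su: "smooth_on (cimage N i UNIV) (rep N i u)" using smooth_u i unfolding smooth_function_def by blast
      have "diff (rep N i u) x v = 0" for v
      proof (rule ccontr)
        assume v: "diff (rep N i u) x v \<noteq> 0"
        let ?B = "{y \<in> cimage N i UNIV. diff (rep N i u) y v \<in> - {0}}"
        have B: "open ?B"
          using continuous_open_preimage[OF smooth_on_continuous[OF smooth_on_diff[OF su]] open_cimage[OF i open_UNIV] open_Compl[OF closed_singleton[of 0]], of v]
          by (simp add: vimage_def Int_def)
        have "cinv N i ` ?B \<subseteq> Z"
        proof (rule in_Z[OF open_chart_preimage[OF i B] i])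
          show "cinv N i ` ?B \<subseteq> cdom N i" using cinv_in[OF i, of _ UNIV] by blast
          show "S i (cmap N i q) = 0" if "q \<in> cinv N i ` ?B" for q
          proof -
            obtain y where y: "y \<in> cimage N i UNIV" "diff (rep N i u) y v \<noteq> 0" "q = cinv N i y" using \<open>q \<in> cinv N i ` ?B\<close> by auto
            show ?thesis unfolding y(3) cmap_cinv[OF i y(1)] by (rule chart_zero[OF i r0[OF i] y(1,2)])
          qed
        qed auto
        then show False using x v Z by auto
      qed
      then have zero: "diff (rep N i u) x = (\<lambda>v. 0)" by (rule ext)
      show "(rep N i u has_derivative (\<lambda>v. 0)) (at x)"
        by (rule smooth_on_has_derivative[OF su x, unfolded zero])
    qed
    then show False using nonconstant by (metis UNIV_I)
  qed
  ultimately have Z: "Z = UNIV" by auto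
  obtain i x where i: "i \<in> index N" and x: "x \<in> cimage N i UNIV" "S i x \<noteq> 0" using nonzero by blast
  have "cinv N i x \<in> Z" using Z by blast
  then have "S i (cmap N i (cinv N i x)) = 0" using i cinv_in[OF i x(1)] unfolding Z_def by blast
  then show False using x cmap_cinv[OF i x(1)] by simp
qed

lemma flow_data:
  "\<exists>b B w v f0. b \<noteq> 0 \<and> harmonic_function N h u \<and>
           soliton_data N h UNIV u B w a b \<and>
           smooth_function N UNIV v \<and> smooth_function N UNIV f0 \<and>
           (\<forall>i\<in>index N. \<forall>x\<in>cimage N i UNIV.
              (\<forall>z. A i x z = add_exact N B v i x z) \<and>
              (\<forall>t. E i (x, t) = gh_field N h u A B w f0 a b i (x, t))) \<and>
           base_equation N h UNIV u A B w a"
proof -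
  obtain b where b: "\<And>i x. i \<in> index N \<Longrightarrow> x \<in> cimage N i UNIV \<Longrightarrow> ratio i x = b" using ratio_constant by blast
  obtain f0 where f0: "\<And>i x. i \<in> index N \<Longrightarrow> x \<in> cimage N i UNIV \<Longrightarrow> rep N i f0 x = vertical i (x, 0)"
    using glue_functions[of "\<lambda>i x. vertical i (x, 0)"] vertical_transition by blast
  \<comment> \<open>At t = 0 the horizontal part of \<open>E\<close> vanishes, so \<open>f0\<close>
    is the fibre component of \<open>E\<close> along the zero section and inherits its
    smoothness.\<close>
  have smf0: "smooth_on (cimage N i UNIV) (rep N i f0)" if i: "i \<in> index N" for i
  proof (rule smooth_on_cong[OF open_cimage[OF i open_UNIV]])
    have "smooth_on (cimage N i UNIV) (\<lambda>x. (x, 0::real))"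
      by (rule smooth_onI[OF open_cimage[OF i open_UNIV], of _ "\<lambda>x v. (v, 0)"])
        (auto intro!: derivative_eq_intros smooth_on_const open_cimage[OF i])
    then have "smooth_on (cimage N i UNIV) (\<lambda>x. E i (x, 0))"
      by (intro smooth_on_compose[OF open_cimage[OF i open_UNIV] open_Times[OF open_cimage[OF i open_UNIV] open_UNIV] _ smooth_E[OF i]]) auto
    then show "smooth_on (cimage N i UNIV) (\<lambda>x. snd (E i (x, 0)))"
      by (rule smooth_on_bounded_linear[OF open_cimage[OF i open_UNIV] bounded_linear_snd])
    show "snd (E i (x, 0)) = rep N i f0 x" if "x \<in> cimage N i UNIV" for x
      by (simp add: f0[OF i that] vertical_zero[OF i that])
  qed
  define w where "w = (\<lambda>p. - f0 p)"
  have rep_w: "rep N i w = (\<lambda>x. - rep N i f0 x)" for i by (simp add: rep_def w_def fun_eq_iff)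
  have smw: "smooth_on (cimage N i UNIV) (rep N i w)" if "i \<in> index N" for i
    unfolding rep_w by (rule smooth_on_minus[OF open_cimage[OF that open_UNIV] smf0[OF that]])
  have w: "rep N i w x = - vertical i (x, 0)" if "i \<in> index N" "x \<in> cimage N i UNIV" for i x
    by (simp add: rep_w f0[OF that])
  have ratio_eq: "\<forall>x\<in>cimage N i UNIV. ratio i x = b" if "i \<in> index N" for i using b[OF that] by blast
  have w_eq: "\<forall>x\<in>cimage N i UNIV. rep N i w x = - vertical i (x, 0)" if "i \<in> index N" for i using w[OF that] by blast
  note d = chart_data[where w = w and b = b, OF _ ratio_eq w_eq smw]
  have rep_0: "rep N i (\<lambda>p. 0) = (\<lambda>x. 0)" for i by (simp add: rep_def fun_eq_iff)
  show ?thesis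
  \<comment> \<open>The given \<open>A\<close> itself serves as \<open>B\<close>, so
    \<open>v\<close> can be taken to be zero.\<close>
  proof (rule exI[of _ b], rule exI[of _ A], rule exI[of _ w], rule exI[of _ "\<lambda>p. 0"], rule exI[of _ f0], intro conjI ballI allI)
    show "b \<noteq> 0" by (rule ratio_nonzero[OF b])
    show "harmonic_function N h u"
      unfolding harmonic_function_def using smooth_u chart_laplacian by blast
    show "soliton_data N h UNIV u A w a b"
      unfolding soliton_data_def Let_def
    proof (intro conjI ballI allI A)
      show "smooth_function N UNIV w" unfolding smooth_function_def using smw by blast
    qed (rule d(3) d(4) d(5); assumption)+
    show "smooth_function N UNIV (\<lambda>p. 0)"
      unfolding smooth_function_def rep_0 by (intro ballI smooth_on_const open_cimage open_UNIV)
    show "smooth_function N UNIV f0" unfolding smooth_function_def using smf0 by blast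
    fix i x assume i: "i \<in> index N" and x: "x \<in> cimage N i UNIV"
    show "A i x z = add_exact N A (\<lambda>p. 0) i x z" for z
      by (simp add: add_exact_def rep_0 diff_eq[OF has_derivative_const])
    show "E i (x, t) = gh_field N h u A A w f0 a b i (x, t)" for t
      using d(1)[OF i i i i x] chart_converse(1)[OF i x, of t] b[OF i x]
      by (simp add: E_eq[OF i x] gh_field_def horizontal_lift_def f0[OF i x])
  next
    show "base_equation N h UNIV u A A w a"
      unfolding base_equation_def
    proof (intro ballI allI)
      fix i x y z assume i: "i \<in> index N" and x: "x \<in> cimage N i UNIV"
      have "rep N i u x / 2 * (A i x y * h i x (S i x) z + A i x z * h i x (S i x) y)
          = (A i x y * (rep N i u x * h i x (S i x) z) + A i x z * (rep N i u x * h i x (S i x) y)) / 2"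
        by (simp add: algebra_simps add_divide_distrib)
      also have "\<dots> = inverse (rep N i u x) * sym_prod (A i x) (dw_aB N w A a i x) y z"
        unfolding d(2)[OF i i i i x] by (simp add: sym_prod_def algebra_simps)
      finally show "ricci (h i) x y z + a * rep N i u x * h i x y z -
          inverse (rep N i u x) * sym_prod (A i x) (dw_aB N w A a i x) y z = 0"
        using chart_converse(6)[OF i x, of y z] by simp
    qed
  qed
qed

end

section \<open>Local existence, uniqueness and the converse on an atlas\<close>

theorem theorem4p5:
  fixes N :: "('i, 'a::{t2_space,second_countable_topology}, real^3) atlas"
    and h :: "'i \<Rightarrow> real^3 \<Rightarrow> real^3 \<Rightarrow> real^3 \<Rightarrow> real"
    and u :: "'a \<Rightarrow> real"
  assumes "analytic_manifold N" and "oriented_atlas N"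
    and "analytic_metric N h" and "\<forall>p. u p > 0"
  shows
    "(\<forall>B w a b W.
        harmonic_function N h u \<and> open W \<and> b \<noteq> 0 \<and> soliton_data N h W u B w a b \<longrightarrow>
        (\<forall>p\<in>W. \<exists>U. open U \<and> connected U \<and> p \<in> U \<and> U \<subseteq> W \<and>
          (\<exists>v f0. smooth_function N U v \<and> smooth_function N U f0 \<and>
             (let A = add_exact N B v;
                  g = gh_metric N h u A;
                  E = gh_field N h u A B w f0 a b
              in soliton_along_fibres (times_line N) g (U \<times> UNIV) E a \<and>
                 (soliton_flow (times_line N) g (U \<times> UNIV) E a
                    \<longleftrightarrow> base_equation N h U u A B w a)) \<and>
             (\<forall>v' f0'. smooth_function N U v' \<and> smooth_function N U f0' \<and>
                (let A = add_exact N B v'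
                 in soliton_along_fibres (times_line N) (gh_metric N h u A) (U \<times> UNIV)
                      (gh_field N h u A B w f0' a b) a) \<longrightarrow>
                (\<exists>c c'. \<forall>q\<in>U. v' q = v q + c \<and> f0' q = f0 q + c')))))
     \<and>
     (\<forall>A E S a.
        connected (UNIV :: 'a set) \<and> smooth_function N UNIV u \<and>
        one_form N UNIV A \<and> monopole N h UNIV u A \<and> (\<exists>p q. u p \<noteq> u q) \<and>
        vector_field (times_line N) UNIV E \<and>
        soliton_flow (times_line N) (gh_metric N h u A) UNIV E a \<and>
        vector_field N UNIV S \<and> (\<exists>i\<in>index N. \<exists>x\<in>cimage N i UNIV. S i x \<noteq> 0) \<and>
        (\<forall>i\<in>index N. \<forall>x\<in>cimage N i UNIV. \<forall>t.
           horizontal_part A E i (x, t) = t *\<^sub>R horizontal_lift A S i (x, t)) \<longrightarrow>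
        (\<exists>b B w v f0. b \<noteq> 0 \<and> harmonic_function N h u \<and>
           soliton_data N h UNIV u B w a b \<and>
           smooth_function N UNIV v \<and> smooth_function N UNIV f0 \<and>
           (\<forall>i\<in>index N. \<forall>x\<in>cimage N i UNIV.
              (\<forall>z. A i x z = add_exact N B v i x z) \<and>
              (\<forall>t. E i (x, t) = gh_field N h u A B w f0 a b i (x, t))) \<and>
           base_equation N h UNIV u A B w a))"
proof -
  have M: "metric_atlas N h u"
    using assms by unfold_locales (auto simp: analytic_metric_def)
  show ?thesis
  proof (intro conjI allI impI ballI)
    fix B w a b W p
    assume *: "harmonic_function N h u \<and> open W \<and> b \<noteq> 0 \<and> soliton_data N h W u B w a b" and p: "p \<in> W"
    have "solution_atlas N h u W B w a b"
      by (intro solution_atlas.intro M solution_atlas_axioms.intro) (insert *, (elim conjE, assumption)+)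
    from solution_atlas.local_solution[OF this p]
    show "\<exists>U. open U \<and> connected U \<and> p \<in> U \<and> U \<subseteq> W \<and>
          (\<exists>v f0. smooth_function N U v \<and> smooth_function N U f0 \<and>
             (let A = add_exact N B v;
                  g = gh_metric N h u A;
                  E = gh_field N h u A B w f0 a b
              in soliton_along_fibres (times_line N) g (U \<times> UNIV) E a \<and>
                 (soliton_flow (times_line N) g (U \<times> UNIV) E a
                    \<longleftrightarrow> base_equation N h U u A B w a)) \<and>
             (\<forall>v' f0'. smooth_function N U v' \<and> smooth_function N U f0' \<and>
                (let A = add_exact N B v'
                 in soliton_along_fibres (times_line N) (gh_metric N h u A) (U \<times> UNIV)
                      (gh_field N h u A B w f0' a b) a) \<longrightarrow>
                (\<exists>c c'. \<forall>q\<in>U. v' q = v q + c \<and> f0' q = f0 q + c')))" .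
  next
    fix A E S a
    assume *: "connected (UNIV :: 'a set) \<and> smooth_function N UNIV u \<and>
        one_form N UNIV A \<and> monopole N h UNIV u A \<and> (\<exists>p q. u p \<noteq> u q) \<and>
        vector_field (times_line N) UNIV E \<and>
        soliton_flow (times_line N) (gh_metric N h u A) UNIV E a \<and>
        vector_field N UNIV S \<and> (\<exists>i\<in>index N. \<exists>x\<in>cimage N i UNIV. S i x \<noteq> 0) \<and>
        (\<forall>i\<in>index N. \<forall>x\<in>cimage N i UNIV. \<forall>t.
           horizontal_part A E i (x, t) = t *\<^sub>R horizontal_lift A S i (x, t))"
    have "flow_atlas N h u A E S a"
      by (intro flow_atlas.intro M flow_atlas_axioms.intro) (insert *, (elim conjE, assumption)+)
    from flow_atlas.flow_data[OF this]
    show "\<exists>b B w v f0. b \<noteq> 0 \<and> harmonic_function N h u \<and>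
           soliton_data N h UNIV u B w a b \<and>
           smooth_function N UNIV v \<and> smooth_function N UNIV f0 \<and>
           (\<forall>i\<in>index N. \<forall>x\<in>cimage N i UNIV.
              (\<forall>z. A i x z = add_exact N B v i x z) \<and>
              (\<forall>t. E i (x, t) = gh_field N h u A B w f0 a b i (x, t))) \<and>
           base_equation N h UNIV u A B w a" .
  qed
qed

end
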